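(* For every $j\ge0$ the bimould $\mathfrak G_j$ is swap invariant, i.e. for all $r\ge1$, $$\mathfrak G_j[X_1,\dots,X_r\mid Y_1,\dots,Y_r]=\mathfrak G_j[Y_1+\dots+Y_r,Y_1+\dots+Y_{r-1},\dots,Y_1+Y_2,Y_1\mid X_r,X_{r-1}-X_r,\dots,X_2-X_3,X_1-X_2].$$
   Context: Fixed mould $\beta$: $\beta^{(0)}=1$, $\beta(X_1,\dots,X_r)=\sum_{k_i\ge1}\beta(k_1,\dots,k_r)X_1^{k_1-1}\cdots X_r^{k_r-1}\in\mathbb{Q}[[X_1,\dots,X_r]]$, with: (i) $\beta(X)=-\sum_{k\ge2}\frac{B_k}{2\,k!}X^{k-1}$ ($B_k$ Bernoulli numbers); (ii) $z_{k_1}\cdots z_{k_r}\mapsto\beta(k_1,\dots,k_r)$ is an algebra homomorphism from $\mathbb{Q}\langle z_1,z_2,\dots\rangle$ with the stuffle product to $\mathbb{Q}$; (iii) with $\sum_j\gamma_jT^j=\exp(\sum_{n\ge2}\frac{(-1)^n}{n}\beta(n)T^n)$ and $\beta_\gamma(X_1,\dots,X_r)=\sum_{j=0}^r\gamma_j\beta(X_1+\dots+X_{r-j},\dots,X_1+X_2,X_1)$, the map sending $z_{k_1}\cdots z_{k_r}$ to the coefficient of $X_1^{k_1-1}\cdots X_r^{k_r-1}$ in $\beta_\gamma$ is an algebra homomorphism for the shuffle product. (Quasi-shuffle product for commutative associative $\diamond$: $\mathbf 1\ast w=w\ast\mathbf 1=w$, $aw\ast bv=a(w\ast bv)+b(aw\ast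 v)+(a\diamond b)(w\ast v)$; stuffle: $z_i\diamond z_j=z_{i+j}$; shuffle: $z_i\diamond z_j=0$.) Construction (bimoulds are families of power series $B[X_1,\dots,X_r\mid Y_1,\dots,Y_r]$, $r\ge0$): $\mathfrak b^{(0)}=1$, $\mathfrak b[X_1,\dots,X_r\mid Y_1,\dots,Y_r]=\sum_{0\le i\le j\le r}\gamma_i\beta(Y_1+\dots+Y_{j-i},\dots,Y_1+Y_2,Y_1)\beta(X_{j+1},\dots,X_r)$; $\tilde{\mathfrak b}[X_1,\dots,X_r\mid Y_1,\dots,Y_r]=\sum_{i=0}^r\frac{(-1)^i}{2^ii!}\mathfrak b[X_{i+1},\dots,X_r\mid-Y_1,\dots,-Y_{r-i}]$; $L_m[X\mid Y]=\frac{e^{X+mY}q^m}{1-e^Xq^m}\in\mathbb{Q}[[q]][[X,Y]]$; $\mathfrak L_m[X_1,\dots,X_r\mid Y_1,\dots,Y_r]=\sum_{j=1}^r\mathfrak b[X_1-X_j,\dots,X_{j-1}-X_j\mid Y_1,\dots,Y_{j-1}]L_m[X_j\mid Y_1+\dots+Y_r]\tilde{\mathfrak b}[X_r-X_j,\dots,X_{j+1}-X_j\mid Y_r,\dots,Y_{j+1}]$. $\mathfrak G_0=\mathfrak b$; for $j\ge1$: $\mathfrak G_j^{(r)}=0$ if $j>r$, and for $1\le j\le r$, $\mathfrak G_j[X_1,\dots,X_r\mid Y_1,\dots,Y_r]=\sum_{0=r_0<r_1<\dots<r_j\le r}\sum_{m_1>\dots>m_j>0}\prod_{i=1}^j\mathfrak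 L_{m_i}[X_{r_{i-1}+1},\dots,X_{r_i}\mid Y_{r_{i-1}+1},\dots,Y_{r_i}]\;\mathfrak b[X_{r_j+1},\dots,X_r\mid Y_{r_j+1},\dots,Y_r]$. *)

theory Defs
  imports "HOL-Analysis.Analysis" "HOL-Library.Poly_Mapping"
begin

section \<open>Formal power series in several variables\<close>

text \<open>A monomial in variables of type \<open>'v\<close> is a finite multiset of variables: \<open>count M v\<close> is
  the exponent of \<open>v\<close>, \<open>size M\<close> the total degree, and multiset addition is multiplication of
  monomials. The number of variables is not bounded by the type.\<close>

typedef ('v, 'a) mfps = "UNIV :: ('v multiset \<Rightarrow> 'a) set"
  morphisms mcoeff Abs_mfps ..

lemma mcoeff_Abs [simp]: "mcoeff (Abs_mfps f) = f"
  by (simp add: Abs_mfps_inverse)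

lemma mfps_eqI: "(\<And>M. mcoeff f M = mcoeff g M) \<Longrightarrow> f = g"
  by (metis ext mcoeff_inject)

lemma finite_submultisets [simp]: "finite {A. A \<subseteq># M}"
proof (rule finite_subset)
  show "{A. A \<subseteq># M} \<subseteq> mset ` {xs. set xs \<subseteq> set_mset M \<and> length xs \<le> size M}"
  proof
    fix A assume "A \<in> {A. A \<subseteq># M}"
    then have A: "A \<subseteq># M" by simp
    obtain xs where xs: "mset xs = A" using ex_mset by blast
    then have "set xs \<subseteq> set_mset M" "length xs \<le> size M"
      using A by (auto dest: mset_subset_eqD size_mset_mono)
    with xs show "A \<in> mset ` {xs. set xs \<subseteq> set_mset M \<and> length xs \<le> size M}" by blast
  qed
  show "finite (mset ` {xs. set xs \<subseteq> set_mset M \<and> length xs \<le> size M})"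
    by (intro finite_imageI finite_lists_length_le) simp
qed

instantiation mfps :: (type, comm_ring_1) comm_ring_1
begin

definition "0 = Abs_mfps (\<lambda>M. 0)"
definition "1 = Abs_mfps (\<lambda>M. if M = {#} then 1 else 0)"
definition "f + g = Abs_mfps (\<lambda>M. mcoeff f M + mcoeff g M)"
definition "- f = Abs_mfps (\<lambda>M. - mcoeff f M)"
definition "f - g = Abs_mfps (\<lambda>M. mcoeff f M - mcoeff g M)"
definition "f * g = Abs_mfps (\<lambda>M. \<Sum>A\<in>{A. A \<subseteq># M}. mcoeff f A * mcoeff g (M - A))"

instance
proof
  fix f g h :: "('a, 'b) mfps"
  show "f * g * h = f * (g * h)"
  proof (rule mfps_eqI)
    fix M :: "'a multiset"
    have "mcoeff (f * g * h) M =
        (\<Sum>(A, B)\<in>(SIGMA A:{A. A \<subseteq># M}. {B. B \<subseteq># A}).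
           mcoeff f B * mcoeff g (A - B) * mcoeff h (M - A))"
      by (simp add: times_mfps_def sum_distrib_right sum.Sigma)
    also have "\<dots> = (\<Sum>(B, C)\<in>(SIGMA B:{B. B \<subseteq># M}. {C. C \<subseteq># M - B}).
           mcoeff f B * (mcoeff g C * mcoeff h (M - B - C)))"
    proof (rule sum.reindex_bij_witness[where i = "\<lambda>(B, C). (B + C, B)" and j = "\<lambda>(A, B). (B, A - B)"])
      fix p assume "p \<in> (SIGMA A:{A. A \<subseteq># M}. {B. B \<subseteq># A})"
      then obtain A B where p: "p = (A, B)" "A \<subseteq># M" "B \<subseteq># A" by auto
      have 1: "B + (A - B) = A" and 2: "B \<subseteq># M" and 3: "A - B \<subseteq># M - B"
        and 4: "M - B - (A - B) = M - A"
        using p(2,3) by (auto simp: subseteq_mset_def multiset_eq_iff intro: order_trans diff_le_mono)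
      show "(case case p of (A, B) \<Rightarrow> (B, A - B) of (B, C) \<Rightarrow> (B + C, B)) = p"
        and "(case p of (A, B) \<Rightarrow> (B, A - B)) \<in> (SIGMA B:{B. B \<subseteq># M}. {C. C \<subseteq># M - B})"
        and "(case case p of (A, B) \<Rightarrow> (B, A - B) of (B, C) \<Rightarrow>
            mcoeff f B * (mcoeff g C * mcoeff h (M - B - C))) =
          (case p of (A, B) \<Rightarrow> mcoeff f B * mcoeff g (A - B) * mcoeff h (M - A))"
        using 1 2 3 4 by (auto simp: p(1) mult.assoc)
    next
      fix p assume "p \<in> (SIGMA B:{B. B \<subseteq># M}. {C. C \<subseteq># M - B})"
      then obtain B C where p: "p = (B, C)" "B \<subseteq># M" "C \<subseteq># M - B" by auto
      have "B + C \<subseteq># M"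
        using p(2,3) by (metis add.commute subset_mset.le_diff_conv2)
      then show "(case case p of (B, C) \<Rightarrow> (B + C, B) of (A, B) \<Rightarrow> (B, A - B)) = p"
        and "(case p of (B, C) \<Rightarrow> (B + C, B)) \<in> (SIGMA A:{A. A \<subseteq># M}. {B. B \<subseteq># A})"
        by (auto simp: p(1))
    qed
    also have "\<dots> = mcoeff (f * (g * h)) M"
      by (simp add: times_mfps_def sum_distrib_left sum.Sigma)
    finally show "mcoeff (f * g * h) M = mcoeff (f * (g * h)) M" .
  qed
  show "f * g = g * f"
  proof (rule mfps_eqI)
    fix M :: "'a multiset"
    have *: "M - (M - A) = A" if "A \<subseteq># M" for A
      using that by (simp add: subseteq_mset_def multiset_eq_iff)
    show "mcoeff (f * g) M = mcoeff (g * f) M"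
      unfolding times_mfps_def mcoeff_Abs
      by (rule sum.reindex_bij_witness[where i = "\<lambda>A. M - A" and j = "\<lambda>A. M - A"])
         (auto simp: * mult.commute)
  qed
  show "1 * f = f"
  proof (rule mfps_eqI)
    fix M :: "'a multiset"
    have "mcoeff (1 * f) M = (\<Sum>A\<in>{A. A \<subseteq># M}. if A = {#} then mcoeff f M else 0)"
      unfolding times_mfps_def one_mfps_def mcoeff_Abs by (rule sum.cong) auto
    then show "mcoeff (1 * f) M = mcoeff f M" by simp
  qed
  show "(f + g) * h = f * h + g * h"
    by (rule mfps_eqI) (simp add: times_mfps_def plus_mfps_def sum.distrib distrib_right)
  show "(0 :: ('a, 'b) mfps) \<noteq> 1"
  proof
    assume "(0 :: ('a, 'b) mfps) = 1"
    then have "mcoeff (0 :: ('a, 'b) mfps) {#} = mcoeff 1 {#}" by simp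
    then show False by (simp add: zero_mfps_def one_mfps_def)
  qed
qed (auto intro!: mfps_eqI simp: plus_mfps_def zero_mfps_def uminus_mfps_def minus_mfps_def
      algebra_simps)

end

definition mconst :: "'a::zero \<Rightarrow> ('v, 'a) mfps" where
  "mconst c = Abs_mfps (\<lambda>M. if M = {#} then c else 0)"

definition mvar :: "'v \<Rightarrow> ('v, 'a::zero_neq_one) mfps" where
  "mvar v = Abs_mfps (\<lambda>M. if M = {#v#} then 1 else 0)"

text \<open>Substitution \<open>v \<mapsto> \<sigma> v\<close>, meant for \<open>f\<close> in finitely many variables and \<open>\<sigma> v\<close> without
  constant term: then the product over \<open>N\<close> has no terms of degree below \<open>size N\<close>, so the
  restriction on \<open>size N\<close> drops only zero summands and leaves a finite sum.\<close>

definition msubst :: "('v \<Rightarrow> ('w, 'a) mfps) \<Rightarrow> ('v, 'a::comm_ring_1) mfps \<Rightarrow> ('w, 'a) mfps" where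
  "msubst \<sigma> f = Abs_mfps (\<lambda>M. \<Sum>N | mcoeff f N \<noteq> 0 \<and> size N \<le> size M.
     mcoeff f N * mcoeff (\<Prod>v\<in>#N. \<sigma> v) M)"

text \<open>\<open>e\<^sup>f = \<Sum>\<^sub>n f\<^sup>n / n!\<close> for \<open>f\<close> without constant term; again only zero summands are dropped.\<close>

definition mexp :: "('v, rat) mfps \<Rightarrow> ('v, rat) mfps" where
  "mexp f = Abs_mfps (\<lambda>M. \<Sum>n\<le>size M. mcoeff (f ^ n) M / fact n)"

text \<open>The quotient \<open>f / g\<close>; meant for \<open>g\<close> a unit, so that the quotient exists and is unique.\<close>

definition mquot :: "('v, 'a::comm_ring_1) mfps \<Rightarrow> ('v, 'a) mfps \<Rightarrow> ('v, 'a) mfps" where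
  "mquot f g = (THE h. h * g = f)"

text \<open>The inclusion of series over \<open>\<rat>\<close> into series over \<open>\<rat>[[q]]\<close>, where \<open>q\<close> is \<open>fps_X\<close>.\<close>

definition to_q :: "('v, rat) mfps \<Rightarrow> ('v, rat fps) mfps" where
  "to_q f = Abs_mfps (\<lambda>M. fps_const (mcoeff f M))"

text \<open>Infinite sums of series over \<open>\<rat>[[q]]\<close>: each coefficient is summed in the q-adic topology,
  i.e. the library's metric on formal power series.\<close>

definition msum_q :: "('i \<Rightarrow> ('v, rat fps) mfps) \<Rightarrow> 'i set \<Rightarrow> ('v, rat fps) mfps" where
  "msum_q f I = Abs_mfps (\<lambda>M. infsum (\<lambda>i. mcoeff (f i) M) I)"


section \<open>Moulds and bimoulds\<close>

datatype var = Xvar nat | Yvar nat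

abbreviation sX :: "nat \<Rightarrow> (var, 'a::zero_neq_one) mfps" where "sX i \<equiv> mvar (Xvar i)"
abbreviation sY :: "nat \<Rightarrow> (var, 'a::zero_neq_one) mfps" where "sY i \<equiv> mvar (Yvar i)"

text \<open>The component \<open>B r\<close> of depth \<open>r\<close> is a series in \<open>X\<^sub>1, \<dots>, X\<^sub>r, Y\<^sub>1, \<dots>, Y\<^sub>r\<close> (for moulds:
  in \<open>X\<^sub>1, \<dots>, X\<^sub>r\<close>); variables are indexed from 1. \<open>mould_at F xs\<close> is \<open>F(xs)\<close> and
  \<open>bimould_at B xs ys\<close> is \<open>B[xs | ys]\<close>, for lists of series without constant term.\<close>

type_synonym 'a bimould = "nat \<Rightarrow> (var, 'a) mfps"

definition mould_at :: "'a::comm_ring_1 bimould \<Rightarrow> (var, 'a) mfps list \<Rightarrow> (var, 'a) mfps" where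
  "mould_at F xs =
     msubst (\<lambda>v. case v of Xvar i \<Rightarrow> xs ! (i - 1) | Yvar i \<Rightarrow> sY i) (F (length xs))"

definition bimould_at ::
    "'a::comm_ring_1 bimould \<Rightarrow> (var, 'a) mfps list \<Rightarrow> (var, 'a) mfps list \<Rightarrow> (var, 'a) mfps" where
  "bimould_at B xs ys =
     msubst (\<lambda>v. case v of Xvar i \<Rightarrow> xs ! (i - 1) | Yvar i \<Rightarrow> ys ! (i - 1)) (B (length xs))"

text \<open>\<open>B[X\<^sub>1, \<dots>, X\<^sub>r | Y\<^sub>1, \<dots>, Y\<^sub>r]
  = B[Y\<^sub>1 + \<dots> + Y\<^sub>r, \<dots>, Y\<^sub>1 + Y\<^sub>2, Y\<^sub>1 | X\<^sub>r, X\<^sub>r\<^sub>-\<^sub>1 - X\<^sub>r, \<dots>, X\<^sub>1 - X\<^sub>2]\<close>\<close>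

definition swap_invariant :: "'a::comm_ring_1 bimould \<Rightarrow> bool" where
  "swap_invariant B \<longleftrightarrow> (\<forall>r\<ge>1. B r = bimould_at B
     (map (\<lambda>k. \<Sum>l=1..k. sY l) (rev [1..<r+1]))
     (sX r # map (\<lambda>k. sX k - sX (k+1)) (rev [1..<r])))"


section \<open>Quasi-shuffle products\<close>

text \<open>Elements of \<open>\<rat>\<langle>z\<^sub>1, z\<^sub>2, \<dots>\<rangle>\<close>: finitely supported rational combinations of words, the word
  \<open>z\<^bsub>k1\<^esub> \<dots> z\<^bsub>kr\<^esub>\<close> being the list \<open>[k1, \<dots>, kr]\<close> of positive numbers. Finitely supported combinations
  of letters are represented in the same way.\<close>

definition nc_polys :: "(nat list \<Rightarrow>\<^sub>0 rat) set" where
  "nc_polys = {p. \<forall>w\<in>Poly_Mapping.keys p. 0 \<notin> set w}"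

definition pm_scale :: "rat \<Rightarrow> ('k \<Rightarrow>\<^sub>0 rat) \<Rightarrow> ('k \<Rightarrow>\<^sub>0 rat)" where
  "pm_scale c p = Poly_Mapping.map (\<lambda>x. c * x) p"

definition prepend :: "nat \<Rightarrow> (nat list \<Rightarrow>\<^sub>0 rat) \<Rightarrow> (nat list \<Rightarrow>\<^sub>0 rat)" where
  "prepend a p = (\<Sum>w\<in>Poly_Mapping.keys p. Poly_Mapping.single (a # w) (Poly_Mapping.lookup p w))"

fun qsh_words :: "(nat \<Rightarrow> nat \<Rightarrow> (nat \<Rightarrow>\<^sub>0 rat)) \<Rightarrow> nat list \<Rightarrow> nat list \<Rightarrow> (nat list \<Rightarrow>\<^sub>0 rat)" where
  "qsh_words d [] w = Poly_Mapping.single w 1"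
| "qsh_words d w [] = Poly_Mapping.single w 1"
| "qsh_words d (a # w) (b # v) =
     prepend a (qsh_words d w (b # v)) + prepend b (qsh_words d (a # w) v)
     + (\<Sum>c\<in>Poly_Mapping.keys (d a b).
          pm_scale (Poly_Mapping.lookup (d a b) c) (prepend c (qsh_words d w v)))"

definition qsh :: "(nat \<Rightarrow> nat \<Rightarrow> (nat \<Rightarrow>\<^sub>0 rat)) \<Rightarrow>
    (nat list \<Rightarrow>\<^sub>0 rat) \<Rightarrow> (nat list \<Rightarrow>\<^sub>0 rat) \<Rightarrow> (nat list \<Rightarrow>\<^sub>0 rat)" where
  "qsh d p q = (\<Sum>w\<in>Poly_Mapping.keys p. \<Sum>v\<in>Poly_Mapping.keys q.
     pm_scale (Poly_Mapping.lookup p w * Poly_Mapping.lookup q v) (qsh_words d w v))"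

definition stuffle_diamond :: "nat \<Rightarrow> nat \<Rightarrow> (nat \<Rightarrow>\<^sub>0 rat)" where
  "stuffle_diamond i j = Poly_Mapping.single (i + j) 1"

definition shuffle_diamond :: "nat \<Rightarrow> nat \<Rightarrow> (nat \<Rightarrow>\<^sub>0 rat)" where
  "shuffle_diamond i j = 0"

definition linear_ext :: "(nat list \<Rightarrow> rat) \<Rightarrow> (nat list \<Rightarrow>\<^sub>0 rat) \<Rightarrow> rat" where
  "linear_ext \<phi> p = (\<Sum>w\<in>Poly_Mapping.keys p. Poly_Mapping.lookup p w * \<phi> w)"

text \<open>The linear extension of \<open>\<phi>\<close> is an algebra homomorphism to \<open>\<rat>\<close> for the quasi-shuffle
  product given by \<open>d\<close>.\<close>

definition qsh_hom :: "(nat \<Rightarrow> nat \<Rightarrow> (nat \<Rightarrow>\<^sub>0 rat)) \<Rightarrow> (nat list \<Rightarrow> rat) \<Rightarrow> bool" where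
  "qsh_hom d \<phi> \<longleftrightarrow> linear_ext \<phi> (Poly_Mapping.single [] 1) = 1 \<and>
     (\<forall>p\<in>nc_polys. \<forall>q\<in>nc_polys. linear_ext \<phi> (qsh d p q) = linear_ext \<phi> p * linear_ext \<phi> q)"


section \<open>The mould \<open>\<beta>\<close>\<close>

text \<open>\<open>\<Sum>\<^sub>n B\<^sub>n T\<^sup>n / n! = T / (e\<^sup>T - 1)\<close>\<close>

definition bernoulli_num :: "nat \<Rightarrow> rat" where
  "bernoulli_num n = fact n * fps_nth (fps_X / (fps_exp 1 - 1)) n"

text \<open>A mould is given by its coefficients \<open>\<beta>(k\<^sub>1, \<dots>, k\<^sub>r)\<close>, \<open>k\<^sub>i \<ge> 1\<close>, and \<open>gen \<beta> r\<close> is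
  \<open>\<Sum> \<beta>(k\<^sub>1, \<dots>, k\<^sub>r) X\<^sub>1^(k\<^sub>1 - 1) \<dots> X\<^sub>r^(k\<^sub>r - 1)\<close>. Values of \<open>\<beta>\<close> on lists containing 0 are
  never used.\<close>

definition gen :: "(nat list \<Rightarrow> rat) \<Rightarrow> rat bimould" where
  "gen \<beta> r = Abs_mfps (\<lambda>M. if set_mset M \<subseteq> Xvar ` {1..r}
     then \<beta> (map (\<lambda>i. count M (Xvar i) + 1) [1..<r+1]) else 0)"

definition gam :: "(nat list \<Rightarrow> rat) \<Rightarrow> nat \<Rightarrow> rat" where
  "gam \<beta> j = fps_nth (fps_compose (fps_exp 1)
     (Abs_fps (\<lambda>n. if n \<ge> 2 then (-1) ^ n / of_nat n * \<beta> [n] else 0))) j"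

definition beta_gam :: "(nat list \<Rightarrow> rat) \<Rightarrow> rat bimould" where
  "beta_gam \<beta> r = (\<Sum>j=0..r. mconst (gam \<beta> j) *
     mould_at (gen \<beta>) (map (\<lambda>k. \<Sum>l=1..k. sX l) (rev [1..<r-j+1])))"

text \<open>The coefficient of \<open>X\<^sub>1^(k\<^sub>1 - 1) \<dots> X\<^sub>r^(k\<^sub>r - 1)\<close> in the depth \<open>r\<close> component.\<close>

definition mould_coeff :: "rat bimould \<Rightarrow> nat list \<Rightarrow> rat" where
  "mould_coeff F ks = mcoeff (F (length ks))
     (\<Sum>i=1..length ks. replicate_mset (ks ! (i - 1) - 1) (Xvar i))"


section \<open>The bimoulds \<open>\<GG>\<^sub>j\<close>\<close>

definition bm_b :: "(nat list \<Rightarrow> rat) \<Rightarrow> rat bimould" where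
  "bm_b \<beta> r = (\<Sum>j=0..r. \<Sum>i=0..j. mconst (gam \<beta> i)
     * mould_at (gen \<beta>) (map (\<lambda>k. \<Sum>l=1..k. sY l) (rev [1..<j-i+1]))
     * mould_at (gen \<beta>) (map sX [j+1..<r+1]))"

definition bm_bt :: "(nat list \<Rightarrow> rat) \<Rightarrow> rat bimould" where
  "bm_bt \<beta> r = (\<Sum>i=0..r. mconst ((-1) ^ i / (2 ^ i * fact i))
     * bimould_at (bm_b \<beta>) (map sX [i+1..<r+1]) (map (\<lambda>k. - sY k) [1..<r-i+1]))"

text \<open>\<open>L\<^sub>m[X\<^sub>1 | Y\<^sub>1] = e^(X\<^sub>1 + m Y\<^sub>1) q\<^sup>m / (1 - e^X\<^sub>1 q\<^sup>m)\<close>. For \<open>m \<ge> 1\<close> the denominator is a unit,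
  as its constant term \<open>1 - q\<^sup>m\<close> is one in \<open>\<rat>[[q]]\<close>. Only depth 1 is meaningful.\<close>

definition bm_L :: "nat \<Rightarrow> rat fps bimould" where
  "bm_L m r = mquot (to_q (mexp (sX 1 + of_nat m * sY 1)) * mconst (fps_X ^ m))
     (1 - to_q (mexp (sX 1)) * mconst (fps_X ^ m))"

definition bm_LL :: "(nat list \<Rightarrow> rat) \<Rightarrow> nat \<Rightarrow> rat fps bimould" where
  "bm_LL \<beta> m r = (\<Sum>j=1..r.
       to_q (bimould_at (bm_b \<beta>) (map (\<lambda>k. sX k - sX j) [1..<j]) (map sY [1..<j]))
     * bimould_at (bm_L m) [sX j] [\<Sum>l=1..r. sY l]
     * to_q (bimould_at (bm_bt \<beta>) (map (\<lambda>k. sX k - sX j) (rev [j+1..<r+1]))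
                                  (map sY (rev [j+1..<r+1]))))"

text \<open>In the sum, \<open>rs = [r\<^sub>0, \<dots>, r\<^sub>j]\<close> and \<open>ms = [m\<^sub>1, \<dots>, m\<^sub>j]\<close>.\<close>

definition bm_G :: "(nat list \<Rightarrow> rat) \<Rightarrow> nat \<Rightarrow> rat fps bimould" where
  "bm_G \<beta> j r =
    (if j = 0 then to_q (bm_b \<beta> r)
     else if j > r then 0
     else \<Sum>rs | length rs = j + 1 \<and> rs ! 0 = 0 \<and> sorted_wrt (<) rs \<and> rs ! j \<le> r.
       msum_q (\<lambda>ms.
           (\<Prod>i=1..j. bimould_at (bm_LL \<beta> (ms ! (i - 1)))
              (map sX [rs ! (i - 1) + 1..<rs ! i + 1]) (map sY [rs ! (i - 1) + 1..<rs ! i + 1]))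
           * to_q (bimould_at (bm_b \<beta>) (map sX [rs ! j + 1..<r + 1]) (map sY [rs ! j + 1..<r + 1])))
         {ms. length ms = j \<and> sorted_wrt (>) ms \<and> (\<forall>m\<in>set ms. m > 0)})"

end

theory Submission
  imports Defs
begin

text \<open>Expanding the geometric series gives \<open>L\<^sub>m[X | Y] = \<Sum>\<^sub>d\<^sub>\<ge>\<^sub>1 e\<^bsup>dX + mY\<^esup> q\<^bsup>md\<^esup>\<close>, so
  \<open>\<GG>\<^sub>j\<close> is a sum over data \<open>0 = r\<^sub>0 < s\<^sub>1 \<le> r\<^sub>1 < s\<^sub>2 \<le> \<dots> \<le> r\<^sub>j < s\<^bsub>j+1\<^esub> = r + 1\<close>,
  \<open>m\<^sub>1 > \<dots> > m\<^sub>j > 0\<close>, \<open>d\<^sub>1, \<dots>, d\<^sub>j \<ge> 1\<close>. The pairs \<open>(m\<^sub>i, d\<^sub>i)\<close> are the parts and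
  multiplicities of a partition of the exponent of \<open>q\<close>. The swap permutes the summands: it
  conjugates the partition and replaces \<open>r\<^sub>k\<close> by \<open>r + 1 - s\<^bsub>j+1-k\<^esub>\<close> and \<open>s\<^sub>k\<close> by
  \<open>r + 1 - r\<^bsub>j+1-k\<^esub>\<close>. The exponents of \<open>e\<close> match by summation by parts; the factors \<open>\<bb>\<close> in
  the gaps \<open>(r\<^bsub>k-1\<^esub>, s\<^sub>k)\<close> match because \<open>\<bb>\<close> is swap invariant by the symmetry of its
  defining sum, and the factors \<open>\<bb>\<close> with tilde in the gaps \<open>(s\<^sub>k, r\<^sub>k)\<close> by a signed variant of
  this invariance. The infinite sums are compared modulo \<open>q\<^bsup>N+1\<^esup>\<close> for every \<open>N\<close>, where they
  are finite.\<close>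

text \<open>Swap invariance cannot be matched m by m: conjugation turns multiplicities into parts,
  so the sum over the m_i and the geometric series inside each \<open>bm_L\<close> have to be opened
  together before terms can be paired. Truncating where these sums arise, at m_i \<le> N and d_i
  \<le> N, gives a box that conjugation does not preserve, since the new parts are sums of the d_i.
  The weight, the sum of the m_i d_i, is preserved, and box terms of weight above N vanish modulo
  q^(N+1); hence the index set is cut off by weight.

  The swap is one simultaneous substitution. With X_(r+1) = 0 it exchanges X_k and Y_1 + ... +
  Y_(r+1-k), which is why every factor is rewritten in these two families. Substitution is used as a
  ring homomorphism on series in finitely many variables, with images free of constant terms; the
  bookkeeping of variables secures this, also for series given by a quotient or an infinite
  sum.\<close>

unbundle no vec_syntax and fps_syntax

section \<open>Calculus of multivariate series: supports, orders, substitution, exponential\<close>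

section \<open>Coefficients\<close>

lemma mcoeff_simps [simp]:
  "mcoeff 0 M = 0"
  "mcoeff 1 M = (if M = {#} then 1 else 0)"
  "mcoeff (f + g) M = mcoeff f M + mcoeff g M"
  "mcoeff (- f) M = - mcoeff f M"
  "mcoeff (f - g) M = mcoeff f M - mcoeff g M"
  "mcoeff (mconst c) M = (if M = {#} then c else 0)"
  "mcoeff (to_q h) M = fps_const (mcoeff h M)"
  by (simp_all add: zero_mfps_def one_mfps_def plus_mfps_def uminus_mfps_def minus_mfps_def
      mconst_def to_q_def)

lemma mcoeff_mvar: "mcoeff (mvar v) M = (if M = {#v#} then 1 else 0)"
  by (simp add: mvar_def)

lemma mcoeff_mult: "mcoeff (f * g) M = (\<Sum>A | A \<subseteq># M. mcoeff f A * mcoeff g (M - A))"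
  by (simp add: times_mfps_def)

lemma mcoeff_sum: "mcoeff (sum f I) M = (\<Sum>i\<in>I. mcoeff (f i) M)"
  by (induction I rule: infinite_finite_induct) auto

lemma mcoeff_mconst_mult [simp]: "mcoeff (mconst c * f) M = c * mcoeff f M"
proof -
  have "mcoeff (mconst c * f) M = (\<Sum>A | A \<subseteq># M. if A = {#} then c * mcoeff f M else 0)"
    unfolding mcoeff_mult by (rule sum.cong) auto
  then show ?thesis by simp
qed

lemma mconst_simps:
  "mconst 0 = 0" "mconst 1 = 1"
  "mconst (a * b) = mconst a * mconst b"
  "mconst (a + b) = mconst a + mconst b"
  by (rule mfps_eqI; simp)+

lemma mconst_prod: "mconst (prod f I) = (\<Prod>i\<in>I. mconst (f i))"
  by (induction I rule: infinite_finite_induct) (auto simp: mconst_simps)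

section \<open>Variables and orders\<close>

text \<open>The type allows infinitely many variables, and then the sum in \<open>msubst\<close> may
  run over an infinite set and default to 0. Finiteness of this set excludes that.\<close>

definition mvars :: "('v, 'a::zero) mfps \<Rightarrow> 'v set" where
  "mvars f = (\<Union>N\<in>{N. mcoeff f N \<noteq> 0}. set_mset N)"

definition mord_ge :: "nat \<Rightarrow> ('v, 'a::zero) mfps \<Rightarrow> bool" where
  "mord_ge n f \<longleftrightarrow> (\<forall>M. size M < n \<longrightarrow> mcoeff f M = 0)"

definition noconst :: "('v, 'a::zero) mfps \<Rightarrow> bool" where
  "noconst f \<longleftrightarrow> mcoeff f {#} = 0"

lemma mvarsD: "mcoeff f N \<noteq> 0 \<Longrightarrow> set_mset N \<subseteq> mvars f"
  by (auto simp: mvars_def)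

lemma mvars_subsetI: "(\<And>N. mcoeff f N \<noteq> 0 \<Longrightarrow> set_mset N \<subseteq> V) \<Longrightarrow> mvars f \<subseteq> V"
  by (auto simp: mvars_def)

lemma mcoeff_multE:
  assumes "mcoeff (f * g) M \<noteq> 0"
  obtains A B where "M = A + B" "mcoeff f A \<noteq> 0" "mcoeff g B \<noteq> 0"
proof -
  obtain A where "A \<subseteq># M" "mcoeff f A * mcoeff g (M - A) \<noteq> 0"
    using assms unfolding mcoeff_mult by (metis (mono_tags, lifting) mem_Collect_eq sum.neutral)
  then show ?thesis
    by (intro that[of A "M - A"]) auto
qed

lemma mvars_0 [simp]: "mvars 0 = {}"
  by (auto simp: mvars_def)

lemma mvars_1 [simp]: "mvars (1 :: ('v, 'a::comm_ring_1) mfps) = {}"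
  by (auto simp: mvars_def split: if_splits)

lemma mvars_mconst [simp]: "mvars (mconst c) = {}"
  by (auto simp: mvars_def split: if_splits)

lemma mvars_mvar [simp]: "mvars (mvar v :: ('v, 'a::zero_neq_one) mfps) = {v}"
  by (auto simp: mvars_def mcoeff_mvar split: if_splits)

lemma mvars_to_q [simp]: "mvars (to_q f) = mvars f"
  by (auto simp: mvars_def)

lemma mvars_add: "mvars (f + g) \<subseteq> mvars f \<union> mvars g"
  by (rule mvars_subsetI) (metis Un_iff add.right_neutral mcoeff_simps(3) mvarsD subset_iff)

lemma mvars_uminus [simp]: "mvars (- f) = mvars (f :: ('v, 'a::comm_ring_1) mfps)"
  by (simp add: mvars_def)

lemma mvars_minus: "mvars (f - g) \<subseteq> mvars f \<union> mvars g"
  using mvars_add[of f "- g"] by simp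

lemma mvars_mult: "mvars (f * g) \<subseteq> mvars f \<union> mvars g"
proof (rule mvars_subsetI)
  fix N assume "mcoeff (f * g) N \<noteq> 0"
  then show "set_mset N \<subseteq> mvars f \<union> mvars g"
    by (elim mcoeff_multE) (use mvarsD in fastforce)
qed

lemma mvars_sum: "(\<And>i. i \<in> I \<Longrightarrow> mvars (f i) \<subseteq> V) \<Longrightarrow> mvars (sum f I) \<subseteq> V"
proof (induction I rule: infinite_finite_induct)
  case (insert x F)
  then show ?case using mvars_add[of "f x" "sum f F"] by auto
qed auto

lemma mvars_prod: "(\<And>i. i \<in> I \<Longrightarrow> mvars (f i) \<subseteq> V) \<Longrightarrow> mvars (prod f I) \<subseteq> V"
proof (induction I rule: infinite_finite_induct)
  case (insert x F)
  then show ?case using mvars_mult[of "f x" "prod f F"] by auto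
qed auto

lemma mvars_prod_mset: "(\<And>v. v \<in># N \<Longrightarrow> mvars (f v) \<subseteq> V) \<Longrightarrow> mvars (\<Prod>v\<in>#N. f v) \<subseteq> V"
proof (induction N)
  case (add x F)
  then show ?case using mvars_mult[of "f x" "\<Prod>v\<in>#F. f v"] by auto
qed auto

lemma mvars_power: "mvars (f ^ n) \<subseteq> mvars f"
proof (induction n)
  case (Suc n)
  then show ?case using mvars_mult[of f "f ^ n"] by auto
qed auto

lemma mvars_of_nat [simp]: "mvars (of_nat n :: ('v, 'a::comm_ring_1) mfps) = {}"
proof (induction n)
  case (Suc n)
  then show ?case using mvars_add[of 1 "of_nat n :: ('v, 'a) mfps"] by auto
qed auto

lemmas mvars_le = order_trans[OF mvars_add Un_least] order_trans[OF mvars_minus Un_least]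
  order_trans[OF mvars_mult Un_least] mvars_sum mvars_prod

lemma noconst_imp_mord_ge: "noconst f \<Longrightarrow> mord_ge 1 f"
  by (auto simp: mord_ge_def noconst_def)

lemma noconst_simps [simp]:
  "noconst 0" "noconst (mvar v)" "noconst (- f) \<longleftrightarrow> noconst f" "noconst (to_q h) \<longleftrightarrow> noconst h"
  by (auto simp: noconst_def mcoeff_mvar)

lemma noconst_add: "noconst f \<Longrightarrow> noconst g \<Longrightarrow> noconst (f + g)"
  by (auto simp: noconst_def)

lemma noconst_minus: "noconst f \<Longrightarrow> noconst g \<Longrightarrow> noconst (f - g)"
  by (auto simp: noconst_def)

lemma noconst_mult: "noconst g \<Longrightarrow> noconst (f * g)"
  by (auto simp: noconst_def mcoeff_mult)

lemma noconst_sum: "(\<And>i. i \<in> I \<Longrightarrow> noconst (f i)) \<Longrightarrow> noconst (sum f I)"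
  by (auto simp: noconst_def mcoeff_sum)

lemmas noconst_intros = noconst_add noconst_minus noconst_mult noconst_sum

lemma mord_ge_mult:
  assumes "mord_ge a f" "mord_ge b g"
  shows "mord_ge (a + b) (f * g)"
  unfolding mord_ge_def
proof (intro allI impI)
  fix M :: "'a multiset"
  assume M: "size M < a + b"
  show "mcoeff (f * g) M = 0"
  proof (rule ccontr)
    assume "mcoeff (f * g) M \<noteq> 0"
    then obtain A B where "M = A + B" "mcoeff f A \<noteq> 0" "mcoeff g B \<noteq> 0" by (rule mcoeff_multE)
    then show False using assms M unfolding mord_ge_def
      by (metis add_mono leD linorder_not_less size_union)
  qed
qed

lemma mord_ge_0 [simp]: "mord_ge 0 f"
  by (simp add: mord_ge_def)

lemma mord_ge_power: "noconst f \<Longrightarrow> mord_ge n (f ^ n)"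
proof (induction n)
  case (Suc n)
  then show ?case using mord_ge_mult[OF noconst_imp_mord_ge, of f n "f ^ n"] by simp
qed auto

lemma mord_ge_prod_mset: "(\<And>v. noconst (\<sigma> v)) \<Longrightarrow> mord_ge (size N) (\<Prod>v\<in>#N. \<sigma> v)"
proof (induction N)
  case (add v N)
  then show ?case using mord_ge_mult[OF noconst_imp_mord_ge, of "\<sigma> v" "size N"] by simp
qed auto

section \<open>Substitution\<close>

text \<open>A summation range independent of the coefficients of the series, so that the sums for
  several series can be combined. It replaces the support-dependent range in
  \<open>msubst\<close>.\<close>

definition mons_upto :: "'v set \<Rightarrow> nat \<Rightarrow> 'v multiset set" where
  "mons_upto V K = {N. set_mset N \<subseteq> V \<and> size N \<le> K}"

lemma finite_mons_upto [simp]: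
  assumes "finite V" shows "finite (mons_upto V K)"
proof (rule finite_subset)
  show "mons_upto V K \<subseteq> mset ` {xs. set xs \<subseteq> V \<and> length xs \<le> K}"
  proof
    fix N assume N: "N \<in> mons_upto V K"
    obtain xs where "mset xs = N" using ex_mset by blast
    then show "N \<in> mset ` {xs. set xs \<subseteq> V \<and> length xs \<le> K}"
      using N by (auto simp: mons_upto_def)
  qed
  show "finite (mset ` {xs. set xs \<subseteq> V \<and> length xs \<le> K})"
    by (intro finite_imageI finite_lists_length_le assms)
qed

text \<open>A product of \<open>size N\<close> factors without constant term has order at least
  \<open>size N\<close>, so enlarging the range only adds zeros. \<open>V\<close> and
  \<open>K\<close> are free so that one range serves several series and all submonomials of a given
  monomial.\<close>

lemma mcoeff_msubst:
  assumes "finite V" "mvars f \<subseteq> V" "\<And>v. noconst (\<sigma> v)" "size M \<le> K"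
  shows "mcoeff (msubst \<sigma> f) M = (\<Sum>N\<in>mons_upto V K. mcoeff f N * mcoeff (\<Prod>v\<in>#N. \<sigma> v) M)"
  unfolding msubst_def mcoeff_Abs
proof (rule sum.mono_neutral_left)
  show "finite (mons_upto V K)" using assms by simp
  show "{N. mcoeff f N \<noteq> 0 \<and> size N \<le> size M} \<subseteq> mons_upto V K"
    using assms(2,4) by (auto simp: mons_upto_def dest: mvarsD)
  show "\<forall>N\<in>mons_upto V K - {N. mcoeff f N \<noteq> 0 \<and> size N \<le> size M}.
      mcoeff f N * mcoeff (\<Prod>v\<in>#N. \<sigma> v) M = 0"
  proof
    fix N assume N: "N \<in> mons_upto V K - {N. mcoeff f N \<noteq> 0 \<and> size N \<le> size M}"
    show "mcoeff f N * mcoeff (\<Prod>v\<in>#N. \<sigma> v) M = 0"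
    proof (cases "mcoeff f N = 0")
      case False
      then have "size M < size N" using N by auto
      then show ?thesis using mord_ge_prod_mset[of \<sigma> N] assms(3) by (simp add: mord_ge_def)
    qed simp
  qed
qed

lemma msubst_cong:
  assumes "\<And>v. v \<in> mvars f \<Longrightarrow> \<sigma> v = \<tau> v"
  shows "msubst \<sigma> f = msubst \<tau> f"
proof -
  have "(\<Prod>v\<in>#N. \<sigma> v) = (\<Prod>v\<in>#N. \<tau> v)" if "mcoeff f N \<noteq> 0" for N
    using mvarsD[OF that] assms by (intro arg_cong[of _ _ prod_mset] image_mset_cong) auto
  then show ?thesis
    unfolding msubst_def by (auto intro!: arg_cong[of _ _ Abs_mfps] sum.cong)
qed

text \<open>The cut-off by degree is part of the definition of \<open>msubst\<close>. This allows an
  exponential to be replaced by a partial sum under a substitution.\<close>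

lemma msubst_cong_degree:
  assumes "\<And>N. size N \<le> size M \<Longrightarrow> mcoeff f N = mcoeff g N"
  shows "mcoeff (msubst \<sigma> f) M = mcoeff (msubst \<sigma> g) M"
  unfolding msubst_def mcoeff_Abs by (rule sum.cong) (auto simp: assms)

lemma mvars_msubst: "mvars (msubst \<sigma> f) \<subseteq> (\<Union>v\<in>mvars f. mvars (\<sigma> v))"
proof (rule mvars_subsetI)
  fix M assume "mcoeff (msubst \<sigma> f) M \<noteq> 0"
  then obtain N where N: "mcoeff f N \<noteq> 0" "mcoeff (\<Prod>v\<in>#N. \<sigma> v) M \<noteq> 0"
    unfolding msubst_def mcoeff_Abs by (metis (mono_tags, lifting) mem_Collect_eq mult_zero_right sum.neutral)
  have "set_mset M \<subseteq> mvars (\<Prod>v\<in>#N. \<sigma> v)" using N(2) by (rule mvarsD)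
  also have "\<dots> \<subseteq> (\<Union>v\<in>mvars f. mvars (\<sigma> v))"
    using mvarsD[OF N(1)] by (intro mvars_prod_mset) auto
  finally show "set_mset M \<subseteq> (\<Union>v\<in>mvars f. mvars (\<sigma> v))" .
qed

lemma noconst_msubst: "noconst f \<Longrightarrow> noconst (msubst \<sigma> f)"
  by (auto simp: noconst_def msubst_def intro!: sum.neutral)

lemma msubst_0 [simp]: "msubst \<sigma> 0 = 0"
  by (rule mfps_eqI) (simp add: msubst_def)

lemma msubst_mconst [simp]: "msubst (\<sigma> :: 'v \<Rightarrow> ('w, 'a::comm_ring_1) mfps) (mconst c) = mconst c"
proof (rule mfps_eqI)
  fix M :: "'w multiset"
  have *: "{N :: 'v multiset. mcoeff (mconst c) N \<noteq> 0 \<and> size N \<le> size M} = (if c = 0 then {} else {{#}})"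
    by auto
  show "mcoeff (msubst \<sigma> (mconst c)) M = mcoeff (mconst c) M"
    unfolding msubst_def mcoeff_Abs * by simp
qed

lemma msubst_1 [simp]: "msubst \<sigma> 1 = 1"
  using msubst_mconst[of \<sigma> 1] by (simp add: mconst_simps)

lemma msubst_mvar [simp]:
  assumes "noconst (\<sigma> v)"
  shows "msubst \<sigma> (mvar v) = \<sigma> v"
proof (rule mfps_eqI)
  fix M
  have "mcoeff (msubst \<sigma> (mvar v)) M = (\<Sum>N\<in>(if M = {#} then {} else {{#v#}}). mcoeff (\<sigma> v) M)"
    unfolding msubst_def mcoeff_Abs
    by (rule sum.cong) (auto simp: mcoeff_mvar Suc_le_eq nonempty_has_size split: if_splits)
  then show "mcoeff (msubst \<sigma> (mvar v)) M = mcoeff (\<sigma> v) M" using assms by (auto simp: noconst_def)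
qed

context
  fixes \<sigma> :: "'v \<Rightarrow> ('w, 'a::comm_ring_1) mfps"
  assumes nc: "\<And>v. noconst (\<sigma> v)"
begin

lemma msubst_add:
  assumes "finite (mvars f)" "finite (mvars g)"
  shows "msubst \<sigma> (f + g) = msubst \<sigma> f + msubst \<sigma> g"
proof (rule mfps_eqI)
  fix M
  let ?V = "mvars f \<union> mvars g"
  show "mcoeff (msubst \<sigma> (f + g)) M = mcoeff (msubst \<sigma> f + msubst \<sigma> g) M"
    using assms mvars_add[of f g]
    by (simp add: mcoeff_msubst[where V = ?V and K = "size M"] nc sum.distrib distrib_right)
qed

text \<open>A Cauchy product on the side of the monomials N = A + B and another on the side of the
  target monomial M; the two are interchanged once both ranges are rectangular.\<close>

lemma msubst_mult:
  assumes "finite (mvars f)" "finite (mvars g)"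
  shows "msubst \<sigma> (f * g) = msubst \<sigma> f * msubst \<sigma> g"
proof (rule mfps_eqI)
  fix M :: "'w multiset"
  define V where "V = mvars f \<union> mvars g"
  let ?U = "mons_upto V (size M)"
  define h where "h A B = mcoeff f A * mcoeff g B * mcoeff (\<Prod>v\<in>#A + B. \<sigma> v) M" for A B
  have fin: "finite V" using assms by (simp add: V_def)
  have V: "mvars f \<subseteq> V" "mvars g \<subseteq> V" "mvars (f * g) \<subseteq> V"
    using mvars_mult[of f g] by (auto simp: V_def)
  have "mcoeff (msubst \<sigma> (f * g)) M = (\<Sum>N\<in>?U. \<Sum>A | A \<subseteq># N. h A (N - A))"
    by (simp add: mcoeff_msubst[OF fin V(3) nc order_refl] mcoeff_mult h_def
        sum_distrib_right del: image_mset_union)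
  also have "\<dots> = (\<Sum>(N, A)\<in>(SIGMA N:?U. {A. A \<subseteq># N}). h A (N - A))"
    using fin by (simp add: sum.Sigma)
  also have "\<dots> = (\<Sum>(A, B)\<in>{(A, B). A + B \<in> ?U}. h A B)"
    by (rule sum.reindex_bij_witness[where i = "\<lambda>(A, B). (A + B, A)" and j = "\<lambda>(N, A). (A, N - A)"]) auto
  \<comment> \<open>The triangle \<open>size (A + B) \<le> size M\<close> is filled up to a square:
    the added pairs have degree above that of \<open>M\<close> and contribute nothing.\<close>
  also have "\<dots> = (\<Sum>(A, B)\<in>?U \<times> ?U. h A B)"
  proof (rule sum.mono_neutral_left)
    show "\<forall>p\<in>?U \<times> ?U - {(A, B). A + B \<in> ?U}. (case p of (A, B) \<Rightarrow> h A B) = 0"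
    proof
      fix p assume pU: "p \<in> ?U \<times> ?U - {(A, B). A + B \<in> ?U}"
      obtain A B where AB: "p = (A, B)" by force
      then have p: "p = (A, B)" "size (A + B) > size M"
        using pU by (auto simp: mons_upto_def)
      then have "h A B = 0"
        using mord_ge_prod_mset[of \<sigma> "A + B"] nc by (simp add: h_def mord_ge_def)
      then show "(case p of (A, B) \<Rightarrow> h A B) = 0" by (simp add: p)
    qed
    show "finite (?U \<times> ?U)" using fin by simp
  qed (auto simp: mons_upto_def)
  also have "\<dots> = (\<Sum>A\<in>?U. \<Sum>B\<in>?U. \<Sum>C | C \<subseteq># M.
      mcoeff f A * mcoeff (\<Prod>v\<in>#A. \<sigma> v) C * (mcoeff g B * mcoeff (\<Prod>v\<in>#B. \<sigma> v) (M - C)))"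
    unfolding sum.cartesian_product[symmetric]
    by (simp add: h_def mcoeff_mult sum_distrib_left mult_ac)
  also have "\<dots> = (\<Sum>C | C \<subseteq># M. \<Sum>A\<in>?U. \<Sum>B\<in>?U.
      mcoeff f A * mcoeff (\<Prod>v\<in>#A. \<sigma> v) C * (mcoeff g B * mcoeff (\<Prod>v\<in>#B. \<sigma> v) (M - C)))"
    by (subst (2) sum.swap, subst sum.swap, rule refl)
  also have "\<dots> = (\<Sum>C | C \<subseteq># M. mcoeff (msubst \<sigma> f) C * mcoeff (msubst \<sigma> g) (M - C))"
  proof (rule sum.cong[OF refl])
    fix C assume "C \<in> {C. C \<subseteq># M}"
    then have "size C \<le> size M" "size (M - C) \<le> size M"
      by (auto intro: size_mset_mono)
    then show "(\<Sum>A\<in>?U. \<Sum>B\<in>?U.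
        mcoeff f A * mcoeff (\<Prod>v\<in>#A. \<sigma> v) C * (mcoeff g B * mcoeff (\<Prod>v\<in>#B. \<sigma> v) (M - C)))
        = mcoeff (msubst \<sigma> f) C * mcoeff (msubst \<sigma> g) (M - C)"
      by (simp add: mcoeff_msubst[OF fin V(1) nc] mcoeff_msubst[OF fin V(2) nc] sum_product)
  qed
  finally show "mcoeff (msubst \<sigma> (f * g)) M = mcoeff (msubst \<sigma> f * msubst \<sigma> g) M"
    by (simp add: mcoeff_mult)
qed

lemma msubst_uminus:
  assumes "finite (mvars f)"
  shows "msubst \<sigma> (- f) = - msubst \<sigma> f"
  using msubst_add[of f "- f"] assms by (simp add: eq_neg_iff_add_eq_0 add.commute)

lemma msubst_minus:
  assumes "finite (mvars f)" "finite (mvars g)"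
  shows "msubst \<sigma> (f - g) = msubst \<sigma> f - msubst \<sigma> g"
  using msubst_add[of f "- g"] assms by (simp add: msubst_uminus)

lemma msubst_sum:
  assumes "\<And>i. i \<in> I \<Longrightarrow> finite (mvars (f i))"
  shows "msubst \<sigma> (sum f I) = (\<Sum>i\<in>I. msubst \<sigma> (f i))"
  using assms
proof (induction I rule: infinite_finite_induct)
  case (insert x F)
  have "finite (mvars (sum f F))"
    by (rule finite_subset[OF mvars_sum[where V = "\<Union>i\<in>F. mvars (f i)"]]) (use insert in auto)
  with insert show ?case by (simp add: msubst_add)
qed auto

lemma msubst_prod:
  assumes "\<And>i. i \<in> I \<Longrightarrow> finite (mvars (f i))"
  shows "msubst \<sigma> (prod f I) = (\<Prod>i\<in>I. msubst \<sigma> (f i))"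
  using assms
proof (induction I rule: infinite_finite_induct)
  case (insert x F)
  have "finite (mvars (prod f F))"
    by (rule finite_subset[OF mvars_prod[where V = "\<Union>i\<in>F. mvars (f i)"]]) (use insert in auto)
  with insert show ?case by (simp add: msubst_mult)
qed auto

lemma msubst_prod_mset:
  assumes "\<And>v. v \<in># N \<Longrightarrow> finite (mvars (f v))"
  shows "msubst \<sigma> (\<Prod>v\<in>#N. f v) = (\<Prod>v\<in>#N. msubst \<sigma> (f v))"
  using assms
proof (induction N)
  case (add x F)
  have "finite (mvars (\<Prod>v\<in>#F. f v))"
    by (rule finite_subset[OF mvars_prod_mset[where V = "\<Union>i\<in>set_mset F. mvars (f i)"]]) (use add in auto)
  with add show ?case by (simp add: msubst_mult)
qed auto

lemma msubst_power:
  assumes "finite (mvars f)"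
  shows "msubst \<sigma> (f ^ n) = msubst \<sigma> f ^ n"
proof (induction n)
  case (Suc n)
  have "finite (mvars (f ^ n))"
    by (rule finite_subset[OF mvars_power assms])
  with Suc assms show ?case by (simp add: msubst_mult)
qed auto

lemma msubst_of_nat [simp]: "msubst \<sigma> (of_nat n) = of_nat n"
  by (induction n) (auto simp: msubst_add)

text \<open>After exchanging the sums over N and N', the inner sum is a coefficient of \<sigma>
  applied to the product of the \<tau> v over N, and \<sigma> is multiplicative on such
  products.\<close>

lemma msubst_msubst:
  fixes \<tau> :: "'u \<Rightarrow> ('v, 'a) mfps"
  assumes f: "finite (mvars f)" and \<tau>: "\<And>v. noconst (\<tau> v)" "\<And>v. finite (mvars (\<tau> v))"
  shows "msubst \<sigma> (msubst \<tau> f) = msubst (\<lambda>v. msubst \<sigma> (\<tau> v)) f"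
proof (rule mfps_eqI)
  fix M :: "'w multiset"
  define V where "V = (\<Union>v\<in>mvars f. mvars (\<tau> v))"
  have finV: "finite V" using assms by (simp add: V_def)
  have subV: "mvars (msubst \<tau> f) \<subseteq> V" unfolding V_def by (rule mvars_msubst)
  let ?K = "size M"
  have "mcoeff (msubst \<sigma> (msubst \<tau> f)) M =
      (\<Sum>N'\<in>mons_upto V ?K. \<Sum>N\<in>mons_upto (mvars f) ?K.
         mcoeff f N * mcoeff (\<Prod>v\<in>#N. \<tau> v) N' * mcoeff (\<Prod>v\<in>#N'. \<sigma> v) M)"
    unfolding mcoeff_msubst[OF finV subV nc order_refl] sum_distrib_right[symmetric]
    by (intro sum.cong refl arg_cong[of _ _ "\<lambda>x. x * _"] mcoeff_msubst f order_refl \<tau>)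
       (auto simp: mons_upto_def)
  also have "\<dots> = (\<Sum>N\<in>mons_upto (mvars f) ?K. mcoeff f N *
      (\<Sum>N'\<in>mons_upto V ?K. mcoeff (\<Prod>v\<in>#N. \<tau> v) N' * mcoeff (\<Prod>v\<in>#N'. \<sigma> v) M))"
    by (subst sum.swap) (simp add: sum_distrib_left mult_ac)
  also have "\<dots> = (\<Sum>N\<in>mons_upto (mvars f) ?K. mcoeff f N *
      mcoeff (\<Prod>v\<in>#N. msubst \<sigma> (\<tau> v)) M)"
  proof (intro sum.cong refl arg_cong[of _ _ "\<lambda>x. _ * x"])
    fix N assume N: "N \<in> mons_upto (mvars f) ?K"
    then have "mvars (\<Prod>v\<in>#N. \<tau> v) \<subseteq> V"
      by (intro mvars_prod_mset) (auto simp: V_def mons_upto_def)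
    then show "(\<Sum>N'\<in>mons_upto V ?K. mcoeff (\<Prod>v\<in>#N. \<tau> v) N' * mcoeff (\<Prod>v\<in>#N'. \<sigma> v) M)
        = mcoeff (\<Prod>v\<in>#N. msubst \<sigma> (\<tau> v)) M"
      by (simp add: mcoeff_msubst[OF finV _ nc order_refl, symmetric] msubst_prod_mset \<tau>)
  qed
  also have "\<dots> = mcoeff (msubst (\<lambda>v. msubst \<sigma> (\<tau> v)) f) M"
    by (rule mcoeff_msubst[symmetric]) (auto intro: f noconst_msubst \<tau>)
  finally show "mcoeff (msubst \<sigma> (msubst \<tau> f)) M = mcoeff (msubst (\<lambda>v. msubst \<sigma> (\<tau> v)) f) M" .
qed

end

section \<open>Extension of scalars\<close>

lemma fps_const_sum: "fps_const (sum f I) = (\<Sum>i\<in>I. fps_const (f i :: 'a::comm_ring_1))"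
  by (induction I rule: infinite_finite_induct) (auto simp: fps_const_add[symmetric] simp del: fps_const_add)

lemma to_q_simps [simp]:
  "to_q 0 = 0" "to_q 1 = 1" "to_q (f + g) = to_q f + to_q g" "to_q (f - g) = to_q f - to_q g"
  "to_q (- f) = - to_q f" "to_q (mvar v) = mvar v"
  by (rule mfps_eqI; simp add: mcoeff_mvar)+

lemma to_q_mult [simp]: "to_q (f * g) = to_q f * to_q g"
  by (rule mfps_eqI) (simp add: mcoeff_mult fps_const_sum)

lemma to_q_sum: "to_q (sum f I) = (\<Sum>i\<in>I. to_q (f i))"
  by (induction I rule: infinite_finite_induct) auto

lemma to_q_prod: "to_q (prod f I) = (\<Prod>i\<in>I. to_q (f i))"
  by (induction I rule: infinite_finite_induct) auto

lemma to_q_power: "to_q (f ^ n) = to_q f ^ n"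
  by (induction n) auto

lemma to_q_prod_mset: "to_q (\<Prod>v\<in>#N. f v) = (\<Prod>v\<in>#N. to_q (f v))"
  by (induction N) auto

text \<open>A coefficient vanishes exactly when its image under \<open>fps_const\<close> does, so
  both sides sum over the same monomials.\<close>

lemma msubst_to_q: "msubst (\<lambda>v. to_q (\<sigma> v)) (to_q f) = to_q (msubst \<sigma> f)"
proof (rule mfps_eqI)
  fix M
  have "mcoeff (\<Prod>v\<in>#N. to_q (\<sigma> v)) M = fps_const (mcoeff (\<Prod>v\<in>#N. \<sigma> v) M)" for N
    by (simp only: to_q_prod_mset[symmetric] mcoeff_simps)
  then show "mcoeff (msubst (\<lambda>v. to_q (\<sigma> v)) (to_q f)) M = mcoeff (to_q (msubst \<sigma> f)) M"
    by (simp add: msubst_def fps_const_sum)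
qed

section \<open>The exponential\<close>

lemma mcoeff_mexp:
  assumes "noconst f" "size M \<le> K"
  shows "mcoeff (mexp f) M = mcoeff (\<Sum>n\<le>K. mconst (1 / fact n) * f ^ n) M"
proof -
  have "mcoeff (mexp f) M = (\<Sum>n\<le>K. mcoeff (f ^ n) M / fact n)"
    unfolding mexp_def mcoeff_Abs using assms mord_ge_power[of f]
    by (intro sum.mono_neutral_left) (auto simp: mord_ge_def)
  then show ?thesis by (simp add: mcoeff_sum)
qed

lemma mvars_mexp: "mvars (mexp f) \<subseteq> mvars f"
proof (rule mvars_subsetI)
  fix N assume "mcoeff (mexp f) N \<noteq> 0"
  then obtain n where "mcoeff (f ^ n) N \<noteq> 0"
    by (force simp: mexp_def elim: sum.not_neutral_contains_not_neutral)
  then show "set_mset N \<subseteq> mvars f"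
    using mvarsD[of "f ^ n" N] mvars_power[of f n] by simp
qed

lemma mexp_0 [simp]: "mexp 0 = 1"
proof (rule mfps_eqI)
  fix M :: "'a multiset"
  have "mcoeff (mexp 0) M = (\<Sum>n\<le>size M. if n = 0 then mcoeff 1 M else 0)"
    unfolding mexp_def mcoeff_Abs by (rule sum.cong) (auto simp: power_0_left)
  then show "mcoeff (mexp 0) M = mcoeff 1 M" by simp
qed

text \<open>The binomial theorem gives the terms f^a g^b / (a! b!) with a + b at most the degree;
  those in the rest of the square a, b \<le> K have too high an order to matter.\<close>

lemma mexp_add:
  assumes "noconst f" "noconst g"
  shows "mexp (f + g) = mexp f * mexp g"
proof (rule mfps_eqI)
  fix M :: "'a multiset"
  let ?K = "size M"
  define h where "h a b = mconst (1 / fact a) * f ^ a * (mconst (1 / fact b) * g ^ b)" for a b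
  have "mcoeff (mexp (f + g)) M = mcoeff (\<Sum>n\<le>?K. \<Sum>a\<le>n. h a (n - a)) M"
  proof -
    have "mconst (1 / fact n) * (f + g) ^ n = (\<Sum>a\<le>n. h a (n - a))" for n
    proof -
      have *: "mconst (1 / fact n) * of_nat (n choose a) =
          (mconst (1 / fact a) * mconst (1 / fact (n - a)) :: ('a, rat) mfps)" if "a \<le> n" for a
      proof -
        have "(of_nat m :: ('a, rat) mfps) = mconst (of_nat m)" for m
          by (induction m) (auto simp: mconst_simps)
        then show ?thesis
          using that by (simp add: binomial_fact flip: mconst_simps(3))
      qed
      have "mconst (1 / fact n) * (f + g) ^ n =
          (\<Sum>a\<le>n. (mconst (1 / fact n) * of_nat (n choose a)) * (f ^ a * g ^ (n - a)))"
        by (simp add: binomial_ring sum_distrib_left mult_ac)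
      also have "\<dots> = (\<Sum>a\<le>n. h a (n - a))"
        by (intro sum.cong refl) (subst *, auto simp: h_def mult_ac)
      finally show ?thesis .
    qed
    then show ?thesis
      by (subst mcoeff_mexp[where K = ?K]) (use assms in \<open>auto intro: noconst_add\<close>)
  qed
  also have "\<dots> = (\<Sum>(n, a)\<in>(SIGMA n:{..?K}. {..n}). mcoeff (h a (n - a)) M)"
    by (simp add: mcoeff_sum sum.Sigma split_beta)
  also have "\<dots> = (\<Sum>(a, b)\<in>{(a, b). a + b \<le> ?K}. mcoeff (h a b) M)"
    by (rule sum.reindex_bij_witness[where i = "\<lambda>(a, b). (a + b, a)" and j = "\<lambda>(n, a). (a, n - a)"]) auto
  also have "\<dots> = (\<Sum>(a, b)\<in>{..?K} \<times> {..?K}. mcoeff (h a b) M)"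
  proof (rule sum.mono_neutral_left)
    have "mcoeff (h a b) M = 0" if "a + b > size M" for a b
    proof -
      have "mord_ge (a + b) (f ^ a * g ^ b)"
        by (intro mord_ge_mult mord_ge_power assms)
      then have "mcoeff (mconst (1 / fact a) * (mconst (1 / fact b) * (f ^ a * g ^ b))) M = 0"
        using that by (simp add: mord_ge_def)
      then show ?thesis by (simp only: h_def mult_ac)
    qed
    then show "\<forall>p\<in>{..?K} \<times> {..?K} - {(a, b). a + b \<le> ?K}.
        (case p of (a, b) \<Rightarrow> mcoeff (h a b) M) = 0" by (auto, meson not_le)
  qed auto
  also have "\<dots> = mcoeff ((\<Sum>n\<le>?K. mconst (1 / fact n) * f ^ n) * (\<Sum>n\<le>?K. mconst (1 / fact n) * g ^ n)) M"
    by (simp add: sum_product mcoeff_sum sum.cartesian_product h_def split_beta)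
  also have "\<dots> = mcoeff (mexp f * mexp g) M"
    unfolding mcoeff_mult
  proof (rule sum.cong[OF refl])
    fix A assume "A \<in> {A. A \<subseteq># M}"
    then have "size A \<le> ?K" "size (M - A) \<le> ?K" by (auto intro: size_mset_mono)
    then show "mcoeff (\<Sum>n\<le>?K. mconst (1 / fact n) * f ^ n) A *
        mcoeff (\<Sum>n\<le>?K. mconst (1 / fact n) * g ^ n) (M - A) =
        mcoeff (mexp f) A * mcoeff (mexp g) (M - A)"
      by (simp only: mcoeff_mexp[OF assms(1)] mcoeff_mexp[OF assms(2)])
  qed
  finally show "mcoeff (mexp (f + g)) M = mcoeff (mexp f * mexp g) M" .
qed

lemma mexp_sum:
  assumes "\<And>i. i \<in> I \<Longrightarrow> noconst (f i)"
  shows "mexp (sum f I) = (\<Prod>i\<in>I. mexp (f i))"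
  using assms
  by (induction I rule: infinite_finite_induct) (auto simp: mexp_add noconst_sum)

lemma msubst_mexp:
  fixes \<sigma> :: "'v \<Rightarrow> ('w, rat) mfps"
  assumes \<sigma>: "\<And>v. noconst (\<sigma> v)" and f: "finite (mvars f)" "noconst f"
  shows "msubst \<sigma> (mexp f) = mexp (msubst \<sigma> f)"
proof (rule mfps_eqI)
  fix M :: "'w multiset"
  let ?K = "size M"
  have fin: "finite (mvars (f ^ n))" for n
    by (rule finite_subset[OF mvars_power f(1)])
  have fin': "finite (mvars (mconst c * f ^ n))" for n c
    by (rule finite_subset[OF mvars_mult]) (simp add: fin)
  have "mcoeff (msubst \<sigma> (mexp f)) M = mcoeff (msubst \<sigma> (\<Sum>n\<le>?K. mconst (1 / fact n) * f ^ n)) M"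
    by (rule msubst_cong_degree) (rule mcoeff_mexp[OF f(2)])
  also have "\<dots> = mcoeff (\<Sum>n\<le>?K. mconst (1 / fact n) * msubst \<sigma> f ^ n) M"
    by (simp add: msubst_sum[OF \<sigma>] msubst_mult[OF \<sigma>] msubst_power[OF \<sigma>] fin fin' f)
  also have "\<dots> = mcoeff (mexp (msubst \<sigma> f)) M"
    by (rule mcoeff_mexp[symmetric]) (auto intro: noconst_msubst f)
  finally show "mcoeff (msubst \<sigma> (mexp f)) M = mcoeff (mexp (msubst \<sigma> f)) M" .
qed

section \<open>Approximation in powers of q and the geometric series behind
  \<open>bm_L\<close>\<close>

section \<open>Congruence modulo powers of q\<close>

text \<open>Congruence modulo q^(N+1) in every coefficient. It stands in for the q-adic topology:
  quotients and infinite sums are handled through finite representatives.\<close>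

definition qcong :: "nat \<Rightarrow> ('v, 'a::zero fps) mfps \<Rightarrow> ('v, 'a fps) mfps \<Rightarrow> bool" where
  "qcong N f g \<longleftrightarrow> (\<forall>M. \<forall>k\<le>N. mcoeff f M $ k = mcoeff g M $ k)"

lemma qcong_refl [simp]: "qcong N f f"
  by (simp add: qcong_def)

lemma qcong_sym: "qcong N f g \<Longrightarrow> qcong N g f"
  by (simp add: qcong_def)

lemma qcong_trans [trans]: "qcong N f g \<Longrightarrow> qcong N g h \<Longrightarrow> qcong N f h"
  by (simp add: qcong_def)

lemma qcong_eq_trans [trans]: "f = g \<Longrightarrow> qcong N g h \<Longrightarrow> qcong N f h"
  and qcong_trans_eq [trans]: "qcong N f g \<Longrightarrow> g = h \<Longrightarrow> qcong N f h"
  by simp_all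

lemma qcong_mono: "qcong N f g \<Longrightarrow> n \<le> N \<Longrightarrow> qcong n f g"
  by (auto simp: qcong_def)

lemma qcong_imp_eq: "(\<And>N. qcong N f g) \<Longrightarrow> f = g"
  by (rule mfps_eqI, rule fps_ext) (auto simp: qcong_def)

lemma
  fixes f f' g g' :: "('v, 'a::comm_ring_1 fps) mfps"
  assumes "qcong N f f'" "qcong N g g'"
  shows qcong_add: "qcong N (f + g) (f' + g')"
    and qcong_minus: "qcong N (f - g) (f' - g')"
    and qcong_mult: "qcong N (f * g) (f' * g')"
  using assms by (auto simp: qcong_def mcoeff_mult fps_sum_nth fps_mult_nth)

lemma qcong_sum:
  fixes f :: "'i \<Rightarrow> ('v, 'a::comm_ring_1 fps) mfps"
  shows "(\<And>i. i \<in> I \<Longrightarrow> qcong N (f i) (g i)) \<Longrightarrow> qcong N (sum f I) (sum g I)"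
  by (induction I rule: infinite_finite_induct) (auto intro: qcong_add)

lemma qcong_prod:
  fixes f :: "'i \<Rightarrow> ('v, 'a::comm_ring_1 fps) mfps"
  shows "(\<And>i. i \<in> I \<Longrightarrow> qcong N (f i) (g i)) \<Longrightarrow> qcong N (prod f I) (prod g I)"
  by (induction I rule: infinite_finite_induct) (auto intro: qcong_mult)

lemma qcong_fps_X_power: "N < w \<Longrightarrow> qcong N (f * mconst (fps_X ^ w)) (0 :: ('v, 'a::comm_ring_1 fps) mfps)"
  by (auto simp: qcong_def mult.commute[of f] fps_X_power_mult_nth)

text \<open>Each coefficient after substitution is a finite combination of coefficients before it,
  and multiplication in the q-series respects the congruence.\<close>

lemma qcong_msubst:
  fixes f g :: "('v, 'a::comm_ring_1 fps) mfps"
  assumes "qcong N f g" "\<And>v. noconst (\<sigma> v)" "finite (mvars f)" "finite (mvars g)"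
  shows "qcong N (msubst \<sigma> f) (msubst \<sigma> g)"
proof -
  let ?V = "mvars f \<union> mvars g"
  have V: "finite ?V" using assms by simp
  have *: "mcoeff (msubst \<sigma> h) M =
      (\<Sum>N\<in>mons_upto ?V (size M). mcoeff h N * mcoeff (\<Prod>v\<in>#N. \<sigma> v) M)"
    if "mvars h \<subseteq> ?V" for h M
    by (rule mcoeff_msubst[OF V that assms(2) order_refl])
  show ?thesis
    unfolding qcong_def
  proof (intro allI impI)
    fix M n assume "n \<le> N"
    then show "mcoeff (msubst \<sigma> f) M $ n = mcoeff (msubst \<sigma> g) M $ n"
      using assms(1) by (simp add: * qcong_def fps_sum_nth fps_mult_nth)
  qed
qed

text \<open>A nonzero coefficient is already visible modulo some power of q. This bounds the
  variables of \<open>bm_L\<close>, \<open>bm_LL\<close> and \<open>bm_G\<close>, whose definitions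
  by \<open>THE\<close> and \<open>infsum\<close> hide them.\<close>

lemma mvars_qcong:
  assumes "\<And>N. \<exists>g. qcong N f g \<and> mvars g \<subseteq> V"
  shows "mvars f \<subseteq> V"
proof (rule mvars_subsetI)
  fix M assume "mcoeff f M \<noteq> 0"
  then obtain n where n: "mcoeff f M $ n \<noteq> 0" by (auto simp: fps_eq_iff)
  obtain g where g: "qcong n f g" "mvars g \<subseteq> V" using assms by blast
  then have "mcoeff g M \<noteq> 0" using n by (auto simp: qcong_def)
  then show "set_mset M \<subseteq> V" using g(2) mvarsD by blast
qed

text \<open>The passage from \<open>infsum\<close> to finite sums. Summability is the first
  assumption: for each n, all but finitely many summands vanish modulo q^(n+1).\<close>

lemma qcong_msum_q:
  assumes conv: "\<And>n. \<exists>J. finite J \<and> J \<subseteq> I \<and> (\<forall>i\<in>I - J. qcong n (F i) 0)"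
    and J: "finite J" "J \<subseteq> I" "\<And>i. i \<in> I - J \<Longrightarrow> qcong N (F i) 0"
  shows "qcong N (msum_q F I) (sum F J)"
proof -
  obtain T where T: "\<And>n. finite (T n)" "\<And>n. T n \<subseteq> I" "\<And>n i. i \<in> I - T n \<Longrightarrow> qcong n (F i) 0"
    using conv by metis
  have eq: "mcoeff (sum F J1) M $ k = mcoeff (sum F J2) M $ k"
    if J12: "finite J1" "J1 \<subseteq> I" "\<And>i. i \<in> I - J1 \<Longrightarrow> qcong n (F i) 0"
      "finite J2" "J2 \<subseteq> I" "\<And>i. i \<in> I - J2 \<Longrightarrow> qcong n (F i) 0" "k \<le> n" for J1 J2 n k M
  proof -
    have "(\<Sum>i\<in>J1. mcoeff (F i) M $ k) = (\<Sum>i\<in>J1 \<union> J2. mcoeff (F i) M $ k)"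
      using J12 by (intro sum.mono_neutral_left) (auto simp: qcong_def)
    also have "\<dots> = (\<Sum>i\<in>J2. mcoeff (F i) M $ k)"
      using J12 by (intro sum.mono_neutral_right) (auto simp: qcong_def)
    finally show ?thesis by (simp add: mcoeff_sum fps_sum_nth)
  qed
  \<comment> \<open>The limit is written down diagonally: its coefficient at q^n is taken from the
    partial sum over \<open>T n\<close>, beyond which that coefficient no longer changes.\<close>
  have "infsum (\<lambda>i. mcoeff (F i) M) I = Abs_fps (\<lambda>n. mcoeff (sum F (T n)) M $ n)" for M
  proof (rule infsumI, unfold has_sum_def tendsto_iff eventually_finite_subsets_at_top, intro allI impI)
    fix e :: real assume "e > 0"
    then obtain n where n: "inverse (2 ^ n) < e"
      using real_arch_pow_inv[of e "1 / 2"] by (auto simp: field_simps)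
    show "\<exists>X. finite X \<and> X \<subseteq> I \<and> (\<forall>Y. finite Y \<and> X \<subseteq> Y \<and> Y \<subseteq> I \<longrightarrow>
        dist (\<Sum>i\<in>Y. mcoeff (F i) M) (Abs_fps (\<lambda>n. mcoeff (sum F (T n)) M $ n)) < e)"
    \<comment> \<open>A finite set containing all of these \<open>T k\<close> fixes every
      coefficient up to q^n, which bounds the distance by 2^(-n).\<close>
    proof (intro exI[of _ "\<Union>k\<le>n. T k"] conjI allI impI)
      fix Y assume Y: "finite Y \<and> (\<Union>k\<le>n. T k) \<subseteq> Y \<and> Y \<subseteq> I"
      have "dist (\<Sum>i\<in>Y. mcoeff (F i) M) (Abs_fps (\<lambda>n. mcoeff (sum F (T n)) M $ n)) < inverse (2 ^ n)"
      proof (rule nth_equal_imp_dist_less)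
        fix k assume k: "k \<le> n"
        have "mcoeff (sum F Y) M $ k = mcoeff (sum F (T k)) M $ k"
        proof (rule eq[where n = k, OF _ _ _ T(1,2) T(3) order_refl])
          show "qcong k (F i) 0" if "i \<in> I - Y" for i
            using that Y k by (intro T(3)) auto
        qed (use Y in auto)
        then show "(\<Sum>i\<in>Y. mcoeff (F i) M) $ k = Abs_fps (\<lambda>n. mcoeff (sum F (T n)) M $ n) $ k"
          by (simp add: mcoeff_sum)
      qed
      then show "dist (\<Sum>i\<in>Y. mcoeff (F i) M) (Abs_fps (\<lambda>n. mcoeff (sum F (T n)) M $ n)) < e"
        using n by linarith
    qed (use T in auto)
  qed
  moreover have "mcoeff (sum F (T k)) M $ k = mcoeff (sum F J) M $ k" if "k \<le> N" for k M
    by (rule eq[where n = k, OF T(1,2) T(3) J(1,2) qcong_mono[OF J(3) that] order_refl])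
  ultimately show ?thesis by (simp add: qcong_def msum_q_def)
qed

section \<open>The series \<open>L\<^sub>m\<close>\<close>

lemma mult_mconst_power:
  "(f * mconst (fps_X ^ m)) ^ k = f ^ k * mconst ((fps_X :: 'a::comm_ring_1 fps) ^ (m * k))"
  by (induction k) (auto simp: mconst_simps power_add mult_ac)

text \<open>Since m \<ge> 1, the k-th power of g q^m is divisible by q^k, so the geometric series
  stabilises coefficientwise whatever the constant term of g is.\<close>

lemma qgeometric_inverse:
  fixes g :: "('v, 'a::comm_ring_1 fps) mfps"
  assumes "m \<ge> 1"
  obtains h where "h * (1 - g * mconst (fps_X ^ m)) = 1"
    and "\<And>N. qcong N h (\<Sum>k\<le>N. (g * mconst (fps_X ^ m)) ^ k)"
proof -
  define u where "u = g * mconst (fps_X ^ m)"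
  have u: "qcong N (u ^ k) 0" if "N < k" for N k
  proof -
    have "N < m * k" using that assms by (metis less_le_trans mult_le_mono1 nat_mult_1)
    then show ?thesis by (simp add: u_def mult_mconst_power qcong_fps_X_power)
  qed
  define h where "h = Abs_mfps (\<lambda>M. Abs_fps (\<lambda>n. mcoeff (\<Sum>k\<le>n. u ^ k) M $ n))"
  have h: "qcong N h (\<Sum>k\<le>N. u ^ k)" for N
    unfolding qcong_def
  proof (intro allI impI)
    fix M n assume n: "n \<le> N"
    have "(\<Sum>k\<le>n. mcoeff (u ^ k) M $ n) = (\<Sum>k\<le>N. mcoeff (u ^ k) M $ n)"
      using n u[of n] by (intro sum.mono_neutral_left) (auto simp: qcong_def)
    then show "mcoeff h M $ n = mcoeff (\<Sum>k\<le>N. u ^ k) M $ n"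
      by (simp add: h_def mcoeff_sum fps_sum_nth)
  qed
  have "h * (1 - u) = 1"
  proof (rule qcong_imp_eq)
    fix N
    have "qcong N (h * (1 - u)) ((\<Sum>k\<le>N. u ^ k) * (1 - u))"
      by (intro qcong_mult h qcong_refl)
    also have "(\<Sum>k\<le>N. u ^ k) * (1 - u) = 1 - u ^ Suc N"
    proof (induction N)
      case (Suc N)
      show ?case unfolding sum.atMost_Suc distrib_right Suc.IH by (simp add: algebra_simps)
    qed simp
    also have "qcong N \<dots> (1 - 0)"
      by (intro qcong_minus u) auto
    finally show "qcong N (h * (1 - u)) 1" by simp
  qed
  with h show ?thesis using that unfolding u_def by blast
qed

text \<open>An inverse of the denominator supplies both existence and uniqueness for the definite
  description in \<open>mquot\<close>.\<close>

lemma mquot_unit: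
  assumes "h * g = 1"
  shows "mquot f g = f * h"
  unfolding mquot_def
proof (rule the_equality)
  show "f * h * g = f" using assms by (simp add: mult.assoc)
  show "h' = f * h" if "h' * g = f" for h'
    using assms that by (metis mult.assoc mult.commute mult_1)
qed

lemma mexp_of_nat_mult:
  assumes "noconst f" shows "mexp (of_nat n * f) = mexp f ^ n"
proof (induction n)
  case (Suc n)
  then show ?case using assms by (simp add: distrib_right mexp_add noconst_mult)
qed auto

lemma qcong_bm_L:
  assumes m: "m \<ge> 1"
  shows "qcong N (bm_L m r)
    (\<Sum>d=1..N. to_q (mexp (of_nat d * sX 1 + of_nat m * sY 1)) * mconst (fps_X ^ (m * d)))"
proof -
  define g :: "(var, rat fps) mfps" where "g = to_q (mexp (sX 1))"
  define f where "f = to_q (mexp (sX 1 + of_nat m * sY 1)) * mconst (fps_X ^ m)"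
  define F where "F d = to_q (mexp (of_nat d * sX 1 + of_nat m * sY 1)) * mconst (fps_X ^ (m * d))" for d
  obtain h where h: "h * (1 - g * mconst (fps_X ^ m)) = 1"
    "\<And>N. qcong N h (\<Sum>k\<le>N. (g * mconst (fps_X ^ m)) ^ k)"
    using qgeometric_inverse[OF m] by blast
  have "bm_L m r = f * h"
    unfolding bm_L_def f_def[symmetric] g_def[symmetric] by (rule mquot_unit[OF h(1)])
  also have "qcong N (f * h) (f * (\<Sum>k\<le>N. (g * mconst (fps_X ^ m)) ^ k))"
    by (intro qcong_mult h) simp
  also have "f * (\<Sum>k\<le>N. (g * mconst (fps_X ^ m)) ^ k) = (\<Sum>k\<le>N. F (Suc k))"
    unfolding sum_distrib_left
  proof (rule sum.cong[OF refl])
    fix k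
    have *: "mexp (of_nat (Suc k) * sX 1 + of_nat m * sY 1) =
        mexp (sX 1 + of_nat m * sY 1) * mexp (sX 1) ^ k"
      by (subst mexp_of_nat_mult[symmetric], simp, subst mexp_add[symmetric])
        (auto intro!: noconst_intros simp: algebra_simps)
    show "f * (g * mconst (fps_X ^ m)) ^ k = F (Suc k)"
      unfolding f_def g_def F_def * mult_mconst_power
      by (simp add: to_q_power mconst_simps power_add mult_ac)
  qed
  \<comment> \<open>The numerator already carries one factor e^X q^m, so k = 0, ..., N corresponds
    to d = 1, ..., N + 1; the extra term is divisible by q^(m(N+1)).\<close>
  also have "\<dots> = (\<Sum>d=1..N. F d) + F (Suc N)"
  proof -
    have "(\<Sum>k\<le>N. F (Suc k)) = (\<Sum>d\<in>{1..Suc N}. F d)"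
      by (rule sum.reindex_bij_witness[where i = "\<lambda>d. d - 1" and j = Suc]) auto
    then show ?thesis by simp
  qed
  also have "qcong N \<dots> ((\<Sum>d=1..N. F d) + 0)"
  proof (intro qcong_add qcong_refl)
    have "N < m * Suc N" using m by (metis less_le_trans lessI mult_le_mono1 nat_mult_1)
    then show "qcong N (F (Suc N)) 0"
      unfolding F_def by (rule qcong_fps_X_power)
  qed
  finally show ?thesis by (simp add: F_def)
qed

section \<open>Evaluation of moulds at indexed families; the swap for \<open>bm_b\<close> and
  \<open>bm_bt\<close>\<close>

section \<open>Moulds evaluated at families of series\<close>

text \<open>This and \<open>map_rev_upt\<close> bring every argument list of the construction to the
  form \<open>map x [1..<n + 1]\<close>, in which an evaluation is a substitution by an index
  function.\<close>

lemma map_upt_shift: "map f [a + 1..<c + 1] = map (\<lambda>k. f (a + k)) [1..<c - a + 1]"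
  by (rule nth_equalityI) (simp_all del: upt_Suc)

lemma map_rev_upt: "map f (rev [j + 1..<r + 1]) = map (\<lambda>k. f (r + 1 - k)) [1..<r - j + 1]"
  by (rule nth_equalityI) (simp_all add: rev_nth Suc_diff_Suc del: upt_Suc)

lemma map_rev_upt_1: "map f (rev [1..<r + 1]) = map (\<lambda>k. f (r + 1 - k)) [1..<r + 1]"
  using map_rev_upt[of f 0 r] by simp

text \<open>The condition on the images under which substitutions both multiply and compose.\<close>

definition adm :: "('v, 'a::comm_ring_1) mfps \<Rightarrow> bool" where
  "adm f \<longleftrightarrow> noconst f \<and> finite (mvars f)"

lemma finite_mvars_add: "finite (mvars f) \<Longrightarrow> finite (mvars g) \<Longrightarrow> finite (mvars (f + g))"
  by (rule finite_subset[OF mvars_add]) simp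

lemma finite_mvars_minus:
  "finite (mvars f) \<Longrightarrow> finite (mvars g) \<Longrightarrow> finite (mvars (f - g :: ('v, 'a::comm_ring_1) mfps))"
  by (rule finite_subset[OF mvars_minus]) simp

lemma finite_mvars_mult:
  "finite (mvars f) \<Longrightarrow> finite (mvars g) \<Longrightarrow> finite (mvars (f * g :: ('v, 'a::comm_ring_1) mfps))"
  by (rule finite_subset[OF mvars_mult]) simp

lemma finite_mvars_sum:
  fixes f :: "'i \<Rightarrow> ('v, 'a::comm_ring_1) mfps"
  assumes "\<And>i. i \<in> I \<Longrightarrow> finite (mvars (f i))"
  shows "finite (mvars (sum f I))"
proof (cases "finite I")
  case True
  then have "finite (\<Union>i\<in>I. mvars (f i))" by (rule finite_UN_I) (rule assms)
  then show ?thesis by (rule rev_finite_subset) (rule mvars_sum, rule UN_upper)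
next
  case False
  show ?thesis unfolding sum.infinite[OF False] mvars_0 by (rule finite.emptyI)
qed

lemma finite_mvars_prod:
  fixes f :: "'i \<Rightarrow> ('v, 'a::comm_ring_1) mfps"
  assumes "\<And>i. i \<in> I \<Longrightarrow> finite (mvars (f i))"
  shows "finite (mvars (prod f I))"
proof (cases "finite I")
  case True
  then have "finite (\<Union>i\<in>I. mvars (f i))" by (rule finite_UN_I) (rule assms)
  then show ?thesis by (rule rev_finite_subset) (rule mvars_prod, rule UN_upper)
next
  case False
  show ?thesis unfolding prod.infinite[OF False] mvars_1 by (rule finite.emptyI)
qed

lemma finite_mvars_mexp: "finite (mvars f) \<Longrightarrow> finite (mvars (mexp f))"
  by (rule finite_subset[OF mvars_mexp])

lemmas finite_mvars_intros = finite_mvars_add finite_mvars_minus finite_mvars_mult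
  finite_mvars_sum finite_mvars_prod finite_mvars_mexp

lemma adm_mvar [simp]: "adm (mvar v)" and adm_0 [simp]: "adm 0"
  by (auto simp: adm_def)

lemma adm_uminus: "adm f \<Longrightarrow> adm (- f)"
  by (simp add: adm_def)

lemma adm_add: "adm f \<Longrightarrow> adm g \<Longrightarrow> adm (f + g)"
  and adm_minus: "adm f \<Longrightarrow> adm g \<Longrightarrow> adm (f - g)"
  by (auto simp: adm_def intro: noconst_intros finite_mvars_intros)

lemma adm_sum: "(\<And>i. i \<in> I \<Longrightarrow> adm (f i)) \<Longrightarrow> adm (sum f I)"
  by (auto simp: adm_def intro: noconst_intros finite_mvars_intros)

lemma adm_of_nat_mult: "adm f \<Longrightarrow> adm (of_nat n * f)"
  by (auto simp: adm_def intro: noconst_intros finite_mvars_intros)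

lemma adm_noconst [simp]: "adm f \<Longrightarrow> noconst f"
  and adm_finite [simp]: "adm f \<Longrightarrow> finite (mvars f)"
  by (auto simp: adm_def)

lemmas adm_intros = adm_add adm_minus adm_sum adm_of_nat_mult adm_uminus

definition XY :: "nat \<Rightarrow> var set" where
  "XY n = Xvar ` {1..n} \<union> Yvar ` {1..n}"

lemma finite_XY [simp]: "finite (XY n)"
  by (simp add: XY_def)

lemma adm_case_var: "(\<And>i. adm (x i)) \<Longrightarrow> (\<And>i. adm (y i)) \<Longrightarrow> adm (case v of Xvar i \<Rightarrow> x i | Yvar i \<Rightarrow> y i)"
  by (cases v) auto

text \<open>List access is meaningful only for the indices 1 to n; the bound on the variables of
  \<open>B n\<close> ensures that no other index is ever read.\<close>

lemma bimould_at_map: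
  assumes "mvars (B n) \<subseteq> XY n"
  shows "bimould_at B (map x [1..<n + 1]) (map y [1..<n + 1]) =
    msubst (\<lambda>v. case v of Xvar i \<Rightarrow> x i | Yvar i \<Rightarrow> y i) (B n)"
proof -
  have "map x [1..<n + 1] ! (i - 1) = x i" "map y [1..<n + 1] ! (i - 1) = y i" if "i \<in> {1..n}" for i
    using that by (auto simp del: upt_Suc)
  moreover have "length (map x [1..<n + 1]) = n" by simp
  ultimately show ?thesis
    unfolding bimould_at_def using assms
    by (auto intro!: msubst_cong simp: XY_def simp del: upt_Suc split: var.splits)
qed

lemma mould_at_map:
  assumes "mvars (F n) \<subseteq> Xvar ` {1..n}"
  shows "mould_at F (map x [1..<n + 1]) =
    msubst (\<lambda>v. case v of Xvar i \<Rightarrow> x i | Yvar i \<Rightarrow> sY i) (F n)"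
proof -
  have "map x [1..<n + 1] ! (i - 1) = x i" if "i \<in> {1..n}" for i
    using that by (auto simp del: upt_Suc)
  moreover have "length (map x [1..<n + 1]) = n" by simp
  ultimately show ?thesis
    unfolding mould_at_def using assms
    by (auto intro!: msubst_cong simp del: upt_Suc split: var.splits)
qed

lemma mvars_bimould_at:
  assumes "mvars (B n) \<subseteq> XY n"
    and "\<And>k. k \<in> {1..n} \<Longrightarrow> mvars (x k) \<subseteq> W" "\<And>k. k \<in> {1..n} \<Longrightarrow> mvars (y k) \<subseteq> W"
  shows "mvars (bimould_at B (map x [1..<n + 1]) (map y [1..<n + 1])) \<subseteq> W"
  unfolding bimould_at_map[of B, OF assms(1)]
proof (rule order_trans[OF mvars_msubst], rule UN_least)
  fix v assume "v \<in> mvars (B n)"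
  then have "v \<in> XY n" using assms(1) by (rule subsetD[rotated])
  then consider k where "v = Xvar k" "k \<in> {1..n}" | k where "v = Yvar k" "k \<in> {1..n}"
    unfolding XY_def by blast
  then show "mvars (case v of Xvar i \<Rightarrow> x i | Yvar i \<Rightarrow> y i) \<subseteq> W"
    by cases (simp_all only: var.case assms)
qed

lemma msubst_bimould_at:
  assumes B: "mvars (B n) \<subseteq> XY n" and xy: "\<And>i. adm (x i)" "\<And>i. adm (y i)"
    and \<sigma>: "\<And>v. noconst (\<sigma> v)"
  shows "msubst \<sigma> (bimould_at B (map x [1..<n + 1]) (map y [1..<n + 1])) =
    bimould_at B (map (\<lambda>i. msubst \<sigma> (x i)) [1..<n + 1]) (map (\<lambda>i. msubst \<sigma> (y i)) [1..<n + 1])"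
proof -
  have fin: "finite (mvars (B n))" using B finite_XY by (rule finite_subset)
  have *: "msubst \<sigma> (case v of Xvar i \<Rightarrow> x i | Yvar i \<Rightarrow> y i) =
      (case v of Xvar i \<Rightarrow> msubst \<sigma> (x i) | Yvar i \<Rightarrow> msubst \<sigma> (y i))" for v
    by (cases v) auto
  show ?thesis
    unfolding bimould_at_map[of B, OF B]
    by (subst msubst_msubst[OF \<sigma> fin]) (auto simp: * xy adm_case_var)
qed

definition mould_ev :: "(nat list \<Rightarrow> rat) \<Rightarrow> nat \<Rightarrow> (nat \<Rightarrow> (var, rat) mfps) \<Rightarrow> (var, rat) mfps" where
  "mould_ev \<beta> n x = mould_at (gen \<beta>) (map x [1..<n + 1])"

lemma mvars_gen: "mvars (gen \<beta> n) \<subseteq> Xvar ` {1..n}"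
  by (rule mvars_subsetI) (simp add: gen_def split: if_splits)

lemma mould_ev_cong: "(\<And>k. 1 \<le> k \<Longrightarrow> k \<le> n \<Longrightarrow> x k = x' k) \<Longrightarrow> mould_ev \<beta> n x = mould_ev \<beta> n x'"
  unfolding mould_ev_def by (auto intro!: arg_cong[of _ _ "mould_at _"] simp del: upt_Suc)

lemma mvars_mould_ev:
  assumes "\<And>k. k \<in> {1..n} \<Longrightarrow> mvars (x k) \<subseteq> W"
  shows "mvars (mould_ev \<beta> n x) \<subseteq> W"
  unfolding mould_ev_def mould_at_map[of "gen \<beta>", OF mvars_gen]
proof (rule order_trans[OF mvars_msubst], rule UN_least)
  fix v assume "v \<in> mvars (gen \<beta> n)"
  then obtain k where "v = Xvar k" "k \<in> {1..n}" using mvars_gen[of \<beta> n] by blast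
  then show "mvars (case v of Xvar i \<Rightarrow> x i | Yvar i \<Rightarrow> sY i) \<subseteq> W" using assms by simp
qed

lemma finite_mvars_mould_ev: "(\<And>k. adm (x k)) \<Longrightarrow> finite (mvars (mould_ev \<beta> n x))"
  by (rule finite_subset[OF mvars_mould_ev[where W = "\<Union>k\<in>{1..n}. mvars (x k)"]]) auto

lemma msubst_mould_ev:
  assumes x: "\<And>i. adm (x i)" and \<sigma>: "\<And>v. noconst (\<sigma> v)"
  shows "msubst \<sigma> (mould_ev \<beta> n x) = mould_ev \<beta> n (\<lambda>i. msubst \<sigma> (x i))"
proof -
  have fin: "finite (mvars (gen \<beta> n))" by (rule finite_subset[OF mvars_gen]) simp
  show ?thesis
    unfolding mould_ev_def mould_at_map[of "gen \<beta>", OF mvars_gen]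
    by (subst msubst_msubst[OF \<sigma> fin])
      (use mvars_gen[of \<beta> n] in \<open>auto simp: x adm_case_var intro!: msubst_cong\<close>)
qed

section \<open>The bimould b and its swap invariance\<close>

definition b_ev :: "(nat list \<Rightarrow> rat) \<Rightarrow> nat \<Rightarrow> (nat \<Rightarrow> (var, rat) mfps) \<Rightarrow>
    (nat \<Rightarrow> (var, rat) mfps) \<Rightarrow> (var, rat) mfps" where
  "b_ev \<beta> n x y = bimould_at (bm_b \<beta>) (map x [1..<n + 1]) (map y [1..<n + 1])"

lemma bm_b_mould_ev:
  "bm_b \<beta> r = (\<Sum>j=0..r. \<Sum>i=0..j. mconst (gam \<beta> i)
     * mould_ev \<beta> (j - i) (\<lambda>k. \<Sum>l=1..j - i + 1 - k. sY l) * mould_ev \<beta> (r - j) (\<lambda>k. sX (j + k)))"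
  unfolding bm_b_def mould_ev_def map_upt_shift[of sX] map_rev_upt_1 ..

lemma mvars_bm_b: "mvars (bm_b \<beta> r) \<subseteq> XY r"
  unfolding bm_b_mould_ev
  by (intro mvars_sum mvars_le mvars_mould_ev) (auto simp: XY_def)

lemma b_ev_cong:
  "(\<And>k. 1 \<le> k \<Longrightarrow> k \<le> n \<Longrightarrow> x k = x' k) \<Longrightarrow> (\<And>k. 1 \<le> k \<Longrightarrow> k \<le> n \<Longrightarrow> y k = y' k) \<Longrightarrow>
    b_ev \<beta> n x y = b_ev \<beta> n x' y'"
  unfolding b_ev_def by (auto intro!: arg_cong2[of _ _ _ _ "bimould_at _"] simp del: upt_Suc)

lemma b_ev_eq:
  assumes "\<And>i. adm (x i)" "\<And>i. adm (y i)"
  shows "b_ev \<beta> n x y = (\<Sum>j=0..n. \<Sum>i=0..j. mconst (gam \<beta> i)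
     * mould_ev \<beta> (j - i) (\<lambda>k. \<Sum>l=1..j - i + 1 - k. y l) * mould_ev \<beta> (n - j) (\<lambda>k. x (j + k)))"
proof -
  define \<sigma> where "\<sigma> v = (case v of Xvar i \<Rightarrow> x i | Yvar i \<Rightarrow> y i)" for v
  have \<sigma>: "noconst (\<sigma> v)" for v
    unfolding \<sigma>_def by (cases v) (simp_all add: assms)
  have Y: "msubst \<sigma> (sY i) = y i" and X: "msubst \<sigma> (sX i) = x i" for i
    by (subst msubst_mvar[where \<sigma> = \<sigma>, OF \<sigma>], simp add: \<sigma>_def)+
  note fin = finite_mvars_intros finite_mvars_mould_ev adm_intros
  have YY: "msubst \<sigma> (\<Sum>l\<in>L. sY l) = (\<Sum>l\<in>L. y l)" for L
    by (simp add: msubst_sum[OF \<sigma>] Y)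
  have "b_ev \<beta> n x y = msubst \<sigma> (bm_b \<beta> n)"
    unfolding b_ev_def \<sigma>_def by (rule bimould_at_map[of "bm_b \<beta>", OF mvars_bm_b])
  also have "\<dots> = (\<Sum>j=0..n. \<Sum>i=0..j. mconst (gam \<beta> i)
     * mould_ev \<beta> (j - i) (\<lambda>k. \<Sum>l=1..j - i + 1 - k. y l) * mould_ev \<beta> (n - j) (\<lambda>k. x (j + k)))"
  proof -
    have *: "msubst \<sigma> (mconst c * mould_ev \<beta> a u * mould_ev \<beta> b w) =
        mconst c * mould_ev \<beta> a (\<lambda>k. msubst \<sigma> (u k)) * mould_ev \<beta> b (\<lambda>k. msubst \<sigma> (w k))"
      if "\<And>k. adm (u k)" "\<And>k. adm (w k)" for a b c u w
      by (simp add: msubst_mult[OF \<sigma>] msubst_mould_ev[OF _ \<sigma>] finite_mvars_mould_ev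
          finite_mvars_mult that)
    have "msubst \<sigma> (bm_b \<beta> n) = (\<Sum>j=0..n. \<Sum>i=0..j. msubst \<sigma> (mconst (gam \<beta> i)
       * mould_ev \<beta> (j - i) (\<lambda>k. \<Sum>l=1..j - i + 1 - k. sY l) * mould_ev \<beta> (n - j) (\<lambda>k. sX (j + k))))"
      unfolding bm_b_mould_ev by (subst msubst_sum[OF \<sigma>]; (intro fin sum.cong refl; simp)?)+
    then show ?thesis
      by (simp add: * adm_sum X YY)
  qed
  finally show ?thesis .
qed

text \<open>The new Y-arguments of the swap are consecutive differences of the x's, so the partial
  sums formed inside \<open>bm_b\<close> collapse.\<close>

lemma telescope_swap:
  fixes x :: "nat \<Rightarrow> 'a::ab_group_add"
  shows "m \<le> n \<Longrightarrow> (\<Sum>l=1..m. x (n + 1 - l) - x (n + 2 - l)) = x (n + 1 - m) - x (n + 1)"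
  by (induction m) (auto simp: Suc_diff_Suc)

text \<open>The swap merely trades the two \<beta>-factors of each summand: partial sums of the y's
  on one side, x's on the other, with the coefficient \<gamma>_i untouched. The base point x (n + 1)
  lets one statement cover \<open>bm_b\<close> itself (base point 0) and its occurrences in
  \<open>bm_LL\<close>, which are taken relative to X_j.\<close>

lemma b_ev_swap:
  assumes x: "\<And>i. adm (x i)" and y: "\<And>i. adm (y i)"
  shows "b_ev \<beta> n (\<lambda>k. x k - x (n + 1)) y =
    b_ev \<beta> n (\<lambda>k. \<Sum>l=1..n + 1 - k. y l) (\<lambda>k. x (n + 1 - k) - x (n + 2 - k))"
proof -
  define P where "P a = mould_ev \<beta> a (\<lambda>k. \<Sum>l=1..a + 1 - k. y l)" for a
  define Q where "Q c = mould_ev \<beta> c (\<lambda>k. x (n - c + k) - x (n + 1))" for c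
  have P': "mould_ev \<beta> (n - j) (\<lambda>k. \<Sum>l=1..n + 1 - (j + k). y l) = P (n - j)" if "j \<le> n" for j
    using that unfolding P_def by (intro mould_ev_cong) simp
  have Q': "mould_ev \<beta> a (\<lambda>k. \<Sum>l=1..a + 1 - k. x (n + 1 - l) - x (n + 2 - l)) = Q a"
    if "a \<le> n" for a
    unfolding Q_def
  proof (rule mould_ev_cong)
    fix k assume "1 \<le> k" "k \<le> a"
    then show "(\<Sum>l=1..a + 1 - k. x (n + 1 - l) - x (n + 2 - l)) = x (n - a + k) - x (n + 1)"
      using that by (subst telescope_swap) auto
  qed
  have "b_ev \<beta> n (\<lambda>k. x k - x (n + 1)) y =
      (\<Sum>j=0..n. \<Sum>i=0..j. mconst (gam \<beta> i) * P (j - i) * Q (n - j))"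
    by (subst b_ev_eq) (auto intro!: adm_intros x y simp: P_def Q_def)
  also have "\<dots> = (\<Sum>(j, i)\<in>(SIGMA j:{0..n}. {0..j}). mconst (gam \<beta> i) * P (j - i) * Q (n - j))"
    by (simp add: sum.Sigma)
  \<comment> \<open>P has depth j - i and Q has depth n - j; replacing j by n - (j - i) exchanges
    these depths and keeps i.\<close>
  also have "\<dots> = (\<Sum>(j, i)\<in>(SIGMA j:{0..n}. {0..j}). mconst (gam \<beta> i) * Q (j - i) * P (n - j))"
    by (rule sum.reindex_bij_witness[where i = "\<lambda>(j, i). (n - (j - i), i)" and j = "\<lambda>(j, i). (n - (j - i), i)"])
      (auto simp: mult_ac)
  also have "\<dots> = (\<Sum>j=0..n. \<Sum>i=0..j. mconst (gam \<beta> i) * Q (j - i) * P (n - j))"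
    by (simp add: sum.Sigma)
  also have "\<dots> = b_ev \<beta> n (\<lambda>k. \<Sum>l=1..n + 1 - k. y l) (\<lambda>k. x (n + 1 - k) - x (n + 2 - k))"
    by (subst b_ev_eq) (auto intro!: adm_intros x y sum.cong simp: P'[symmetric] Q'[symmetric])
  finally show ?thesis .
qed

lemma finite_mvars_bimould_at:
  assumes "mvars (B n) \<subseteq> XY n" "\<And>i. adm (x i)" "\<And>i. adm (y i)"
  shows "finite (mvars (bimould_at B (map x [1..<n + 1]) (map y [1..<n + 1])))"
  by (rule finite_subset[OF mvars_bimould_at[where B = B and W = "\<Union>k\<in>{1..n}. mvars (x k) \<union> mvars (y k)"]])
    (use assms in auto)

lemma finite_mvars_b_ev: "(\<And>i. adm (x i)) \<Longrightarrow> (\<And>i. adm (y i)) \<Longrightarrow> finite (mvars (b_ev \<beta> n x y))"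
  unfolding b_ev_def by (rule finite_mvars_bimould_at[of "bm_b \<beta>", OF mvars_bm_b])

lemma mvars_b_ev:
  "(\<And>k. k \<in> {1..n} \<Longrightarrow> mvars (x k) \<subseteq> W) \<Longrightarrow> (\<And>k. k \<in> {1..n} \<Longrightarrow> mvars (y k) \<subseteq> W) \<Longrightarrow>
    mvars (b_ev \<beta> n x y) \<subseteq> W"
  unfolding b_ev_def by (rule mvars_bimould_at[of "bm_b \<beta>", OF mvars_bm_b])

lemma msubst_b_ev:
  "(\<And>i. adm (x i)) \<Longrightarrow> (\<And>i. adm (y i)) \<Longrightarrow> (\<And>v. noconst (\<sigma> v)) \<Longrightarrow>
    msubst \<sigma> (b_ev \<beta> n x y) = b_ev \<beta> n (\<lambda>i. msubst \<sigma> (x i)) (\<lambda>i. msubst \<sigma> (y i))"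
  unfolding b_ev_def by (rule msubst_bimould_at[of "bm_b \<beta>", OF mvars_bm_b])

definition bt_ev :: "(nat list \<Rightarrow> rat) \<Rightarrow> nat \<Rightarrow> (nat \<Rightarrow> (var, rat) mfps) \<Rightarrow>
    (nat \<Rightarrow> (var, rat) mfps) \<Rightarrow> (var, rat) mfps" where
  "bt_ev \<beta> n x y = bimould_at (bm_bt \<beta>) (map x [1..<n + 1]) (map y [1..<n + 1])"

lemma bm_bt_b_ev:
  "bm_bt \<beta> r = (\<Sum>i=0..r. mconst ((-1) ^ i / (2 ^ i * fact i)) *
     b_ev \<beta> (r - i) (\<lambda>k. sX (i + k)) (\<lambda>k. - sY k))"
  unfolding bm_bt_def b_ev_def map_upt_shift[of sX] ..

lemma mvars_bm_bt: "mvars (bm_bt \<beta> r) \<subseteq> XY r"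
  unfolding bm_bt_b_ev by (intro mvars_sum mvars_le mvars_b_ev) (auto simp: XY_def)

lemma bt_ev_cong:
  "(\<And>k. 1 \<le> k \<Longrightarrow> k \<le> n \<Longrightarrow> x k = x' k) \<Longrightarrow> (\<And>k. 1 \<le> k \<Longrightarrow> k \<le> n \<Longrightarrow> y k = y' k) \<Longrightarrow>
    bt_ev \<beta> n x y = bt_ev \<beta> n x' y'"
  unfolding bt_ev_def by (auto intro!: arg_cong2[of _ _ _ _ "bimould_at _"] simp del: upt_Suc)

lemma finite_mvars_bt_ev: "(\<And>i. adm (x i)) \<Longrightarrow> (\<And>i. adm (y i)) \<Longrightarrow> finite (mvars (bt_ev \<beta> n x y))"
  unfolding bt_ev_def by (rule finite_mvars_bimould_at[of "bm_bt \<beta>", OF mvars_bm_bt])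

lemma mvars_bt_ev:
  "(\<And>k. k \<in> {1..n} \<Longrightarrow> mvars (x k) \<subseteq> W) \<Longrightarrow> (\<And>k. k \<in> {1..n} \<Longrightarrow> mvars (y k) \<subseteq> W) \<Longrightarrow>
    mvars (bt_ev \<beta> n x y) \<subseteq> W"
  unfolding bt_ev_def by (rule mvars_bimould_at[of "bm_bt \<beta>", OF mvars_bm_bt])

lemma msubst_bt_ev:
  "(\<And>i. adm (x i)) \<Longrightarrow> (\<And>i. adm (y i)) \<Longrightarrow> (\<And>v. noconst (\<sigma> v)) \<Longrightarrow>
    msubst \<sigma> (bt_ev \<beta> n x y) = bt_ev \<beta> n (\<lambda>i. msubst \<sigma> (x i)) (\<lambda>i. msubst \<sigma> (y i))"
  unfolding bt_ev_def by (rule msubst_bimould_at[of "bm_bt \<beta>", OF mvars_bm_bt])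

lemma bt_ev_eq:
  assumes "\<And>i. adm (x i)" "\<And>i. adm (y i)"
  shows "bt_ev \<beta> n x y = (\<Sum>i=0..n. mconst ((-1) ^ i / (2 ^ i * fact i)) *
     b_ev \<beta> (n - i) (\<lambda>k. x (i + k)) (\<lambda>k. - y k))"
proof -
  define \<sigma> where "\<sigma> v = (case v of Xvar i \<Rightarrow> x i | Yvar i \<Rightarrow> y i)" for v
  have \<sigma>: "noconst (\<sigma> v)" for v
    unfolding \<sigma>_def by (cases v) (simp_all add: assms)
  have Y: "msubst \<sigma> (- sY i) = - y i" and X: "msubst \<sigma> (sX i) = x i" for i
    by (simp only: msubst_uminus[OF \<sigma>] mvars_mvar finite.intros msubst_mvar[where \<sigma> = \<sigma>, OF \<sigma>],
        simp add: \<sigma>_def)+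
  have "bt_ev \<beta> n x y = msubst \<sigma> (bm_bt \<beta> n)"
    unfolding bt_ev_def \<sigma>_def by (rule bimould_at_map[of "bm_bt \<beta>", OF mvars_bm_bt])
  also have "\<dots> = (\<Sum>i=0..n. mconst ((-1) ^ i / (2 ^ i * fact i)) *
     b_ev \<beta> (n - i) (\<lambda>k. x (i + k)) (\<lambda>k. - y k))"
    unfolding bm_bt_b_ev
    by (simp add: msubst_sum[OF \<sigma>] msubst_mult[OF \<sigma>] msubst_b_ev[OF _ _ \<sigma>] X Y
        finite_mvars_mult finite_mvars_b_ev adm_uminus)
  finally show ?thesis .
qed

text \<open>Applied summand by summand: the coefficient depends only on the number i of dropped x's,
  and dropping the first i of them corresponds to dropping the first i entries after the swap. The
  sign that \<open>bm_bt\<close> puts on its y's reappears on both argument lists, whence the signed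
  form.\<close>

lemma bt_ev_swap:
  assumes x: "\<And>i. adm (x i)" and y: "\<And>i. adm (y i)"
  shows "bt_ev \<beta> n (\<lambda>k. x k - x (n + 1)) y =
    bt_ev \<beta> n (\<lambda>k. - (\<Sum>l=1..n + 1 - k. y l)) (\<lambda>k. x (n + 2 - k) - x (n + 1 - k))"
proof -
  have "b_ev \<beta> (n - i) (\<lambda>k. x (i + k) - x (n + 1)) (\<lambda>k. - y k) =
      b_ev \<beta> (n - i) (\<lambda>k. - (\<Sum>l=1..n + 1 - (i + k). y l)) (\<lambda>k. - (x (n + 2 - k) - x (n + 1 - k)))"
    if i: "i \<le> n" for i
  proof -
    \<comment> \<open>The family shifted by i has its base point at position n - i + 1, which is
      again x (n + 1).\<close>
    have "b_ev \<beta> (n - i) (\<lambda>k. x (i + k) - x (i + (n - i + 1))) (\<lambda>k. - y k) =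
        b_ev \<beta> (n - i) (\<lambda>k. \<Sum>l=1..n - i + 1 - k. - y l)
          (\<lambda>k. x (i + (n - i + 1 - k)) - x (i + (n - i + 2 - k)))"
      by (rule b_ev_swap[where x = "\<lambda>k. x (i + k)"]) (auto intro: x y adm_uminus)
    also have "\<dots> = b_ev \<beta> (n - i) (\<lambda>k. - (\<Sum>l=1..n + 1 - (i + k). y l))
        (\<lambda>k. - (x (n + 2 - k) - x (n + 1 - k)))"
      using i by (intro b_ev_cong) (auto simp: sum_negf Suc_diff_le)
    finally show ?thesis using i by simp
  qed
  then show ?thesis
    by (subst (1 2) bt_ev_eq) (auto intro!: adm_intros x y sum.cong)
qed

section \<open>Ferrers conjugation for parts with multiplicities, together with interlacing
  cuts\<close>

section \<open>Conjugation of partition data\<close>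

text \<open>\<open>S (j + 1) = r + 1\<close> and \<open>M (j + 1) = 0\<close> are sentinels: they
  give the last gap and the last difference of parts the same form as the others. Values outside the
  displayed ranges are arbitrary.\<close>

definition pdata :: "nat \<Rightarrow> nat \<Rightarrow> (nat \<Rightarrow> nat) \<Rightarrow> (nat \<Rightarrow> nat) \<Rightarrow> (nat \<Rightarrow> nat) \<Rightarrow> (nat \<Rightarrow> nat) \<Rightarrow> bool" where
  "pdata r j R S M D \<longleftrightarrow> R 0 = 0 \<and> R j \<le> r \<and> S (j + 1) = r + 1 \<and> M (j + 1) = 0 \<and>
    (\<forall>i\<in>{1..j}. R (i - 1) < S i \<and> S i \<le> R i \<and> M (i + 1) < M i \<and> 0 < D i)"

text \<open>The same reflection serves twice: applied to the old S it gives the new R, applied to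
  the old R the new S.\<close>

definition conjR :: "nat \<Rightarrow> nat \<Rightarrow> (nat \<Rightarrow> nat) \<Rightarrow> nat \<Rightarrow> nat" where
  "conjR r j F k = r + 1 - F (j + 1 - k)"

text \<open>In the Ferrers diagram this counts the parts of size at least
  \<open>M (j + 1 - k)\<close>, hence is the k-th distinct part of the conjugate partition; its
  multiplicity, \<open>conjD\<close>, is the step between neighbouring old parts.\<close>

definition conjM :: "nat \<Rightarrow> (nat \<Rightarrow> nat) \<Rightarrow> nat \<Rightarrow> nat" where
  "conjM j D k = (\<Sum>i=1..j + 1 - k. D i)"

definition conjD :: "nat \<Rightarrow> (nat \<Rightarrow> nat) \<Rightarrow> nat \<Rightarrow> nat" where
  "conjD j M k = M (j + 1 - k) - M (j + 2 - k)"

lemma abel_summation: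
  fixes a m :: "nat \<Rightarrow> 'a::comm_ring_1"
  shows "(\<Sum>k=1..j. m k * (a k - a (k - 1))) =
    (\<Sum>k=1..j. (m k - m (k + 1)) * a k) + m (j + 1) * a j - m 1 * a 0"
  by (induction j) (auto simp: algebra_simps)

lemma sum_reflect: "(\<Sum>k=1..j::nat. f k) = (\<Sum>k=1..j. f (j + 1 - k))"
  by (subst sum.atLeastAtMost_rev) simp

lemma prod_reflect: "(\<Prod>k=1..j::nat. f k) = (\<Prod>k=1..j. f (j + 1 - k))"
  by (subst prod.atLeastAtMost_rev) simp

lemma sum_conjD:
  assumes "\<And>i. i \<in> {1..j} \<Longrightarrow> M (i + 1) \<le> M i"
  shows "n \<le> j \<Longrightarrow> (\<Sum>i=1..n. conjD j M i) + M (j + 1) = M (j + 1 - n)"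
proof (induction n)
  case (Suc n)
  obtain d where d: "j = Suc n + d" using Suc.prems le_Suc_ex by blast
  have "M (d + 2) \<le> M (d + 1)" using assms[of "d + 1"] d by simp
  moreover have "(\<Sum>i=1..n. conjD j M i) + M (j + 1) = M (d + 2)"
    using Suc d by simp
  moreover have "conjD j M (Suc n) = M (d + 1) - M (d + 2)" "j + 1 - Suc n = d + 1"
    by (simp_all add: conjD_def d)
  ultimately show ?case by simp
qed simp

text \<open>The interlacing makes R increase, so the bound on \<open>R j\<close> propagates
  downwards; the case i = j + 1 comes from the sentinel.\<close>

lemma pdata_bounds:
  assumes "pdata r j R S M D"
  shows "i \<le> j \<Longrightarrow> R i \<le> r" "1 \<le> i \<Longrightarrow> i \<le> j + 1 \<Longrightarrow> S i \<le> r + 1"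
    "1 \<le> i \<Longrightarrow> i \<le> j + 1 \<Longrightarrow> R (i - 1) < S i" "1 \<le> i \<Longrightarrow> i \<le> j \<Longrightarrow> S i \<le> R i"
proof -
  show R: "R i \<le> r" if "i \<le> j" for i
    using that
  proof (induction i rule: inc_induct)
    case base
    then show ?case using assms by (simp add: pdata_def)
  next
    case (step n)
    then have "Suc n \<in> {1..j}" by auto
    then have "R (Suc n - 1) < S (Suc n) \<and> S (Suc n) \<le> R (Suc n)"
      using assms unfolding pdata_def by blast
    then have "R n < R (Suc n)" by simp
    then show ?case using step.IH by simp
  qed
  have SR: "R (i - 1) < S i \<and> S i \<le> R i" if "1 \<le> i" "i \<le> j" for i
    using assms that unfolding pdata_def by (metis atLeastAtMost_iff)
  then show "S i \<le> R i" if "1 \<le> i" "i \<le> j" using that by blast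
  have last: "S (j + 1) = r + 1" "R j \<le> r" using assms by (auto simp only: pdata_def)
  show "S i \<le> r + 1" if "1 \<le> i" "i \<le> j + 1"
  proof (cases "i = j + 1")
    case False
    then have "i \<le> j" using that by simp
    then show ?thesis using SR[of i] R[of i] that by linarith
  qed (use last in simp)
  show "R (i - 1) < S i" if "1 \<le> i" "i \<le> j + 1"
  proof (cases "i = j + 1")
    case False
    then have "i \<le> j" using that by simp
    then show ?thesis using SR[of i] that by blast
  qed (use last in simp)
qed

text \<open>Reflection reverses the interlacing chain and exchanges its strict and weak links
  correctly because R and S change roles. Positive multiplicities make the new parts strictly
  decreasing, and strict decrease of the old parts makes the new multiplicities positive.\<close>

lemma pdata_conj:
  assumes P: "pdata r j R S M D"
  shows "pdata r j (conjR r j S) (conjR r j R) (conjM j D) (conjD j M)"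
  unfolding pdata_def
proof (intro conjI ballI)
  note B = pdata_bounds[OF P]
  show "conjR r j S 0 = 0" "conjR r j R (j + 1) = r + 1" "conjM j D (j + 1) = 0"
    using P by (auto simp: conjR_def conjM_def pdata_def)
  show "conjR r j S j \<le> r" using B(3)[of 1] by (auto simp: conjR_def)
  fix i assume i: "i \<in> {1..j}"
  have ix: "j + 1 - (i - 1) = (j + 1 - i) + 1" "j + 1 - (i + 1) = j - i" "j + 1 - i = Suc (j - i)"
     "j + 2 - i = (j + 1 - i) + 1"
    using i by auto
  show "conjR r j S (i - 1) < conjR r j R i"
    unfolding conjR_def ix(1)
  proof (rule diff_less_mono2)
    have n: "j + 1 - i \<le> j" using i by auto
    show "R (j + 1 - i) < S (j + 1 - i + 1)" using B(3)[of "j + 1 - i + 1"] n by simp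
    show "R (j + 1 - i) < r + 1" using B(1)[OF n] by simp
  qed
  show "conjR r j R i \<le> conjR r j S i"
    unfolding conjR_def using B(4)[of "j + 1 - i"] i by (intro diff_le_mono2) auto
  have "j + 1 - i \<in> {1..j}" using i by auto
  then have M: "M (j + 1 - i + 1) < M (j + 1 - i)" and D: "0 < D (j + 1 - i)"
    using P by (auto simp: pdata_def)
  show "conjM j D (i + 1) < conjM j D i"
    using D unfolding conjM_def ix by simp
  show "0 < conjD j M i" using M unfolding conjD_def ix(4) by simp
qed

text \<open>The bounds keep all truncated subtractions exact; partial sums and successive
  differences are inverse to each other because M ends in 0.\<close>

lemma conj_conj:
  assumes P: "pdata r j R S M D"
  shows "k \<le> j \<Longrightarrow> conjR r j (conjR r j R) k = R k"
    and "1 \<le> k \<Longrightarrow> k \<le> j + 1 \<Longrightarrow> conjR r j (conjR r j S) k = S k"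
    and "1 \<le> k \<Longrightarrow> k \<le> j + 1 \<Longrightarrow> conjM j (conjD j M) k = M k"
    and "1 \<le> k \<Longrightarrow> k \<le> j \<Longrightarrow> conjD j (conjM j D) k = D k"
proof -
  note B = pdata_bounds[OF P]
  show "conjR r j (conjR r j R) k = R k" if "k \<le> j"
    using that B(1)[of k] by (simp add: conjR_def)
  show "conjR r j (conjR r j S) k = S k" if "1 \<le> k" "k \<le> j + 1"
    using that B(2)[of k] by (simp add: conjR_def)
  show "conjM j (conjD j M) k = M k" if "1 \<le> k" "k \<le> j + 1"
  proof -
    have "(\<Sum>i=1..j + 1 - k. conjD j M i) + M (j + 1) = M (j + 1 - (j + 1 - k))"
      by (rule sum_conjD) (use P that in \<open>auto simp: pdata_def less_imp_le\<close>)
    then show ?thesis using P that by (simp add: conjM_def pdata_def)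
  qed
  show "conjD j (conjM j D) k = D k" if k: "1 \<le> k" "k \<le> j"
  proof -
    obtain k' where k': "k = Suc k'" using k by (cases k) auto
    then have "j + 1 - (j + 1 - k) = Suc k'" "j + 1 - (j + 2 - k) = k'"
      using k by auto
    then show ?thesis by (simp add: conjD_def conjM_def k')
  qed
qed

lemma conjM_diff:
  assumes "k \<in> {1..j}"
  shows "conjM j D (j + 1 - k) = conjM j D (j + 1 - k + 1) + D k"
proof -
  obtain k' where k': "k = Suc k'" using assms by (cases k) auto
  then have "j + 1 - (j + 1 - k) = Suc k'" "j + 1 - (j + 1 - k + 1) = k'"
    using assms by auto
  then show ?thesis by (simp add: conjM_def k')
qed

lemma conjD_reflect: "k \<in> {1..j} \<Longrightarrow> conjD j M (j + 1 - k) = M k - M (k + 1)"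
  by (simp add: conjD_def)

text \<open>A partition and its conjugate have the same size; algebraically this is summation by
  parts.\<close>

lemma pdata_weight:
  assumes P: "pdata r j R S M D"
  shows "(\<Sum>i=1..j. conjM j D i * conjD j M i) = (\<Sum>i=1..j. M i * D i)"
proof -
  have "int (\<Sum>i=1..j. conjM j D i * conjD j M i) =
      (\<Sum>k=1..j. int (conjM j D k) * (int (M (j + 1 - k)) - int (M (j + 1 - (k - 1)))))"
    unfolding of_nat_sum of_nat_mult
  proof (intro sum.cong refl arg_cong2[of _ _ _ _ "(*)"])
    fix k assume k: "k \<in> {1..j}"
    have "j + 1 - k \<in> {1..j}" using k by auto
    then have "M (j + 1 - k + 1) < M (j + 1 - k)" using P by (auto simp: pdata_def)
    moreover have "j + 2 - k = j + 1 - k + 1" "j + 1 - (k - 1) = j + 1 - k + 1" using k by auto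
    ultimately show "int (conjD j M k) = int (M (j + 1 - k)) - int (M (j + 1 - (k - 1)))"
      by (simp only: conjD_def of_nat_diff less_imp_le)
  qed
  \<comment> \<open>Both boundary terms vanish: \<open>conjM j D (j + 1)\<close> is an empty sum and
    \<open>M (j + 1) = 0\<close>.\<close>
  also have "\<dots> = (\<Sum>k=1..j. (int (conjM j D k) - int (conjM j D (k + 1))) * int (M (j + 1 - k)))"
    using P by (subst abel_summation[where a = "\<lambda>k. int (M (j + 1 - k))"])
      (simp add: pdata_def conjM_def)
  also have "\<dots> = (\<Sum>k=1..j. int (D k) * int (M k))"
    by (subst sum_reflect) (intro sum.cong refl, simp add: conjM_diff del: One_nat_def)
  also have "\<dots> = int (\<Sum>i=1..j. M i * D i)"
    by (simp add: mult.commute)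
  finally show ?thesis by (simp only: of_nat_eq_iff)
qed

section \<open>Action of the swap on a single summand\<close>

section \<open>The swap\<close>

text \<open>\<open>Xext r k\<close> is \<open>X\<^sub>k\<close> with the convention \<open>X\<^bsub>r+1\<^esub> = 0\<close>: the last factor
  \<open>\<bb>[X\<^bsub>a+1\<^esub>, \<dots>, X\<^sub>r | Y\<^bsub>a+1\<^esub>, \<dots>, Y\<^sub>r]\<close> of \<open>\<GG>\<^sub>j\<close> then has the same form as the factors
  of the \<open>\<LL>\<^sub>m\<close>, for the gap between \<open>a\<close> and \<open>r + 1\<close>.\<close>

definition Xext :: "nat \<Rightarrow> nat \<Rightarrow> (var, 'a::comm_ring_1) mfps" where
  "Xext r k = (if k \<le> r then sX k else 0)"

definition Ysum :: "nat \<Rightarrow> (var, 'a::comm_ring_1) mfps" where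
  "Ysum k = (\<Sum>l=1..k. sY l)"

text \<open>The isolated first entry X_r of the swapped Y-list is the difference X_r - X_(r+1), so
  \<open>Xext\<close> absorbs it into the general pattern.\<close>

definition swap_map :: "nat \<Rightarrow> var \<Rightarrow> (var, 'a::comm_ring_1) mfps" where
  "swap_map r v = (case v of Xvar i \<Rightarrow> Ysum (r + 1 - i)
     | Yvar i \<Rightarrow> Xext r (r + 1 - i) - Xext r (r + 2 - i))"

lemma adm_Xext [simp]: "adm (Xext r k)" and adm_Ysum [simp]: "adm (Ysum k)"
  by (auto simp: Xext_def Ysum_def intro: adm_sum)

lemma adm_swap_map [simp]: "adm (swap_map r v)"
  by (cases v) (auto simp: swap_map_def intro: adm_minus)

lemma to_q_Xext [simp]: "to_q (Xext r k) = Xext r k" and to_q_Ysum [simp]: "to_q (Ysum k) = Ysum k"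
  by (auto simp: Xext_def Ysum_def to_q_sum)

lemma to_q_swap_map: "to_q (swap_map r v) = swap_map r v"
  by (cases v) (auto simp: swap_map_def)

lemma Ysum_diff_shift: "Ysum (a + m) - Ysum a = (\<Sum>l=1..m. sY (a + l))"
  by (induction m) (auto simp: Ysum_def algebra_simps)

lemma Ysum_diff_reflect: "m \<le> t \<Longrightarrow> Ysum t - Ysum (t - m) = (\<Sum>l=1..m. sY (t + 1 - l))"
proof (induction m)
  case (Suc m)
  have "t - m = Suc (t - Suc m)" using Suc.prems by simp
  then have "Ysum (t - m) = Ysum (t - Suc m) + sY (t + 1 - Suc m)"
    by (simp add: Ysum_def)
  then show ?case using Suc by (simp add: algebra_simps)
qed simp

lemma swap_mvar: "msubst (swap_map r) (mvar v) = swap_map r v"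
  by (rule msubst_mvar) simp

text \<open>With \<open>swap_Ysum\<close> this makes the swap symmetric: \<open>Xext r k\<close> and
  \<open>Ysum (r + 1 - k)\<close> are interchanged. The conventions agree at the end, where X_(r+1)
  = 0 meets the empty sum \<open>Ysum 0\<close>.\<close>

lemma swap_Xext: "msubst (swap_map r) (Xext r k) = Ysum (r + 1 - k)"
  by (simp add: Xext_def swap_mvar) (simp add: swap_map_def Ysum_def)

lemma swap_Y: "msubst (swap_map r) (sY k) = Xext r (r + 1 - k) - Xext r (r + 2 - k)"
  by (simp add: swap_mvar swap_map_def)

lemma swap_Ysum:
  assumes "m \<le> r"
  shows "msubst (swap_map r) (Ysum m) = Xext r (r + 1 - m)"
proof -
  have "msubst (swap_map r) (Ysum m) = (\<Sum>l=1..m. Xext r (r + 1 - l) - Xext r (r + 2 - l))"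
    by (simp add: Ysum_def msubst_sum swap_Y)
  also have "\<dots> = Xext r (r + 1 - m) - Xext r (r + 1)"
    using assms by (rule telescope_swap)
  finally show ?thesis by (simp add: Xext_def)
qed

lemma swap_diff:
  "adm f \<Longrightarrow> adm g \<Longrightarrow> msubst (swap_map r) (f - g) = msubst (swap_map r) f - msubst (swap_map r) g"
  by (simp add: msubst_minus)

text \<open>The indices strictly between \<open>a\<close> and \<open>c\<close>, with base point X_c.
  For c = r + 1 the base point is 0.\<close>

definition gapL :: "(nat list \<Rightarrow> rat) \<Rightarrow> nat \<Rightarrow> nat \<Rightarrow> nat \<Rightarrow> (var, rat) mfps" where
  "gapL \<beta> r a c = b_ev \<beta> (c - a - 1) (\<lambda>k. Xext r (a + k) - Xext r c) (\<lambda>k. sY (a + k))"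

text \<open>The indices from s + 1 to t, read downwards as in the right-hand factor of
  \<open>bm_LL\<close>, with base point X_s.\<close>

definition gapR :: "(nat list \<Rightarrow> rat) \<Rightarrow> nat \<Rightarrow> nat \<Rightarrow> nat \<Rightarrow> (var, rat) mfps" where
  "gapR \<beta> r s t = bt_ev \<beta> (t - s) (\<lambda>k. Xext r (t + 1 - k) - Xext r s) (\<lambda>k. sY (t + 1 - k))"

lemma finite_mvars_gapL [simp]: "finite (mvars (gapL \<beta> r a c))"
  and finite_mvars_gapR [simp]: "finite (mvars (gapR \<beta> r a c))"
  unfolding gapL_def gapR_def
  by (auto intro!: finite_mvars_b_ev finite_mvars_bt_ev adm_minus)

text \<open>Obtained by applying \<open>b_ev_swap\<close> to the target gap, whose x-family is
  shifted by r + 1 - c; the resulting sums of Y's are differences of \<open>Ysum\<close>.\<close>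

lemma swap_gapL:
  assumes "a < c" "c \<le> r + 1"
  shows "msubst (swap_map r) (gapL \<beta> r a c) = gapL \<beta> r (r + 1 - c) (r + 1 - a)"
proof -
  define n where "n = c - a - 1"
  define a' where "a' = r + 1 - c"
  have c: "c = a + n + 1" and r: "r = a' + a + n" using assms by (auto simp: n_def a'_def)
  have "gapL \<beta> r a' (r + 1 - a) = b_ev \<beta> n (\<lambda>k. Xext r (a' + k) - Xext r (a' + (n + 1))) (\<lambda>k. sY (a' + k))"
    by (simp add: gapL_def r)
  also have "\<dots> = b_ev \<beta> n (\<lambda>k. \<Sum>l=1..n + 1 - k. sY (a' + l))
      (\<lambda>k. Xext r (a' + (n + 1 - k)) - Xext r (a' + (n + 2 - k)))"
    by (rule b_ev_swap[where x = "\<lambda>k. Xext r (a' + k)"]) auto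
  also have "\<dots> = b_ev \<beta> n (\<lambda>k. Ysum (r + 1 - (a + k)) - Ysum (r + 1 - c))
      (\<lambda>k. Xext r (r + 1 - (a + k)) - Xext r (r + 2 - (a + k)))"
  proof (rule b_ev_cong)
    fix k assume k: "1 \<le> k" "k \<le> n"
    then have *: "r + 1 - (a + k) = a' + (n + 1 - k)" "r + 2 - (a + k) = a' + (n + 2 - k)" "r + 1 - c = a'"
      by (auto simp: r c)
    show "(\<Sum>l=1..n + 1 - k. sY (a' + l)) = Ysum (r + 1 - (a + k)) - (Ysum (r + 1 - c) :: (var, rat) mfps)"
      unfolding * Ysum_diff_shift ..
    show "Xext r (a' + (n + 1 - k)) - Xext r (a' + (n + 2 - k)) =
        Xext r (r + 1 - (a + k)) - (Xext r (r + 2 - (a + k)) :: (var, rat) mfps)"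
      unfolding * ..
  qed
  also have "\<dots> = msubst (swap_map r) (gapL \<beta> r a c)"
    unfolding gapL_def n_def
    by (subst msubst_b_ev) (auto intro!: adm_minus simp: swap_diff swap_Xext swap_Y)
  finally show ?thesis by (simp add: a'_def)
qed

lemma swap_gapR:
  assumes "1 \<le> s" "s \<le> t" "t \<le> r"
  shows "msubst (swap_map r) (gapR \<beta> r s t) = gapR \<beta> r (r + 1 - t) (r + 1 - s)"
proof -
  define n where "n = t - s"
  define t' where "t' = r + 1 - s"
  have t: "t = s + n" and r: "r + 1 = t' + s" "n < t'" using assms by (auto simp: n_def t'_def)
  \<comment> \<open>Reading downwards from t' puts the base point at position n + 1, since t' - n =
    r + 1 - t; this is the shape that \<open>bt_ev_swap\<close> expects.\<close>
  have "gapR \<beta> r (r + 1 - t) t' = bt_ev \<beta> n (\<lambda>k. Xext r (t' + 1 - k) - Xext r (t' + 1 - (n + 1))) (\<lambda>k. sY (t' + 1 - k))"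
    using r by (simp add: gapR_def t)
  also have "\<dots> = bt_ev \<beta> n (\<lambda>k. - (\<Sum>l=1..n + 1 - k. sY (t' + 1 - l)))
      (\<lambda>k. Xext r (t' + 1 - (n + 2 - k)) - Xext r (t' + 1 - (n + 1 - k)))"
    by (rule bt_ev_swap[where x = "\<lambda>k. Xext r (t' + 1 - k)"]) auto
  also have "\<dots> = bt_ev \<beta> n (\<lambda>k. Ysum (r + 1 - (t + 1 - k)) - Ysum (r + 1 - s))
      (\<lambda>k. Xext r (r + 1 - (t + 1 - k)) - Xext r (r + 2 - (t + 1 - k)))"
  proof (rule bt_ev_cong)
    fix k assume k: "1 \<le> k" "k \<le> n"
    then have *: "r + 1 - (t + 1 - k) = t' - (n + 1 - k)" "t' + 1 - (n + 2 - k) = t' - (n + 1 - k)"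
      "r + 2 - (t + 1 - k) = t' + 1 - (n + 1 - k)" "r + 1 - s = t'" "n + 1 - k \<le> t'"
      using r by (auto simp: t)
    show "- (\<Sum>l=1..n + 1 - k. sY (t' + 1 - l)) =
        Ysum (r + 1 - (t + 1 - k)) - (Ysum (r + 1 - s) :: (var, rat) mfps)"
      unfolding * Ysum_diff_reflect[OF *(5), symmetric] by simp
    show "Xext r (t' + 1 - (n + 2 - k)) - Xext r (t' + 1 - (n + 1 - k)) =
        Xext r (r + 1 - (t + 1 - k)) - (Xext r (r + 2 - (t + 1 - k)) :: (var, rat) mfps)"
      unfolding * ..
  qed
  also have "\<dots> = msubst (swap_map r) (gapR \<beta> r s t)"
    unfolding gapR_def n_def
    by (subst msubst_bt_ev) (auto intro!: adm_minus simp: swap_diff swap_Xext swap_Y)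
  finally show ?thesis by (simp add: t'_def)
qed

text \<open>The Y-sum of a block is written as a difference of \<open>Ysum\<close> so that summation
  by parts applies.\<close>

definition expo :: "nat \<Rightarrow> nat \<Rightarrow> (nat \<Rightarrow> nat) \<Rightarrow> (nat \<Rightarrow> nat) \<Rightarrow> (nat \<Rightarrow> nat) \<Rightarrow> (nat \<Rightarrow> nat) \<Rightarrow> (var, rat) mfps" where
  "expo r j R S M D = (\<Sum>i=1..j. of_nat (D i) * Xext r (S i) + of_nat (M i) * (Ysum (R i) - Ysum (R (i - 1))))"

definition gterm :: "(nat list \<Rightarrow> rat) \<Rightarrow> nat \<Rightarrow> nat \<Rightarrow> (nat \<Rightarrow> nat) \<Rightarrow> (nat \<Rightarrow> nat) \<Rightarrow> (nat \<Rightarrow> nat) \<Rightarrow>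
    (nat \<Rightarrow> nat) \<Rightarrow> (var, rat fps) mfps" where
  "gterm \<beta> r j R S M D =
     to_q ((\<Prod>i=1..j + 1. gapL \<beta> r (R (i - 1)) (S i)) * (\<Prod>i=1..j. gapR \<beta> r (S i) (R i)) *
       mexp (expo r j R S M D)) * mconst (fps_X ^ (\<Sum>i=1..j. M i * D i))"

lemma msubst_to_q_mult:
  assumes "\<And>v. noconst (\<sigma> v)" "finite (mvars F)"
  shows "msubst (\<lambda>v. to_q (\<sigma> v)) (to_q F * mconst c) = to_q (msubst \<sigma> F) * mconst c"
  using assms by (simp add: msubst_mult msubst_to_q)

lemma adm_expo [simp]: "adm (expo r j R S M D)"
  unfolding expo_def by (intro adm_intros) auto

text \<open>\<open>?A\<close> collects the Y-part and \<open>?B\<close> the X-part after the swap.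
  The first comes directly from the old X-part, the second from the old Y-part by summation by
  parts; on the conjugate side the roles are reversed.\<close>

lemma swap_expo:
  assumes P: "pdata r j R S M D"
  shows "msubst (swap_map r) (expo r j R S M D) =
    expo r j (conjR r j S) (conjR r j R) (conjM j D) (conjD j M)"
proof -
  note B = pdata_bounds[OF P]
  let ?R = "conjR r j S" and ?S = "conjR r j R" and ?M = "conjM j D" and ?D = "conjD j M"
  let ?A = "\<Sum>i=1..j. of_nat (D i) * Ysum (r + 1 - S i) :: (var, rat) mfps"
  let ?B = "\<Sum>i=1..j. (of_nat (M i) - of_nat (M (i + 1))) * Xext r (r + 1 - R i) :: (var, rat) mfps"
  have summand: "msubst (swap_map r) (of_nat (D i) * Xext r (S i) + of_nat (M i) * (Ysum (R i) - Ysum (R (i - 1))))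
      = of_nat (D i) * Ysum (r + 1 - S i) + of_nat (M i) * (Xext r (r + 1 - R i) - Xext r (r + 1 - R (i - 1)) :: (var, rat) mfps)"
    if "i \<in> {1..j}" for i
  proof -
    have "i \<le> j" "i - 1 \<le> j" using that by auto
    then have "R i \<le> r" "R (i - 1) \<le> r"
      using B(1)[of i] B(1)[of "i - 1"] by simp_all
    then show ?thesis
      by (simp add: msubst_add msubst_mult msubst_minus finite_mvars_intros swap_Xext swap_Ysum del: One_nat_def)
  qed
  have "msubst (swap_map r) (expo r j R S M D) = (\<Sum>i=1..j. of_nat (D i) * Ysum (r + 1 - S i) +
      of_nat (M i) * (Xext r (r + 1 - R i) - Xext r (r + 1 - R (i - 1))))"
    unfolding expo_def
    by (subst msubst_sum) (auto intro!: finite_mvars_intros sum.cong summand simp del: One_nat_def)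
  \<comment> \<open>The boundary terms vanish because \<open>M (j + 1) = 0\<close> and because R 0 =
    0 leads to \<open>Xext r (r + 1) = 0\<close>.\<close>
  also have "\<dots> = ?A + ?B"
    unfolding sum.distrib using P
    by (subst abel_summation[where a = "\<lambda>i. Xext r (r + 1 - R i)"]) (simp add: pdata_def Xext_def)
  finally have lhs: "msubst (swap_map r) (expo r j R S M D) = ?A + ?B" .
  have "expo r j ?R ?S ?M ?D = (\<Sum>k=1..j. of_nat (?D k) * Xext r (?S k)) +
      (\<Sum>k=1..j. (of_nat (?M k) - of_nat (?M (k + 1))) * Ysum (?R k))"
    unfolding expo_def sum.distrib using pdata_conj[OF P]
    by (subst abel_summation[where a = "\<lambda>i. Ysum (?R i)"]) (simp add: pdata_def Ysum_def)
  also have "(\<Sum>k=1..j. of_nat (?D k) * Xext r (?S k)) = ?B"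
  proof (subst sum_reflect, rule sum.cong[OF refl])
    fix k assume k: "k \<in> {1..j}"
    then have "M (k + 1) < M k" using P by (auto simp: pdata_def)
    then show "of_nat (?D (j + 1 - k)) * Xext r (?S (j + 1 - k)) =
        (of_nat (M k) - of_nat (M (k + 1))) * (Xext r (r + 1 - R k) :: (var, rat) mfps)"
      using k by (simp add: conjD_reflect conjR_def del: One_nat_def)
  qed
  also have "(\<Sum>k=1..j. (of_nat (?M k) - of_nat (?M (k + 1))) * Ysum (?R k)) = ?A"
  proof (subst sum_reflect, rule sum.cong[OF refl])
    fix k assume k: "k \<in> {1..j}"
    then show "(of_nat (?M (j + 1 - k)) - of_nat (?M (j + 1 - k + 1))) * Ysum (?R (j + 1 - k)) =
        of_nat (D k) * (Ysum (r + 1 - S k) :: (var, rat) mfps)"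
      by (subst conjM_diff) (auto simp: conjR_def)
  qed
  finally show ?thesis unfolding lhs by (simp add: add.commute)
qed

text \<open>The j + 1 left gaps are permuted by i to j + 2 - i and the j right gaps by i to j + 1 -
  i; exponent and weight are covered by \<open>swap_expo\<close> and
  \<open>pdata_weight\<close>.\<close>

lemma swap_gterm:
  assumes P: "pdata r j R S M D"
  shows "msubst (swap_map r) (gterm \<beta> r j R S M D) =
    gterm \<beta> r j (conjR r j S) (conjR r j R) (conjM j D) (conjD j M)"
proof -
  note B = pdata_bounds[OF P]
  let ?R = "conjR r j S" and ?S = "conjR r j R" and ?M = "conjM j D" and ?D = "conjD j M"
  let ?PL = "\<Prod>i=1..j + 1. gapL \<beta> r (R (i - 1)) (S i)"
  let ?PR = "\<Prod>i=1..j. gapR \<beta> r (S i) (R i)"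
  have fin: "finite (mvars ?PL)" "finite (mvars ?PR)" "finite (mvars (mexp (expo r j R S M D)))"
    by (intro finite_mvars_prod finite_mvars_mexp finite_mvars_gapL finite_mvars_gapR adm_finite adm_expo)+
  have L: "msubst (swap_map r) ?PL = (\<Prod>i=1..j + 1. gapL \<beta> r (?R (i - 1)) (?S i))"
  proof -
    have "msubst (swap_map r) ?PL = (\<Prod>i=1..j + 1. gapL \<beta> r (r + 1 - S i) (r + 1 - R (i - 1)))"
      by (subst msubst_prod) (auto intro!: prod.cong swap_gapL B(2,3) simp del: prod.cl_ivl_Suc One_nat_def)
    also have "\<dots> = (\<Prod>i=1..j + 1. gapL \<beta> r (?R (i - 1)) (?S i))"
      by (subst prod_reflect, rule prod.cong[OF refl]) (auto simp: conjR_def Suc_diff_le)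
    finally show ?thesis .
  qed
  have R: "msubst (swap_map r) ?PR = (\<Prod>i=1..j. gapR \<beta> r (?S i) (?R i))"
  proof -
    have "msubst (swap_map r) ?PR = (\<Prod>i=1..j. gapR \<beta> r (r + 1 - R i) (r + 1 - S i))"
    proof (subst msubst_prod)
      show "(\<Prod>i=1..j. msubst (swap_map r) (gapR \<beta> r (S i) (R i))) =
          (\<Prod>i=1..j. gapR \<beta> r (r + 1 - R i) (r + 1 - S i))"
      proof (intro prod.cong refl swap_gapR)
        fix i assume "i \<in> {1..j}"
        then show "1 \<le> S i" "S i \<le> R i" "R i \<le> r" using B(1)[of i] B(3)[of i] B(4)[of i] by auto
      qed
    qed auto
    also have "\<dots> = (\<Prod>i=1..j. gapR \<beta> r (?S i) (?R i))"
      by (subst prod_reflect, rule prod.cong[OF refl]) (auto simp: conjR_def)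
    finally show ?thesis .
  qed
  have "msubst (swap_map r) (gterm \<beta> r j R S M D) =
      to_q (msubst (swap_map r) (?PL * ?PR * mexp (expo r j R S M D))) * mconst (fps_X ^ (\<Sum>i=1..j. M i * D i))"
    unfolding gterm_def to_q_swap_map[symmetric]
    by (intro msubst_to_q_mult adm_noconst adm_swap_map finite_mvars_mult fin)
  also have "msubst (swap_map r) (?PL * ?PR * mexp (expo r j R S M D)) =
      msubst (swap_map r) ?PL * msubst (swap_map r) ?PR * mexp (msubst (swap_map r) (expo r j R S M D))"
    by (simp only: msubst_mult fin finite_mvars_mult adm_noconst adm_finite adm_swap_map adm_expo msubst_mexp)
  finally show ?thesis
    unfolding gterm_def L R swap_expo[OF P] pdata_weight[OF P] .
qed

section \<open>From the definition of \<open>bm_G\<close> to finite sums over partition data\<close>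

section \<open>Expansion of L and LL modulo powers of q\<close>

lemma mvars_bm_L:
  assumes "m \<ge> 1" shows "mvars (bm_L m r) \<subseteq> XY 1"
proof (rule mvars_qcong)
  fix N
  have "mvars (mexp (of_nat d * sX 1 + of_nat m * sY 1)) \<subseteq> XY 1" for d
    by (intro order_trans[OF mvars_mexp] mvars_le) (auto simp: XY_def)
  then have "mvars (\<Sum>d=1..N. to_q (mexp (of_nat d * sX 1 + of_nat m * sY 1)) *
      mconst (fps_X ^ (m * d))) \<subseteq> XY 1"
    by (intro mvars_le) auto
  then show "\<exists>g. qcong N (bm_L m r) g \<and> mvars g \<subseteq> XY 1"
    using qcong_bm_L[OF assms] by blast
qed

lemma qcong_bm_L_at:
  assumes m: "m \<ge> 1" and x: "adm x" and y: "adm y"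
  shows "qcong N (bimould_at (bm_L m) [to_q x] [to_q y])
    (\<Sum>d=1..N. to_q (mexp (of_nat d * x + of_nat m * y)) * mconst (fps_X ^ (m * d)))"
proof -
  define \<sigma> where "\<sigma> v = (case v of Xvar i \<Rightarrow> x | Yvar i \<Rightarrow> y)" for v
  define F where "F d = mexp (of_nat d * sX 1 + of_nat m * sY 1)" for d
  have \<sigma>: "noconst (\<sigma> v)" for v
    unfolding \<sigma>_def by (cases v) (simp_all add: x y)
  have \<sigma>': "noconst (to_q (\<sigma> v))" for v by (simp add: \<sigma>)
  have \<sigma>1: "\<sigma> (Xvar 1) = x" "\<sigma> (Yvar 1) = y" by (simp_all add: \<sigma>_def)
  have F: "finite (mvars (F d))" for d
    unfolding F_def by (intro finite_mvars_mexp adm_finite adm_intros) auto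
  have F': "finite (mvars (to_q (F d) * mconst c))" for d c
    by (rule finite_mvars_mult) (simp_all add: F)
  have mvL: "mvars (bm_L m 1) \<subseteq> XY 1" using m by (rule mvars_bm_L)
  have "bimould_at (bm_L m) [to_q x] [to_q y] =
      bimould_at (bm_L m) (map (\<lambda>_. to_q x) [1..<1 + 1]) (map (\<lambda>_. to_q y) [1..<1 + 1])"
    by simp
  also have "\<dots> = msubst (\<lambda>v. to_q (\<sigma> v)) (bm_L m 1)"
    by (subst bimould_at_map[of "bm_L m", OF mvL]) (auto intro!: msubst_cong simp: \<sigma>_def split: var.split)
  also have "qcong N \<dots> (msubst (\<lambda>v. to_q (\<sigma> v)) (\<Sum>d=1..N. to_q (F d) * mconst (fps_X ^ (m * d))))"
    unfolding F_def
    by (rule qcong_msubst[OF qcong_bm_L[OF m] \<sigma>' finite_subset[OF mvL finite_XY]])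
       (intro finite_mvars_sum F'[unfolded F_def])
  also have "\<dots> = (\<Sum>d=1..N. to_q (msubst \<sigma> (F d)) * mconst (fps_X ^ (m * d)))"
    by (subst msubst_sum[OF \<sigma>' F']) (intro sum.cong refl msubst_to_q_mult \<sigma> F)
  also have "\<dots> = (\<Sum>d=1..N. to_q (mexp (of_nat d * x + of_nat m * y)) * mconst (fps_X ^ (m * d)))"
  proof -
    have "msubst \<sigma> (F d) = mexp (of_nat d * x + of_nat m * y)" for d
    proof -
      have "msubst \<sigma> (F d) = mexp (msubst \<sigma> (of_nat d * sX 1 + of_nat m * sY 1))"
        unfolding F_def by (rule msubst_mexp[OF \<sigma>]; intro adm_finite adm_noconst adm_intros; simp)
      also have "msubst \<sigma> (of_nat d * sX 1 + of_nat m * sY 1) = of_nat d * \<sigma> (Xvar 1) + of_nat m * \<sigma> (Yvar 1)"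
        by (simp add: msubst_add[OF \<sigma>] msubst_mult[OF \<sigma>] msubst_of_nat[OF \<sigma>]
            msubst_mvar[where \<sigma> = \<sigma>, OF \<sigma>] finite_mvars_mult del: One_nat_def)
      finally show ?thesis unfolding \<sigma>1 .
    qed
    then show ?thesis by simp
  qed
  finally show ?thesis .
qed

text \<open>One summand of \<open>bm_LL\<close> in depth n: \<open>s\<close> is the position of the
  \<open>bm_L\<close> factor, \<open>d\<close> the index in its geometric series. The power of q is
  kept apart so that the rest has rational coefficients.\<close>

definition LLterm :: "(nat list \<Rightarrow> rat) \<Rightarrow> nat \<Rightarrow> nat \<Rightarrow> nat \<Rightarrow> nat \<Rightarrow> (var, rat) mfps" where
  "LLterm \<beta> m n s d = b_ev \<beta> (s - 1) (\<lambda>k. sX k - sX s) sY *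
     bt_ev \<beta> (n - s) (\<lambda>k. sX (n + 1 - k) - sX s) (\<lambda>k. sY (n + 1 - k)) *
     mexp (of_nat d * sX s + of_nat m * Ysum n)"

lemma qcong_bm_LL:
  assumes m: "m \<ge> 1"
  shows "qcong N (bm_LL \<beta> m n)
    (\<Sum>s=1..n. \<Sum>d=1..N. to_q (LLterm \<beta> m n s d) * mconst (fps_X ^ (m * d)))"
proof -
  let ?b = "\<lambda>s. b_ev \<beta> (s - 1) (\<lambda>k. sX k - sX s) sY"
  let ?t = "\<lambda>s. bt_ev \<beta> (n - s) (\<lambda>k. sX (n + 1 - k) - sX s) (\<lambda>k. sY (n + 1 - k))"
  have "bm_LL \<beta> m n = (\<Sum>s=1..n. to_q (?b s) * bimould_at (bm_L m) [to_q (sX s)] [to_q (Ysum n)] * to_q (?t s))"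
    unfolding bm_LL_def
  proof (rule sum.cong[OF refl])
    fix s assume "s \<in> {1..n}"
    then have s: "[1..<s] = [1..<s - 1 + 1]" by simp
    show "to_q (bimould_at (bm_b \<beta>) (map (\<lambda>k. sX k - sX s) [1..<s]) (map sY [1..<s])) *
        bimould_at (bm_L m) [sX s] [\<Sum>l=1..n. sY l] *
        to_q (bimould_at (bm_bt \<beta>) (map (\<lambda>k. sX k - sX s) (rev [s + 1..<n + 1])) (map sY (rev [s + 1..<n + 1]))) =
        to_q (?b s) * bimould_at (bm_L m) [to_q (sX s)] [to_q (Ysum n)] * to_q (?t s)"
      unfolding s b_ev_def bt_ev_def map_rev_upt to_q_simps(6) to_q_Ysum
      unfolding Ysum_def ..
  qed
  also have "qcong N \<dots> (\<Sum>s=1..n. to_q (?b s) *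
      (\<Sum>d=1..N. to_q (mexp (of_nat d * sX s + of_nat m * Ysum n)) * mconst (fps_X ^ (m * d))) * to_q (?t s))"
    by (rule qcong_sum, rule qcong_mult[OF qcong_mult[OF qcong_refl
        qcong_bm_L_at[OF m adm_mvar adm_Ysum]] qcong_refl])
  also have "\<dots> = (\<Sum>s=1..n. \<Sum>d=1..N. to_q (LLterm \<beta> m n s d) * mconst (fps_X ^ (m * d)))"
  proof -
    have "b * (\<Sum>d\<in>A. e d * q d) * t = (\<Sum>d\<in>A. b * t * e d * q d)"
      for b t :: "(var, rat fps) mfps" and A :: "nat set" and e q
      by (simp add: sum_distrib_left sum_distrib_right mult_ac)
    then show ?thesis unfolding LLterm_def to_q_mult by simp
  qed
  finally show ?thesis .
qed

lemma mvars_LLterm: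
  assumes "s \<in> {1..n}" shows "mvars (LLterm \<beta> m n s d) \<subseteq> XY n"
proof -
  have X: "Xvar k \<in> XY n" and Y: "Yvar k \<in> XY n" if "1 \<le> k" "k \<le> n" for k
    using that by (auto simp: XY_def)
  have D: "mvars (sX k - sX s :: (var, rat) mfps) \<subseteq> XY n" if "1 \<le> k" "k \<le> n" for k
    using X[OF that] X[of s] assms by (intro order_trans[OF mvars_minus]) simp
  have S: "mvars (Ysum n :: (var, rat) mfps) \<subseteq> XY n"
    unfolding Ysum_def by (rule mvars_sum) (simp add: Y)
  show ?thesis
    unfolding LLterm_def using assms X[of s]
    by (intro mvars_mult[THEN order_trans] Un_least mvars_b_ev mvars_bt_ev
        mvars_mexp[THEN order_trans] mvars_add[THEN order_trans]) (auto simp: Y intro: S[THEN subsetD] D[THEN subsetD, rotated 2])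
qed

lemma finite_mvars_LLterm: "finite (mvars (LLterm \<beta> m n s d))"
  unfolding LLterm_def
  by (intro finite_mvars_mult finite_mvars_b_ev finite_mvars_bt_ev finite_mvars_mexp adm_finite adm_intros)
    auto

lemma mvars_bm_LL:
  assumes "m \<ge> 1" shows "mvars (bm_LL \<beta> m n) \<subseteq> XY n"
proof (rule mvars_qcong)
  fix N
  have "mvars (\<Sum>s=1..n. \<Sum>d=1..N. to_q (LLterm \<beta> m n s d) * mconst (fps_X ^ (m * d))) \<subseteq> XY n"
    by (intro mvars_le) (simp_all add: mvars_LLterm del: One_nat_def)
  then show "\<exists>g. qcong N (bm_LL \<beta> m n) g \<and> mvars g \<subseteq> XY n"
    using qcong_bm_LL[OF assms] by blast
qed

definition blockterm :: "(nat list \<Rightarrow> rat) \<Rightarrow> nat \<Rightarrow> nat \<Rightarrow> nat \<Rightarrow> nat \<Rightarrow> nat \<Rightarrow> nat \<Rightarrow> (var, rat) mfps" where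
  "blockterm \<beta> r a c m s d = gapL \<beta> r a s * gapR \<beta> r s c *
     mexp (of_nat d * Xext r s + of_nat m * (Ysum c - Ysum a))"

text \<open>The local expansion is moved by the substitution k to a + k. All positions stay at most
  r, so \<open>sX\<close> may be replaced by \<open>Xext\<close> and the factors become gaps of the
  global variables.\<close>

lemma qcong_block:
  assumes m: "m \<ge> 1" and ac: "a < c" "c \<le> r"
  shows "qcong N (bimould_at (bm_LL \<beta> m) (map sX [a + 1..<c + 1]) (map sY [a + 1..<c + 1]))
    (\<Sum>s=a + 1..c. \<Sum>d=1..N. to_q (blockterm \<beta> r a c m s d) * mconst (fps_X ^ (m * d)))"
proof -
  define n where "n = c - a"
  define \<sigma> :: "var \<Rightarrow> (var, rat) mfps" where
    "\<sigma> v = (case v of Xvar i \<Rightarrow> sX (a + i) | Yvar i \<Rightarrow> sY (a + i))" for v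
  have \<sigma>: "noconst (\<sigma> v)" for v
    unfolding \<sigma>_def by (cases v) simp_all
  have \<sigma>': "noconst (to_q (\<sigma> v))" for v by (simp add: \<sigma>)
  have \<sigma>X: "msubst \<sigma> (sX k) = sX (a + k)" and \<sigma>Y: "msubst \<sigma> (sY k) = sY (a + k)" for k
    by (subst msubst_mvar[where \<sigma> = \<sigma>, OF \<sigma>], simp add: \<sigma>_def)+
  have \<sigma>S: "msubst \<sigma> (Ysum n) = Ysum c - Ysum a"
  proof -
    have "msubst \<sigma> (Ysum n) = Ysum (a + n) - Ysum a"
      unfolding Ysum_diff_shift by (simp add: Ysum_def msubst_sum[OF \<sigma>] \<sigma>Y)
    then show ?thesis using ac by (simp add: n_def)
  qed
  have fin: "finite (mvars (to_q (LLterm \<beta> m n s d) * mconst e))" for s d e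
    by (rule finite_mvars_mult) (simp_all add: finite_mvars_LLterm)
  have mvLL: "mvars (bm_LL \<beta> m n) \<subseteq> XY n" using m by (rule mvars_bm_LL)
  have "bimould_at (bm_LL \<beta> m) (map sX [a + 1..<c + 1]) (map sY [a + 1..<c + 1]) =
      msubst (\<lambda>v. to_q (\<sigma> v)) (bm_LL \<beta> m n)"
    unfolding map_upt_shift n_def[symmetric] bimould_at_map[of "bm_LL \<beta> m", OF mvLL]
    by (auto intro!: msubst_cong simp: \<sigma>_def split: var.split)
  also have "qcong N \<dots> (msubst (\<lambda>v. to_q (\<sigma> v))
      (\<Sum>s=1..n. \<Sum>d=1..N. to_q (LLterm \<beta> m n s d) * mconst (fps_X ^ (m * d))))"
    by (rule qcong_msubst[OF qcong_bm_LL[OF m] \<sigma>' finite_subset[OF mvLL finite_XY]])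
       (intro finite_mvars_sum fin)
  also have "\<dots> = (\<Sum>s=1..n. \<Sum>d=1..N. to_q (msubst \<sigma> (LLterm \<beta> m n s d)) * mconst (fps_X ^ (m * d)))"
    by (subst msubst_sum[OF \<sigma>' finite_mvars_sum[OF fin]], subst msubst_sum[OF \<sigma>' fin])
      (intro sum.cong refl msubst_to_q_mult \<sigma> finite_mvars_LLterm)
  also have "\<dots> = (\<Sum>s=1..n. \<Sum>d=1..N. to_q (blockterm \<beta> r a c m (a + s) d) * mconst (fps_X ^ (m * d)))"
  proof (intro sum.cong refl)
    fix s d assume s: "s \<in> {1..n}"
    note adms = adm_minus adm_mvar
    have "msubst \<sigma> (LLterm \<beta> m n s d) =
        msubst \<sigma> (b_ev \<beta> (s - 1) (\<lambda>k. sX k - sX s) sY) *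
        msubst \<sigma> (bt_ev \<beta> (n - s) (\<lambda>k. sX (n + 1 - k) - sX s) (\<lambda>k. sY (n + 1 - k))) *
        msubst \<sigma> (mexp (of_nat d * sX s + of_nat m * Ysum n))"
      unfolding LLterm_def
      by (subst msubst_mult[OF \<sigma>] |
          intro finite_mvars_mult finite_mvars_b_ev finite_mvars_bt_ev finite_mvars_mexp adm_finite adm_intros adm_mvar adm_Ysum refl)+
    also have "msubst \<sigma> (b_ev \<beta> (s - 1) (\<lambda>k. sX k - sX s) sY) =
        b_ev \<beta> (s - 1) (\<lambda>k. sX (a + k) - sX (a + s)) (\<lambda>k. sY (a + k))"
      by (subst msubst_b_ev[OF _ _ \<sigma>]) (simp_all add: adms msubst_minus[OF \<sigma>] \<sigma>X \<sigma>Y)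
    also have "\<dots> = gapL \<beta> r a (a + s)"
      unfolding gapL_def using s ac by (auto intro!: b_ev_cong simp: Xext_def n_def)
    also have "msubst \<sigma> (bt_ev \<beta> (n - s) (\<lambda>k. sX (n + 1 - k) - sX s) (\<lambda>k. sY (n + 1 - k))) =
        bt_ev \<beta> (n - s) (\<lambda>k. sX (a + (n + 1 - k)) - sX (a + s)) (\<lambda>k. sY (a + (n + 1 - k)))"
      by (subst msubst_bt_ev[OF _ _ \<sigma>]) (simp_all add: adms msubst_minus[OF \<sigma>] \<sigma>X \<sigma>Y)
    also have "\<dots> = gapR \<beta> r (a + s) c"
    proof -
      have "c - (a + s) = n - s" by (simp add: n_def)
      moreover have "a + (n + 1 - k) = c + 1 - k" "c + 1 - k \<le> r" if "1 \<le> k" "k \<le> n - s" for k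
        using that s ac by (auto simp: n_def)
      moreover have "a + s \<le> r" using s ac by (auto simp: n_def)
      ultimately show ?thesis
        unfolding gapR_def by (auto intro!: bt_ev_cong simp: Xext_def)
    qed
    also have "msubst \<sigma> (mexp (of_nat d * sX s + of_nat m * Ysum n)) =
        mexp (of_nat d * sX (a + s) + of_nat m * (Ysum c - Ysum a))"
      by (subst msubst_mexp[OF \<sigma>])
        (auto intro!: finite_mvars_intros noconst_intros
          simp: msubst_add[OF \<sigma>] msubst_mult[OF \<sigma>] msubst_of_nat[OF \<sigma>] \<sigma>X \<sigma>S finite_mvars_mult)
    also have "sX (a + s) = Xext r (a + s)" using s ac by (auto simp: Xext_def n_def)
    finally show "to_q (msubst \<sigma> (LLterm \<beta> m n s d)) * mconst (fps_X ^ (m * d)) =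
        to_q (blockterm \<beta> r a c m (a + s) d) * mconst (fps_X ^ (m * d))"
      unfolding blockterm_def by simp
  qed
  also have "\<dots> = (\<Sum>s=a + 1..c. \<Sum>d=1..N. to_q (blockterm \<beta> r a c m s d) * mconst (fps_X ^ (m * d)))"
    by (rule sum.reindex_bij_witness[where i = "\<lambda>s. s - a" and j = "\<lambda>s. a + s"]) (auto simp: n_def)
  finally show ?thesis .
qed

section \<open>The bimoulds G as sums over partition data\<close>

definition rs_lists :: "nat \<Rightarrow> nat \<Rightarrow> nat list set" where
  "rs_lists r j = {rs. length rs = j + 1 \<and> rs ! 0 = 0 \<and> sorted_wrt (<) rs \<and> rs ! j \<le> r}"

definition ms_lists :: "nat \<Rightarrow> nat list set" where
  "ms_lists j = {ms. length ms = j \<and> sorted_wrt (>) ms \<and> (\<forall>m\<in>set ms. m > 0)}"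

definition S_of :: "nat \<Rightarrow> nat \<Rightarrow> (nat \<Rightarrow> nat \<times> nat) \<Rightarrow> nat \<Rightarrow> nat" where
  "S_of r j g i = (if i = j + 1 then r + 1 else fst (g i))"

definition M_of :: "nat \<Rightarrow> nat list \<Rightarrow> nat \<Rightarrow> nat" where
  "M_of j ms i = (if i = j + 1 then 0 else ms ! (i - 1))"

definition D_of :: "(nat \<Rightarrow> nat \<times> nat) \<Rightarrow> nat \<Rightarrow> nat" where
  "D_of g i = snd (g i)"

definition weight :: "nat \<Rightarrow> nat list \<Rightarrow> (nat \<Rightarrow> nat \<times> nat) \<Rightarrow> nat" where
  "weight j ms g = (\<Sum>i=1..j. M_of j ms i * D_of g i)"

definition lterm :: "(nat list \<Rightarrow> rat) \<Rightarrow> nat \<Rightarrow> nat \<Rightarrow> nat list \<Rightarrow> nat list \<Rightarrow> (nat \<Rightarrow> nat \<times> nat) \<Rightarrow>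
    (var, rat fps) mfps" where
  "lterm \<beta> r j rs ms g = gterm \<beta> r j ((!) rs) (S_of r j g) (M_of j ms) (D_of g)"

text \<open>g i = (s_i, d_i). Extensional functions make each choice a single index, as the
  expansion of a product of sums requires; \<open>B\<close> is \<open>{1..N}\<close> while
  truncating and \<open>{1..}\<close> for the full index set.\<close>

definition choices :: "nat \<Rightarrow> nat list \<Rightarrow> nat set \<Rightarrow> (nat \<Rightarrow> nat \<times> nat) set" where
  "choices j rs B = PiE {1..j} (\<lambda>i. {rs ! (i - 1) + 1..rs ! i} \<times> B)"

lemma rs_lists_step:
  assumes "rs \<in> rs_lists r j" "i \<in> {1..j}"
  shows "rs ! (i - 1) < rs ! i" "rs ! i \<le> r"
proof -
  have s: "sorted_wrt (<) rs" "length rs = j + 1" "rs ! j \<le> r" using assms by (auto simp: rs_lists_def)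
  show "rs ! (i - 1) < rs ! i"
    using s assms(2) by (intro sorted_wrt_nth_less[of "(<)"]) auto
  show "rs ! i \<le> r"
  proof (cases "i = j")
    case False
    then have "rs ! i < rs ! j" using s assms(2) by (intro sorted_wrt_nth_less[of "(<)"]) auto
    then show ?thesis using s(3) by simp
  qed (use s in simp)
qed

lemma finite_rs_lists: "finite (rs_lists r j)"
proof (rule finite_subset)
  show "rs_lists r j \<subseteq> {rs. set rs \<subseteq> {..r} \<and> length rs = j + 1}"
  proof
    fix rs assume rs: "rs \<in> rs_lists r j"
    have "rs ! i \<le> r" if "i < j + 1" for i
      using rs_lists_step(2)[OF rs, of i] rs that by (cases i) (auto simp: rs_lists_def)
    then show "rs \<in> {rs. set rs \<subseteq> {..r} \<and> length rs = j + 1}"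
      using rs by (auto simp: rs_lists_def in_set_conv_nth)
  qed
qed (rule finite_lists_length_eq, simp)

lemma gterm_cong:
  assumes "\<And>i. i \<le> j \<Longrightarrow> R i = R' i" "\<And>i. 1 \<le> i \<Longrightarrow> i \<le> j + 1 \<Longrightarrow> S i = S' i"
    "\<And>i. 1 \<le> i \<Longrightarrow> i \<le> j + 1 \<Longrightarrow> M i = M' i" "\<And>i. 1 \<le> i \<Longrightarrow> i \<le> j \<Longrightarrow> D i = D' i"
  shows "gterm \<beta> r j R S M D = gterm \<beta> r j R' S' M' D'"
proof -
  have "(\<Prod>i=1..j + 1. gapL \<beta> r (R (i - 1)) (S i)) = (\<Prod>i=1..j + 1. gapL \<beta> r (R' (i - 1)) (S' i))"
  proof (rule prod.cong[OF refl])
    fix i assume "i \<in> {1..j + 1}"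
    then have "i - 1 \<le> j" "1 \<le> i" "i \<le> j + 1" by auto
    then show "gapL \<beta> r (R (i - 1)) (S i) = gapL \<beta> r (R' (i - 1)) (S' i)"
      by (simp only: assms(1,2))
  qed
  moreover have "(\<Prod>i=1..j. gapR \<beta> r (S i) (R i)) = (\<Prod>i=1..j. gapR \<beta> r (S' i) (R' i))"
    by (rule prod.cong[OF refl]) (use assms(1,2) in simp)
  moreover have "expo r j R S M D = expo r j R' S' M' D'"
    unfolding expo_def
  proof (rule sum.cong[OF refl])
    fix i assume "i \<in> {1..j}"
    then have "i - 1 \<le> j" "1 \<le> i" "i \<le> j" "i \<le> j + 1" by auto
    then show "of_nat (D i) * Xext r (S i) + of_nat (M i) * (Ysum (R i) - Ysum (R (i - 1))) =
        of_nat (D' i) * Xext r (S' i) + of_nat (M' i) * (Ysum (R' i) - Ysum (R' (i - 1)))"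
      by (simp only: assms)
  qed
  moreover have "(\<Sum>i=1..j. M i * D i) = (\<Sum>i=1..j. M' i * D' i)"
    by (rule sum.cong[OF refl]) (use assms in simp)
  ultimately show ?thesis unfolding gterm_def by simp
qed

lemma b_tail:
  assumes "a \<le> r"
  shows "bimould_at (bm_b \<beta>) (map sX [a + 1..<r + 1]) (map sY [a + 1..<r + 1]) = gapL \<beta> r a (r + 1)"
  unfolding map_upt_shift b_ev_def[symmetric] gapL_def using assms
  by (simp, intro b_ev_cong) (auto simp: Xext_def)

text \<open>The exponentials of the blocks combine into one, and the tail of the summand is the left
  gap number j + 1, ending at the sentinel.\<close>

lemma lterm_eq:
  assumes rs: "rs \<in> rs_lists r j"
  shows "(\<Prod>i=1..j. to_q (blockterm \<beta> r (rs ! (i - 1)) (rs ! i) (ms ! (i - 1)) (fst (g i)) (snd (g i))) *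
      mconst (fps_X ^ (ms ! (i - 1) * snd (g i)))) * to_q (gapL \<beta> r (rs ! j) (r + 1)) = lterm \<beta> r j rs ms g"
    (is "(\<Prod>i=1..j. to_q (?B i) * mconst (fps_X ^ ?w i)) * to_q ?T = _")
proof -
  let ?L = "\<lambda>i. gapL \<beta> r (rs ! (i - 1)) (S_of r j g i)"
  let ?R = "\<lambda>i. gapR \<beta> r (S_of r j g i) (rs ! i)"
  let ?e = "\<lambda>i. of_nat (D_of g i) * Xext r (S_of r j g i) +
    of_nat (M_of j ms i) * (Ysum (rs ! i) - Ysum (rs ! (i - 1))) :: (var, rat) mfps"
  have B: "?B i = ?L i * ?R i * mexp (?e i)" and w: "?w i = M_of j ms i * D_of g i" if "i \<in> {1..j}" for i
    using that by (auto simp: blockterm_def S_of_def M_of_def D_of_def)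
  have adm: "noconst (?e i)" for i
    by (rule adm_noconst) (intro adm_intros adm_Xext adm_Ysum)
  have last: "?L (j + 1) = ?T"
    by (simp add: S_of_def)
  have "(\<Prod>i=1..j. to_q (?B i) * mconst (fps_X ^ ?w i)) =
      (\<Prod>i=1..j. to_q (?L i * ?R i * mexp (?e i)) * mconst (fps_X ^ (M_of j ms i * D_of g i)))"
    by (rule prod.cong[OF refl]) (simp only: B w)
  also have "\<dots> = to_q ((\<Prod>i=1..j. ?L i) * (\<Prod>i=1..j. ?R i) * mexp (expo r j ((!) rs) (S_of r j g) (M_of j ms) (D_of g)))
      * mconst (fps_X ^ (\<Sum>i=1..j. M_of j ms i * D_of g i))"
    unfolding expo_def mexp_sum[OF adm] power_sum mconst_prod to_q_mult to_q_prod prod.distrib ..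
  finally have "(\<Prod>i=1..j. to_q (?B i) * mconst (fps_X ^ ?w i)) * to_q ?T =
      to_q ((\<Prod>i=1..j. ?L i) * (\<Prod>i=1..j. ?R i) * mexp (expo r j ((!) rs) (S_of r j g) (M_of j ms) (D_of g)))
      * mconst (fps_X ^ (\<Sum>i=1..j. M_of j ms i * D_of g i)) * to_q ?T"
    by (rule arg_cong)
  also have "\<dots> = lterm \<beta> r j rs ms g"
  proof -
    have "(\<Prod>i=1..j + 1. ?L i) = (\<Prod>i=1..j. ?L i) * ?T"
      unfolding last[symmetric] by simp
    then show ?thesis unfolding lterm_def gterm_def by (simp only: to_q_mult mult_ac)
  qed
  finally show ?thesis .
qed

definition Gsummand :: "(nat list \<Rightarrow> rat) \<Rightarrow> nat \<Rightarrow> nat \<Rightarrow> nat list \<Rightarrow> nat list \<Rightarrow> (var, rat fps) mfps" where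
  "Gsummand \<beta> r j rs ms = (\<Prod>i=1..j. bimould_at (bm_LL \<beta> (ms ! (i - 1)))
       (map sX [rs ! (i - 1) + 1..<rs ! i + 1]) (map sY [rs ! (i - 1) + 1..<rs ! i + 1]))
     * to_q (bimould_at (bm_b \<beta>) (map sX [rs ! j + 1..<r + 1]) (map sY [rs ! j + 1..<r + 1]))"

lemma bm_G_eq:
  assumes "1 \<le> j" "j \<le> r"
  shows "bm_G \<beta> j r = (\<Sum>rs\<in>rs_lists r j. msum_q (Gsummand \<beta> r j rs) (ms_lists j))"
  using assms unfolding bm_G_def rs_lists_def ms_lists_def Gsummand_def by simp

lemma qcong_Gsummand:
  assumes rs: "rs \<in> rs_lists r j" and ms: "ms \<in> ms_lists j"
  shows "qcong N (Gsummand \<beta> r j rs ms) (\<Sum>g\<in>choices j rs {1..N}. lterm \<beta> r j rs ms g)"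
proof -
  define U where "U i p = to_q (blockterm \<beta> r (rs ! (i - 1)) (rs ! i) (ms ! (i - 1)) (fst p) (snd p)) *
      mconst (fps_X ^ (ms ! (i - 1) * snd p))" for i p
  define A where "A i = {rs ! (i - 1) + 1..rs ! i} \<times> {1..N}" for i
  let ?T = "to_q (gapL \<beta> r (rs ! j) (r + 1))"
  have T: "to_q (bimould_at (bm_b \<beta>) (map sX [rs ! j + 1..<r + 1]) (map sY [rs ! j + 1..<r + 1])) = ?T"
    using rs by (subst b_tail) (auto simp: rs_lists_def)
  have "qcong N (Gsummand \<beta> r j rs ms) ((\<Prod>i=1..j. \<Sum>p\<in>A i. U i p) * ?T)"
    unfolding Gsummand_def T
  proof (rule qcong_mult[OF qcong_prod qcong_refl])
    fix i assume i: "i \<in> {1..j}"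
    have m: "1 \<le> ms ! (i - 1)"
    proof -
      have "ms ! (i - 1) \<in> set ms" using ms i by (intro nth_mem) (auto simp: ms_lists_def)
      then show ?thesis using ms by (auto simp: ms_lists_def Suc_le_eq)
    qed
    have "(\<Sum>p\<in>A i. U i p) = (\<Sum>s=rs ! (i - 1) + 1..rs ! i. \<Sum>d=1..N.
        to_q (blockterm \<beta> r (rs ! (i - 1)) (rs ! i) (ms ! (i - 1)) s d) * mconst (fps_X ^ (ms ! (i - 1) * d)))"
      unfolding A_def U_def sum.cartesian_product by (simp add: split_beta)
    then show "qcong N (bimould_at (bm_LL \<beta> (ms ! (i - 1))) (map sX [rs ! (i - 1) + 1..<rs ! i + 1])
        (map sY [rs ! (i - 1) + 1..<rs ! i + 1])) (\<Sum>p\<in>A i. U i p)"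
      by (simp only: qcong_block[OF m rs_lists_step[OF rs i]])
  qed
  also have "(\<Prod>i=1..j. \<Sum>p\<in>A i. U i p) = (\<Sum>g\<in>PiE {1..j} A. \<Prod>i=1..j. U i (g i))"
    by (rule prod_sum_PiE) (auto simp: A_def)
  also have "(\<Sum>g\<in>PiE {1..j} A. \<Prod>i=1..j. U i (g i)) * ?T = (\<Sum>g\<in>PiE {1..j} A. lterm \<beta> r j rs ms g)"
    unfolding sum_distrib_right by (intro sum.cong refl) (unfold U_def, rule lterm_eq[OF rs])
  finally show ?thesis unfolding choices_def A_def .
qed

lemma qcong_lterm: "N < weight j ms g \<Longrightarrow> qcong N (lterm \<beta> r j rs ms g) 0"
  unfolding lterm_def gterm_def weight_def by (rule qcong_fps_X_power)

lemma ms_lists_pos: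
  assumes "ms \<in> ms_lists j" "i \<in> {1..j}" shows "0 < M_of j ms i"
proof -
  have "ms ! (i - 1) \<in> set ms" using assms by (intro nth_mem) (auto simp: ms_lists_def)
  then show ?thesis using assms by (auto simp: ms_lists_def M_of_def)
qed

text \<open>Every product m_i d_i has positive factors, so a bound on the weight bounds all parts
  and multiplicities.\<close>

lemma weight_ge:
  assumes "ms \<in> ms_lists j" "g \<in> choices j rs {1..}" "i \<in> {1..j}"
  shows "M_of j ms i \<le> weight j ms g" "D_of g i \<le> weight j ms g"
proof -
  have "M_of j ms i * D_of g i \<le> weight j ms g"
    unfolding weight_def using assms(3) by (intro member_le_sum) auto
  moreover have "0 < D_of g i"
  proof -
    have "g i \<in> {rs ! (i - 1) + 1..rs ! i} \<times> {1..}"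
      using assms(2,3) unfolding choices_def by (rule PiE_mem)
    then show ?thesis by (auto simp: D_of_def mem_Times_iff)
  qed
  moreover note ms_lists_pos[OF assms(1,3)]
  ultimately show "M_of j ms i \<le> weight j ms g" "D_of g i \<le> weight j ms g"
    by (auto elim!: order_trans[rotated])
qed

lemma choices_mono: "A \<subseteq> B \<Longrightarrow> choices j rs A \<subseteq> choices j rs B"
  unfolding choices_def by (intro PiE_mono) auto

text \<open>A part above N forces weight above N in every term. This is the summability needed for
  the infinite sum over \<open>ms\<close>.\<close>

lemma qcong_Gsummand_0:
  assumes rs: "rs \<in> rs_lists r j" and ms: "ms \<in> ms_lists j" and "\<not> set ms \<subseteq> {1..N}"
  shows "qcong N (Gsummand \<beta> r j rs ms) 0"
proof -
  obtain m where m: "m \<in> set ms" "m \<notin> {1..N}" using assms(3) by blast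
  then obtain k where k: "k < j" "ms ! k = m"
    using ms by (auto simp: in_set_conv_nth ms_lists_def)
  have "N < m" using m ms by (auto simp: ms_lists_def)
  then have M: "N < M_of j ms (k + 1)" using k by (simp add: M_of_def)
  have "qcong N (Gsummand \<beta> r j rs ms) (\<Sum>g\<in>choices j rs {1..N}. lterm \<beta> r j rs ms g)"
    using rs ms by (rule qcong_Gsummand)
  also have "qcong N \<dots> (\<Sum>g\<in>choices j rs {1..N}. 0)"
  proof (rule qcong_sum)
    fix g assume "g \<in> choices j rs {1..N}"
    then have "g \<in> choices j rs {1..}" using choices_mono[of "{1..N}" "{1..}"] by auto
    then have "M_of j ms (k + 1) \<le> weight j ms g" using k by (intro weight_ge[OF ms]) auto
    then show "qcong N (lterm \<beta> r j rs ms g) 0" using M by (intro qcong_lterm) simp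
  qed
  finally show ?thesis by simp
qed

definition Gindex :: "nat \<Rightarrow> nat \<Rightarrow> nat \<Rightarrow> (nat list \<times> nat list \<times> (nat \<Rightarrow> nat \<times> nat)) set" where
  "Gindex N r j = {(rs, ms, g). rs \<in> rs_lists r j \<and> ms \<in> ms_lists j \<and> g \<in> choices j rs {1..} \<and>
     weight j ms g \<le> N}"

lemma qcong_bm_G:
  assumes j: "1 \<le> j" "j \<le> r"
  shows "qcong N (bm_G \<beta> j r) (\<Sum>(rs, ms, g)\<in>Gindex N r j. lterm \<beta> r j rs ms g)"
proof -
  define MS where "MS n = {ms \<in> ms_lists j. set ms \<subseteq> {1..n}}" for n
  define Box where "Box = (SIGMA rs:rs_lists r j. MS N \<times> choices j rs {1..N})"
  have fin: "finite (MS n)" for n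
    by (rule finite_subset[OF _ finite_lists_length_eq[of "{1..n}" j]]) (auto simp: MS_def ms_lists_def)
  have finc: "finite (choices j rs {1..N})" for rs
    unfolding choices_def by (intro finite_PiE) auto
  have "qcong N (bm_G \<beta> j r) (\<Sum>rs\<in>rs_lists r j. \<Sum>ms\<in>MS N. \<Sum>g\<in>choices j rs {1..N}. lterm \<beta> r j rs ms g)"
    unfolding bm_G_eq[OF j]
  proof (rule qcong_sum)
    fix rs assume rs: "rs \<in> rs_lists r j"
    have zero: "qcong n (Gsummand \<beta> r j rs ms) 0" if "ms \<in> ms_lists j - MS n" for ms n
      using that by (intro qcong_Gsummand_0[OF rs]) (auto simp: MS_def)
    have "qcong N (msum_q (Gsummand \<beta> r j rs) (ms_lists j)) (\<Sum>ms\<in>MS N. Gsummand \<beta> r j rs ms)"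
    proof (rule qcong_msum_q)
      show "\<exists>J. finite J \<and> J \<subseteq> ms_lists j \<and> (\<forall>i\<in>ms_lists j - J. qcong n (Gsummand \<beta> r j rs i) 0)" for n
        using fin zero by (intro exI[of _ "MS n"]) (auto simp: MS_def)
    qed (use fin zero in \<open>auto simp: MS_def\<close>)
    also have "qcong N \<dots> (\<Sum>ms\<in>MS N. \<Sum>g\<in>choices j rs {1..N}. lterm \<beta> r j rs ms g)"
      by (intro qcong_sum qcong_Gsummand rs) (auto simp: MS_def)
    finally show "qcong N (msum_q (Gsummand \<beta> r j rs) (ms_lists j))
        (\<Sum>ms\<in>MS N. \<Sum>g\<in>choices j rs {1..N}. lterm \<beta> r j rs ms g)" .
  qed
  also have "(\<Sum>rs\<in>rs_lists r j. \<Sum>ms\<in>MS N. \<Sum>g\<in>choices j rs {1..N}. lterm \<beta> r j rs ms g) =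
      (\<Sum>(rs, ms, g)\<in>Box. lterm \<beta> r j rs ms g)"
    unfolding Box_def using fin finc finite_rs_lists[of r j]
    by (simp add: sum.Sigma sum.cartesian_product)
  \<comment> \<open>\<open>weight_ge\<close> places \<open>Gindex\<close> inside the box, and the
    remaining box terms have weight above N, hence vanish modulo q^(N+1).\<close>
  also have "\<dots> = (\<Sum>(rs, ms, g)\<in>Box - Gindex N r j. lterm \<beta> r j rs ms g) +
      (\<Sum>(rs, ms, g)\<in>Gindex N r j. lterm \<beta> r j rs ms g)"
  proof (rule sum.subset_diff)
    show "finite Box" unfolding Box_def using fin finc finite_rs_lists[of r j] by auto
    show "Gindex N r j \<subseteq> Box"
    proof
      fix x assume "x \<in> Gindex N r j"
      then obtain rs ms g where x: "x = (rs, ms, g)" "rs \<in> rs_lists r j" "ms \<in> ms_lists j"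
        "g \<in> choices j rs {1..}" "weight j ms g \<le> N" by (auto simp: Gindex_def)
      have w: "M_of j ms i \<le> N" "D_of g i \<le> N" if "i \<in> {1..j}" for i
        using weight_ge[OF x(3,4) that] x(5) by auto
      have "set ms \<subseteq> {1..N}"
      proof
        fix m assume m: "m \<in> set ms"
        then obtain k where k: "k < j" "ms ! k = m" using x(3) by (auto simp: in_set_conv_nth ms_lists_def)
        then show "m \<in> {1..N}" using w(1)[of "k + 1"] m x(3) by (auto simp: M_of_def ms_lists_def Suc_le_eq)
      qed
      moreover have "g \<in> choices j rs {1..N}"
        unfolding choices_def
      proof (rule PiE_I)
        show "g i = undefined" if "i \<notin> {1..j}" for i
          using x(4) that unfolding choices_def by (rule PiE_arb)
        fix i assume i: "i \<in> {1..j}"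
        then have "g i \<in> {rs ! (i - 1) + 1..rs ! i} \<times> {1..}"
          using x(4) unfolding choices_def by (rule PiE_mem[rotated])
        then show "g i \<in> {rs ! (i - 1) + 1..rs ! i} \<times> {1..N}"
          using w(2)[OF i] by (auto simp: D_of_def mem_Times_iff)
      qed
      ultimately show "x \<in> Box" using x by (simp add: Box_def MS_def)
    qed
  qed
  also have "qcong N \<dots> ((\<Sum>x\<in>Box - Gindex N r j. 0) + (\<Sum>(rs, ms, g)\<in>Gindex N r j. lterm \<beta> r j rs ms g))"
  proof (rule qcong_add[OF qcong_sum qcong_refl])
    fix x assume x: "x \<in> Box - Gindex N r j"
    obtain rs ms g where xx: "x = (rs, ms, g)" by (cases x)
    then have "rs \<in> rs_lists r j" "ms \<in> ms_lists j" "g \<in> choices j rs {1..N}" "(rs, ms, g) \<notin> Gindex N r j"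
      using x by (auto simp: Box_def MS_def)
    moreover from this have "g \<in> choices j rs {1..}" using choices_mono[of "{1..N}" "{1..}"] by auto
    ultimately have "N < weight j ms g" by (auto simp: Gindex_def)
    then show "qcong N (case x of (rs, ms, g) \<Rightarrow> lterm \<beta> r j rs ms g) 0"
      unfolding xx prod.case by (rule qcong_lterm)
  qed
  finally show ?thesis by simp
qed

section \<open>Conjugation as an involution of the index set, and conclusion\<close>

section \<open>Reindexing by the conjugate data\<close>

text \<open>Conjugation acts on functions, whose irrelevant values are arbitrary. Lists and
  restricted functions give a canonical index, so that two conjugations return the same index and
  not merely an equivalent one.\<close>

definition encode :: "nat \<Rightarrow> (nat \<Rightarrow> nat) \<Rightarrow> (nat \<Rightarrow> nat) \<Rightarrow> (nat \<Rightarrow> nat) \<Rightarrow> (nat \<Rightarrow> nat) \<Rightarrow>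
    nat list \<times> nat list \<times> (nat \<Rightarrow> nat \<times> nat)" where
  "encode j R S M D = (map R [0..<j + 1], map M [1..<j + 1], restrict (\<lambda>i. (S i, D i)) {1..j})"

lemma encode_cong:
  assumes "\<And>i. i \<le> j \<Longrightarrow> R i = R' i" "\<And>i. 1 \<le> i \<Longrightarrow> i \<le> j \<Longrightarrow> S i = S' i"
    "\<And>i. 1 \<le> i \<Longrightarrow> i \<le> j \<Longrightarrow> M i = M' i" "\<And>i. 1 \<le> i \<Longrightarrow> i \<le> j \<Longrightarrow> D i = D' i"
  shows "encode j R S M D = encode j R' S' M' D'"
proof -
  have "map R [0..<j + 1] = map R' [0..<j + 1]" "map M [1..<j + 1] = map M' [1..<j + 1]"
    using assms by (auto simp del: upt_Suc)
  moreover have "restrict (\<lambda>i. (S i, D i)) {1..j} = restrict (\<lambda>i. (S' i, D' i)) {1..j}"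
    using assms by (intro restrict_ext) auto
  ultimately show ?thesis by (simp only: encode_def)
qed

lemma decode_encode:
  assumes "encode j R S M D = (rs, ms, g)" "S (j + 1) = r + 1" "M (j + 1) = 0"
  shows "i \<le> j \<Longrightarrow> rs ! i = R i" "1 \<le> i \<Longrightarrow> i \<le> j + 1 \<Longrightarrow> S_of r j g i = S i"
    "1 \<le> i \<Longrightarrow> i \<le> j + 1 \<Longrightarrow> M_of j ms i = M i" "1 \<le> i \<Longrightarrow> i \<le> j \<Longrightarrow> D_of g i = D i"
proof -
  have e: "rs = map R [0..<j + 1]" "ms = map M [1..<j + 1]" "g = restrict (\<lambda>i. (S i, D i)) {1..j}"
    using assms(1) by (auto simp only: encode_def prod.inject)
  show "i \<le> j \<Longrightarrow> rs ! i = R i" "1 \<le> i \<Longrightarrow> i \<le> j + 1 \<Longrightarrow> S_of r j g i = S i"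
    "1 \<le> i \<Longrightarrow> i \<le> j + 1 \<Longrightarrow> M_of j ms i = M i" "1 \<le> i \<Longrightarrow> i \<le> j \<Longrightarrow> D_of g i = D i"
    using assms(2,3) by (auto simp: e S_of_def M_of_def D_of_def simp del: upt_Suc)
qed

lemma encode_decode:
  assumes "rs \<in> rs_lists r j" "ms \<in> ms_lists j" "g \<in> choices j rs B"
  shows "encode j ((!) rs) (S_of r j g) (M_of j ms) (D_of g) = (rs, ms, g)"
proof -
  have "map ((!) rs) [0..<j + 1] = rs" using assms(1) map_nth[of rs] by (simp add: rs_lists_def del: upt_Suc)
  moreover have "map (M_of j ms) [1..<j + 1] = ms"
    using assms(2) by (intro nth_equalityI) (auto simp: ms_lists_def M_of_def simp del: upt_Suc)
  moreover have "restrict (\<lambda>i. (S_of r j g i, D_of g i)) {1..j} = g"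
    using assms(3) unfolding choices_def by (auto simp: S_of_def D_of_def restrict_def PiE_def extensional_def)
  ultimately show ?thesis by (simp only: encode_def)
qed

lemma pdata_Gindex:
  assumes "(rs, ms, g) \<in> Gindex N r j"
  shows "pdata r j ((!) rs) (S_of r j g) (M_of j ms) (D_of g)"
  unfolding pdata_def
proof (intro conjI ballI)
  have rs: "rs \<in> rs_lists r j" and ms: "ms \<in> ms_lists j" and g: "g \<in> choices j rs {1..}"
    using assms by (auto simp: Gindex_def)
  show "rs ! 0 = 0" "rs ! j \<le> r" using rs by (auto simp: rs_lists_def)
  show "S_of r j g (j + 1) = r + 1" "M_of j ms (j + 1) = 0" by (auto simp: S_of_def M_of_def)
  fix i assume i: "i \<in> {1..j}"
  then have gi: "g i \<in> {rs ! (i - 1) + 1..rs ! i} \<times> {1..}"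
    using g unfolding choices_def by (rule PiE_mem[rotated])
  then show "rs ! (i - 1) < S_of r j g i" "S_of r j g i \<le> rs ! i" "0 < D_of g i"
    using i by (auto simp: S_of_def D_of_def mem_Times_iff)
  show "M_of j ms (i + 1) < M_of j ms i"
  proof (cases "i = j")
    case True
    then show ?thesis using ms_lists_pos[OF ms i] by (simp add: M_of_def)
  next
    case False
    have "sorted_wrt (>) ms" "length ms = j" using ms by (auto simp: ms_lists_def)
    then have "ms ! (i - 1) > ms ! i"
      using i False by (intro sorted_wrt_nth_less[of "(>)"]) auto
    then show ?thesis using i False by (simp add: M_of_def)
  qed
qed

lemma chain_less:
  fixes f :: "nat \<Rightarrow> nat"
  assumes "\<And>i. a \<le> i \<Longrightarrow> i < b \<Longrightarrow> f i < f (i + 1)"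
  shows "a \<le> i \<Longrightarrow> i < k \<Longrightarrow> k \<le> b \<Longrightarrow> f i < f k"
proof (induction k)
  case (Suc k)
  then show ?case using assms[of k] by (cases "i = k") auto
qed simp

lemma chain_greater:
  fixes f :: "nat \<Rightarrow> nat"
  assumes "\<And>i. a \<le> i \<Longrightarrow> i < b \<Longrightarrow> f (i + 1) < f i"
  shows "a \<le> i \<Longrightarrow> i < k \<Longrightarrow> k \<le> b \<Longrightarrow> f k < f i"
proof (induction k)
  case (Suc k)
  then show ?case using assms[of k] by (cases "i = k") auto
qed simp

text \<open>Interlacing passes from neighbours to all pairs, which gives strict monotonicity of the
  lists for \<open>rs\<close> and \<open>ms\<close>.\<close>

lemma encode_Gindex:
  assumes P: "pdata r j R S M D" and w: "(\<Sum>i=1..j. M i * D i) \<le> N"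
  shows "encode j R S M D \<in> Gindex N r j"
proof -
  obtain rs ms g where e: "encode j R S M D = (rs, ms, g)" by (cases "encode j R S M D")
  have last: "S (j + 1) = r + 1" "M (j + 1) = 0" "R 0 = 0" "R j \<le> r" using P by (auto simp: pdata_def)
  note d = decode_encode[OF e last(1,2)]
  have step: "R (i - 1) < S i" "S i \<le> R i" "M (i + 1) < M i" "0 < D i" if "i \<in> {1..j}" for i
    using P that by (auto simp only: pdata_def)
  have len: "length rs = j + 1" "length ms = j" and g: "g = restrict (\<lambda>i. (S i, D i)) {1..j}"
    using e by (auto simp: encode_def simp del: upt_Suc)
  have R: "R i < R k" if "i < k" "k \<le> j" for i k
  proof (rule chain_less[where f = R and a = 0 and b = j])
    fix i assume "i < j"
    then show "R i < R (i + 1)" using step(1,2)[of "i + 1"] by simp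
  qed (use that in auto)
  have M: "M k < M i" if "1 \<le> i" "i < k" "k \<le> j" for i k
    by (rule chain_greater[where f = M and a = 1 and b = j]) (use that step(3) in auto)
  have "rs \<in> rs_lists r j"
    unfolding rs_lists_def using last len d(1) R by (auto simp: sorted_wrt_iff_nth_less)
  moreover have nth: "ms ! i = M (i + 1)" if "i < j" for i
    using d(3)[of "i + 1"] that by (simp add: M_of_def)
  have "ms \<in> ms_lists j"
    unfolding ms_lists_def
  proof (intro CollectI conjI ballI)
    show "sorted_wrt (>) ms" using M len nth by (auto simp: sorted_wrt_iff_nth_less)
    fix m assume "m \<in> set ms"
    then obtain i where i: "i < j" "m = ms ! i" using len by (auto simp: in_set_conv_nth)
    then show "0 < m" using nth[OF i(1)] step(3)[of "i + 1"] by simp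
  qed (rule len(2))
  moreover have "g \<in> choices j rs {1..}"
    unfolding choices_def g
  proof (rule restrict_PiE_iff[THEN iffD2], rule ballI)
    fix i assume i: "i \<in> {1..j}"
    then have "rs ! (i - 1) = R (i - 1)" "rs ! i = R i" using d(1)[of "i - 1"] d(1)[of i] by auto
    then show "(S i, D i) \<in> {rs ! (i - 1) + 1..rs ! i} \<times> {1..}" using step[OF i] by simp
  qed
  moreover have "weight j ms g \<le> N"
  proof -
    have "weight j ms g = (\<Sum>i=1..j. M i * D i)"
      unfolding weight_def by (rule sum.cong[OF refl]) (use d(3,4) in simp)
    then show ?thesis using w by simp
  qed
  ultimately show ?thesis unfolding e Gindex_def by simp
qed

definition conj_index :: "nat \<Rightarrow> nat \<Rightarrow> nat list \<times> nat list \<times> (nat \<Rightarrow> nat \<times> nat) \<Rightarrow>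
    nat list \<times> nat list \<times> (nat \<Rightarrow> nat \<times> nat)" where
  "conj_index r j = (\<lambda>(rs, ms, g). encode j (conjR r j (S_of r j g)) (conjR r j ((!) rs))
     (conjM j (D_of g)) (conjD j (M_of j ms)))"

lemma conj_index_Gindex:
  assumes "x \<in> Gindex N r j"
  shows "conj_index r j x \<in> Gindex N r j"
proof -
  obtain rs ms g where x: "x = (rs, ms, g)" by (cases x)
  note P = pdata_Gindex[OF assms[unfolded x]]
  have "weight j ms g \<le> N" using assms by (simp add: x Gindex_def)
  then show ?thesis
    unfolding x conj_index_def prod.case
    by (intro encode_Gindex pdata_conj[OF P]) (simp only: pdata_weight[OF P] weight_def)
qed

text \<open>Decoding recovers exactly the values, sentinels included, that the second conjugation
  reads, so \<open>conj_conj\<close> carries over to encoded data.\<close>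

lemma conj_index_involution:
  assumes "x \<in> Gindex N r j"
  shows "conj_index r j (conj_index r j x) = x"
proof -
  obtain rs ms g where x: "x = (rs, ms, g)" by (cases x)
  have mem: "rs \<in> rs_lists r j" "ms \<in> ms_lists j" "g \<in> choices j rs {1..}"
    using assms by (auto simp: x Gindex_def)
  note P = pdata_Gindex[OF assms[unfolded x]]
  let ?R = "conjR r j (S_of r j g)" and ?S = "conjR r j ((!) rs)"
    and ?M = "conjM j (D_of g)" and ?D = "conjD j (M_of j ms)"
  note P' = pdata_conj[OF P]
  obtain rs' ms' g' where e: "conj_index r j x = (rs', ms', g')" by (cases "conj_index r j x")
  have last: "?S (j + 1) = r + 1" "?M (j + 1) = 0" using P' by (auto simp only: pdata_def)
  note d = decode_encode[OF e[unfolded x conj_index_def prod.case] last]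
  note c = conj_conj[OF P]
  have "conj_index r j (conj_index r j x) = encode j (conjR r j (S_of r j g')) (conjR r j ((!) rs'))
      (conjM j (D_of g')) (conjD j (M_of j ms'))"
    unfolding e by (simp add: conj_index_def)
  also have "\<dots> = encode j ((!) rs) (S_of r j g) (M_of j ms) (D_of g)"
  proof (rule encode_cong)
    fix i assume i: "i \<le> j"
    have "conjR r j (S_of r j g') i = conjR r j ?S i"
      unfolding conjR_def[of r j _ i] using i d(2)[of "j + 1 - i"] by simp
    then show "conjR r j (S_of r j g') i = rs ! i" using c(1)[OF i] by simp
  next
    fix i assume i: "1 \<le> i" "i \<le> j"
    have "conjR r j ((!) rs') i = conjR r j ?R i"
      unfolding conjR_def[of r j _ i] using i d(1)[of "j + 1 - i"] by simp
    then show "conjR r j ((!) rs') i = S_of r j g i" using c(2)[of i] i by simp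
    have "conjM j (D_of g') i = conjM j ?D i"
      unfolding conjM_def[of j _ i] by (rule sum.cong[OF refl]) (use i d(4) in auto)
    then show "conjM j (D_of g') i = M_of j ms i" using c(3)[of i] i by simp
    have "conjD j (M_of j ms') i = conjD j ?M i"
      unfolding conjD_def[of j _ i] using i d(3)[of "j + 1 - i"] d(3)[of "j + 2 - i"] by simp
    then show "conjD j (M_of j ms') i = D_of g i" using c(4)[of i] i by simp
  qed
  also have "\<dots> = x" unfolding x by (rule encode_decode[OF mem])
  finally show ?thesis .
qed

lemma swap_lterm:
  assumes "(rs, ms, g) \<in> Gindex N r j"
  shows "msubst (swap_map r) (lterm \<beta> r j rs ms g) =
    (case conj_index r j (rs, ms, g) of (rs', ms', g') \<Rightarrow> lterm \<beta> r j rs' ms' g')"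
proof -
  note P = pdata_Gindex[OF assms]
  let ?R = "conjR r j (S_of r j g)" and ?S = "conjR r j ((!) rs)"
    and ?M = "conjM j (D_of g)" and ?D = "conjD j (M_of j ms)"
  note P' = pdata_conj[OF P]
  obtain rs' ms' g' where e: "conj_index r j (rs, ms, g) = (rs', ms', g')"
    by (cases "conj_index r j (rs, ms, g)")
  have last: "?S (j + 1) = r + 1" "?M (j + 1) = 0" using P' by (auto simp only: pdata_def)
  note d = decode_encode[OF e[unfolded conj_index_def prod.case] last]
  have "msubst (swap_map r) (lterm \<beta> r j rs ms g) = gterm \<beta> r j ?R ?S ?M ?D"
    unfolding lterm_def by (rule swap_gterm[OF P])
  also have "\<dots> = lterm \<beta> r j rs' ms' g'"
    unfolding lterm_def by (rule gterm_cong) (simp_all only: d)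
  finally show ?thesis unfolding e by simp
qed

lemma mvars_Xext: "k \<ge> 1 \<Longrightarrow> mvars (Xext r k) \<subseteq> XY r"
  by (auto simp: Xext_def XY_def)

lemma mvars_lterm:
  assumes "(rs, ms, g) \<in> Gindex N r j"
  shows "mvars (lterm \<beta> r j rs ms g) \<subseteq> XY r"
proof -
  let ?R = "(!) rs" and ?S = "S_of r j g" and ?M = "M_of j ms" and ?D = "D_of g"
  note P = pdata_Gindex[OF assms]
  note B = pdata_bounds[OF P]
  have Y: "mvars (sY k :: (var, rat) mfps) \<subseteq> XY r" if "1 \<le> k" "k \<le> r" for k
    using that by (auto simp: XY_def)
  have Ys: "mvars (Ysum k :: (var, rat) mfps) \<subseteq> XY r" if "k \<le> r" for k
    unfolding Ysum_def using that by (intro mvars_sum Y) auto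
  have XX: "mvars (Xext r k - Xext r l :: (var, rat) mfps) \<subseteq> XY r" if "1 \<le> k" "1 \<le> l" for k l
    using that by (intro order_trans[OF mvars_minus] Un_least mvars_Xext)
  have L: "mvars (gapL \<beta> r a c) \<subseteq> XY r" if "a < c" "c \<le> r + 1" for a c
    unfolding gapL_def by (intro mvars_b_ev XX Y) (use that in auto)
  have R: "mvars (gapR \<beta> r s t) \<subseteq> XY r" if "1 \<le> s" "s \<le> t" "t \<le> r" for s t
    unfolding gapR_def by (intro mvars_bt_ev XX Y) (use that in auto)
  have "mvars (\<Prod>i=1..j + 1. gapL \<beta> r (?R (i - 1)) (?S i)) \<subseteq> XY r"
    by (intro mvars_prod L) (use B(2,3) in auto)
  moreover have "mvars (\<Prod>i=1..j. gapR \<beta> r (?S i) (?R i)) \<subseteq> XY r"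
  proof (intro mvars_prod R)
    fix i assume "i \<in> {1..j}"
    then show "1 \<le> ?S i" "?S i \<le> ?R i" "?R i \<le> r" using B(1)[of i] B(3)[of i] B(4)[of i] by auto
  qed
  moreover have "mvars (mexp (expo r j ?R ?S ?M ?D)) \<subseteq> XY r"
  proof (rule order_trans[OF mvars_mexp], unfold expo_def, rule mvars_sum)
    fix i assume i: "i \<in> {1..j}"
    then have b: "1 \<le> ?S i" "?R i \<le> r" "?R (i - 1) \<le> r" using B(1)[of i] B(1)[of "i - 1"] B(3)[of i] by auto
    show "mvars (of_nat (?D i) * Xext r (?S i) + of_nat (?M i) * (Ysum (?R i) - Ysum (?R (i - 1))) :: (var, rat) mfps) \<subseteq> XY r"
      using mvars_Xext[OF b(1)] Ys[OF b(2)] Ys[OF b(3)]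
      by (intro mvars_add[THEN order_trans] mvars_mult[THEN order_trans] mvars_minus[THEN order_trans] Un_least)
        simp_all
  qed
  ultimately show ?thesis
    unfolding lterm_def gterm_def
    by (intro mvars_mult[THEN order_trans] Un_least, unfold mvars_to_q mvars_mconst)
      (intro mvars_mult[THEN order_trans] Un_least empty_subsetI; assumption)+
qed

text \<open>The truncation \<open>E N\<close> is exactly invariant, not only up to congruence,
  because conjugation permutes its index set. Substitution respects congruence, so the invariance of
  \<open>bm_G\<close> holds modulo every power of q.\<close>

lemma swap_bm_G:
  assumes j: "1 \<le> j" "j \<le> r"
  shows "mvars (bm_G \<beta> j r) \<subseteq> XY r" and "msubst (swap_map r) (bm_G \<beta> j r) = bm_G \<beta> j r"
proof -
  define E where "E N = (\<Sum>(rs, ms, g)\<in>Gindex N r j. lterm \<beta> r j rs ms g)" for N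
  have G: "qcong N (bm_G \<beta> j r) (E N)" for N
    unfolding E_def by (rule qcong_bm_G[OF j])
  have mt: "mvars (case x of (rs, ms, g) \<Rightarrow> lterm \<beta> r j rs ms g) \<subseteq> XY r" if "x \<in> Gindex N r j" for x N
    using that mvars_lterm by (cases x) auto
  have E: "mvars (E N) \<subseteq> XY r" for N
    unfolding E_def by (rule mvars_sum) (rule mt)
  show mG: "mvars (bm_G \<beta> j r) \<subseteq> XY r"
    by (rule mvars_qcong) (use G E in blast)
  show "msubst (swap_map r) (bm_G \<beta> j r) = bm_G \<beta> j r"
  proof (rule qcong_imp_eq)
    fix N
    have "msubst (swap_map r) (E N) = (\<Sum>x\<in>Gindex N r j. msubst (swap_map r) (case x of (rs, ms, g) \<Rightarrow> lterm \<beta> r j rs ms g))"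
      unfolding E_def
      by (rule msubst_sum, simp, rule finite_subset[OF mt finite_XY])
    also have "\<dots> = E N"
      unfolding E_def
    proof (rule sum.reindex_bij_witness[where i = "conj_index r j" and j = "conj_index r j"])
      fix x assume "x \<in> Gindex N r j"
      then show "(case conj_index r j x of (rs, ms, g) \<Rightarrow> lterm \<beta> r j rs ms g) =
          msubst (swap_map r) (case x of (rs, ms, g) \<Rightarrow> lterm \<beta> r j rs ms g)"
        by (cases x) (simp add: swap_lterm)
    qed (auto intro: conj_index_involution conj_index_Gindex)
    finally have swapE: "msubst (swap_map r) (E N) = E N" .
    have "qcong N (msubst (swap_map r) (bm_G \<beta> j r)) (msubst (swap_map r) (E N))"
      by (rule qcong_msubst[OF G _ finite_subset[OF mG finite_XY] finite_subset[OF E finite_XY]]) simp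
    then show "qcong N (msubst (swap_map r) (bm_G \<beta> j r)) (bm_G \<beta> j r)"
      unfolding swapE using qcong_sym[OF G] by (rule qcong_trans)
  qed
qed

text \<open>\<open>bm_b\<close> is the single left gap from 0 to r + 1, which reflection maps to
  itself.\<close>

lemma swap_bm_b: "msubst (swap_map r) (bm_b \<beta> r) = bm_b \<beta> r"
proof -
  have "bm_b \<beta> r = b_ev \<beta> r sX sY"
    by (subst b_ev_eq) (auto simp: bm_b_mould_ev)
  also have "\<dots> = gapL \<beta> r 0 (r + 1)"
    unfolding gapL_def by (simp, intro b_ev_cong) (auto simp: Xext_def)
  finally have "bm_b \<beta> r = gapL \<beta> r 0 (r + 1)" .
  then show ?thesis by (simp add: swap_gapL)
qed

lemma bimould_at_swap:
  assumes "r \<ge> 1" "mvars (B r) \<subseteq> XY r"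
  shows "bimould_at B (map (\<lambda>k. \<Sum>l=1..k. sY l) (rev [1..<r + 1]))
     (sX r # map (\<lambda>k. sX k - sX (k + 1)) (rev [1..<r])) = msubst (swap_map r) (B r)"
proof -
  \<comment> \<open>The isolated entry X_r becomes the case i = 1 of the uniform pattern, since
    \<open>Xext r (r + 1) = 0\<close>.\<close>
  have ys: "sX r # map (\<lambda>k. sX k - sX (k + 1)) (rev [1..<r]) =
      map (\<lambda>i. Xext r (r + 1 - i) - Xext r (r + 2 - i)) [1..<r + 1]"
  proof (rule nth_equalityI)
    fix i assume "i < length (sX r # map (\<lambda>k. sX k - sX (k + 1)) (rev [1..<r]))"
    then have i: "i < r" using assms(1) by simp
    show "(sX r # map (\<lambda>k. sX k - sX (k + 1)) (rev [1..<r])) ! i =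
        map (\<lambda>i. Xext r (r + 1 - i) - Xext r (r + 2 - i)) [1..<r + 1] ! i"
      using i by (cases i) (auto simp: Xext_def rev_nth Suc_diff_Suc simp del: upt_Suc)
  qed (use assms in simp)
  show ?thesis
    unfolding ys map_rev_upt_1 bimould_at_map[of B, OF assms(2)] swap_map_def Ysum_def ..
qed

theorem theorem6p26:
  fixes \<beta> :: "nat list \<Rightarrow> rat"
  assumes depth0: "\<beta> [] = 1"
    and depth1: "Abs_fps (\<lambda>n. \<beta> [n + 1]) =
        - Abs_fps (\<lambda>n. if n + 1 \<ge> 2 then bernoulli_num (n + 1) / (2 * fact (n + 1)) else 0)"
    and stuffle: "qsh_hom stuffle_diamond \<beta>"
    and shuffle: "qsh_hom shuffle_diamond (mould_coeff (beta_gam \<beta>))"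
  shows "\<forall>j. swap_invariant (bm_G \<beta> j)"
  unfolding swap_invariant_def
proof (intro allI impI)
  fix j r :: nat
  assume r: "r \<ge> 1"
  have "mvars (bm_G \<beta> j r) \<subseteq> XY r \<and> msubst (swap_map r) (bm_G \<beta> j r) = bm_G \<beta> j r"
  proof (cases "1 \<le> j \<and> j \<le> r")
    case True
    then show ?thesis using swap_bm_G by blast
  next
    case False
    then consider "j = 0" | "j > r" "j \<noteq> 0" by linarith
    then show ?thesis
    proof cases
      case 1
      have "msubst (swap_map r) (to_q (bm_b \<beta> r)) = to_q (bm_b \<beta> r)"
        unfolding to_q_swap_map[symmetric] msubst_to_q swap_bm_b ..
      then show ?thesis using mvars_bm_b by (simp add: 1 bm_G_def)
    next
      case 2
      then show ?thesis by (simp add: bm_G_def)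
    qed
  qed
  then show "bm_G \<beta> j r = bimould_at (bm_G \<beta> j) (map (\<lambda>k. \<Sum>l=1..k. sY l) (rev [1..<r + 1]))
      (sX r # map (\<lambda>k. sX k - sX (k + 1)) (rev [1..<r]))"
    using bimould_at_swap[OF r, of "bm_G \<beta> j"] by simp
qed

end
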